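(* Let $\Gamma$ be a countable group and let $X$ be a cocompact $\Gamma$-CW-complex. Let $D$ be a fundamental domain for the action of $\Gamma$ on $X$. Let $k\ge 0$ and let $H$ be a $\Gamma$-invariant closed subspace of $C^{(2)}_k(X)$. Then $$\mathbf E^H\big[|\mathfrak F\cap D|\big]=\dim_\Gamma H .$$ In particular, $$\mathbf E^k_{\mathrm F}\big[|\mathfrak F\cap D|\big]-\mathbf E_k^{\mathrm W}\big[|\mathfrak F\cap D|\big]=\beta_k(X;\Gamma).$$
   Context: All cells are oriented and all chains are cellular with complex coefficients. $\Xi_kX$ is the set of $k$-cells of $X$; $\partial_k$ is the boundary map and $\delta_k=\partial_{k+1}^*$ the coboundary map. A cocompact $\Gamma$-CW-complex is a CW-complex $X$ on which $\Gamma$ acts freely by permutation of cells (the stabilizer of each unoriented cell is trivial) with $X/\Gamma$ compact. A fundamental domain $D$ is a set of cells containing exactly one cell from each $\Gamma$-orbit. $C^{(2)}_k(X)=\ell^2(\Xi_kX)$, with the $k$-cells as orthonormal basis, is a Hilbert $\Gamma$-module, and $\dim_\Gamma$ denotes von Neumann dimension with respect to $\Gamma$. $k$-cochains are identified with $k$-chains through this inner product. The $k$th $\ell^2$-Betti number is $\beta_k(X;\Gamma)=\dim_\Gamma\mathcal H^{(2)}_k(X)$, where $\mathcal H^{(2)}_k(X)=\{u\in C^{(2)}_k(X):\partial_ku=0,\ \delta_ku=0\}$ is the space of harmonic $\ell^2$-$k$-chains (isomorphic to the reduced $k$th $\ell^2$-homology of $X$). For a closed subspace $H\subseteq\ell^2(E)$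 ($E$ countable) with orthogonal projection having matrix $Q_H$ in the standard basis, $\mathbf P^H$ is the unique probability measure on subsets of $E$ such that a random set $\mathfrak F\sim\mathbf P^H$ satisfies $\mathbf P^H[S\subseteq\mathfrak F]=\det[Q_H]_{S,S}$ for all finite $S\subseteq E$; $\mathbf E^H$ is its expectation. Here $E=\Xi_kX$, so $|\mathfrak F\cap D|$ counts the $k$-cells of $D$ that belong to $\mathfrak F$. $\mathbf E_{\mathrm F}^k$ and $\mathbf E^{\mathrm W}_k$ are the expectations for $\mathbf P_{\mathrm F}^k$ and $\mathbf P^{\mathrm W}_k$, the determinantal measures on subsets of $\Xi_kX$ corresponding respectively to the subspaces $B_k(X)^\perp$ and $\overline{B^k_c(X)}$ of $\ell^2(\Xi_kX)$, where $B_k(X)=\partial_{k+1}C_{k+1}(X)$ is the space of boundaries of finitely supported $(k+1)$-chains and $B^k_c(X)$ is the space of coboundaries $\delta_{k-1}u$ of finitely supported $(k-1)$-cochains $u$. *)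

theory Defs
  imports
    "HOL-Probability.Probability"
    "HOL-Homology.Homology"
    "HOL-Algebra.Group_Action"
begin

section \<open>CW-complexes\<close>

definition disc :: "nat \<Rightarrow> (nat \<Rightarrow> real) topology" where
  "disc n = subtopology (Euclidean_space n) {x. (\<Sum>i<n. (x i)\<^sup>2) \<le> 1}"

definition disc_bdry :: "nat \<Rightarrow> (nat \<Rightarrow> real) set" where
  "disc_bdry n = {x \<in> topspace (disc n). (\<Sum>i<n. (x i)\<^sup>2) = 1}"

definition open_disc :: "nat \<Rightarrow> (nat \<Rightarrow> real) topology" where
  "open_disc n = subtopology (Euclidean_space n) {x. (\<Sum>i<n. (x i)\<^sup>2) < 1}"

text \<open>The cells are the open cells, as subsets of the space. The characteristic map of a cell
  also fixes its orientation.\<close>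

record 'a cw_complex =
  cw_top :: "'a topology"
  cells :: "nat \<Rightarrow> 'a set set"
  char_map :: "'a set \<Rightarrow> (nat \<Rightarrow> real) \<Rightarrow> 'a"

definition all_cells :: "'a cw_complex \<Rightarrow> 'a set set" where
  "all_cells K = (\<Union>n. cells K n)"

definition is_cw_complex :: "'a cw_complex \<Rightarrow> bool" where
  "is_cw_complex K \<longleftrightarrow>
     Hausdorff_space (cw_top K) \<and>
     topspace (cw_top K) = \<Union> (all_cells K) \<and>
     disjoint (all_cells K) \<and>
     (\<forall>m n. m \<noteq> n \<longrightarrow> cells K m \<inter> cells K n = {}) \<and>
     (\<forall>n. \<forall>e \<in> cells K n.
        continuous_map (disc n) (cw_top K) (char_map K e) \<and>
        homeomorphic_map (open_disc n) (subtopology (cw_top K) e) (char_map K e) \<and>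
        (\<exists>F. finite F \<and> F \<subseteq> (\<Union>m<n. cells K m) \<and> char_map K e ` disc_bdry n \<subseteq> \<Union>F)) \<and>
     (\<forall>A \<subseteq> topspace (cw_top K).
        (\<forall>n. \<forall>e \<in> cells K n. closedin (disc n) {x \<in> topspace (disc n). char_map K e x \<in> A})
        \<longrightarrow> closedin (cw_top K) A)"

text \<open>The index is an integer so that the skeleton of index \<open>-1\<close> is empty.\<close>

definition skel_set :: "'a cw_complex \<Rightarrow> int \<Rightarrow> 'a set" where
  "skel_set K p = (\<Union>n \<in> {n. int n \<le> p}. \<Union> (cells K n))"

definition skel :: "'a cw_complex \<Rightarrow> int \<Rightarrow> 'a topology" where
  "skel K p = subtopology (cw_top K) (skel_set K p)"


section \<open>Cellular chains\<close>

text \<open>The integral cellular chain group in degree \<open>n\<close> is the singular homology group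
  \<open>H\<^sub>n(X\<^sup>n, X\<^sup>n\<^sup>-\<^sup>1)\<close>. It is free abelian on the classes of the \<open>n\<close>-cells, where the
  class of a cell is the image under its characteristic map of a generator of the infinite
  cyclic group \<open>H\<^sub>n(D\<^sup>n, S\<^sup>n\<^sup>-\<^sup>1)\<close>, fixed once and for all.\<close>

definition cell_group :: "'a cw_complex \<Rightarrow> nat \<Rightarrow> 'a chain set monoid" where
  "cell_group K n = relative_homology_group (int n) (skel K (int n)) (skel_set K (int n - 1))"

definition disc_class :: "nat \<Rightarrow> (nat \<Rightarrow> real) chain set" where
  "disc_class n =
     (let G = relative_homology_group (int n) (disc n) (disc_bdry n)
      in SOME c. c \<in> carrier G \<and> subgroup_generated G {c} = G)"

definition cell_class :: "'a cw_complex \<Rightarrow> nat \<Rightarrow> 'a set \<Rightarrow> 'a chain set" where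
  "cell_class K n e =
     hom_induced (int n) (disc n) (disc_bdry n) (skel K (int n)) (skel_set K (int n - 1))
       (char_map K e) (disc_class n)"

text \<open>Coordinates in the basis of cells; the group is written multiplicatively in the library.\<close>

definition cell_coords :: "'a cw_complex \<Rightarrow> nat \<Rightarrow> 'a chain set \<Rightarrow> 'a set \<Rightarrow> int" where
  "cell_coords K n z =
     (THE c. finite {e. c e \<noteq> 0} \<and> {e. c e \<noteq> 0} \<subseteq> cells K n \<and>
        z = finprod (cell_group K n) (\<lambda>e. cell_class K n e [^]\<^bsub>cell_group K n\<^esub> (c e :: int))
              {e. c e \<noteq> 0})"

text \<open>\<open>incidence K n e f\<close> is the coefficient of the \<open>n\<close>-cell \<open>f\<close> in the boundary of the
  \<open>(n+1)\<close>-cell \<open>e\<close>. The library map \<open>hom_relboundary\<close> is the connecting homomorphism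
  \<open>H\<^sub>n\<^sub>+\<^sub>1(X\<^sup>n\<^sup>+\<^sup>1, X\<^sup>n) \<rightarrow> H\<^sub>n(X\<^sup>n, X\<^sup>n\<^sup>-\<^sup>1)\<close> of the triple.\<close>

definition incidence :: "'a cw_complex \<Rightarrow> nat \<Rightarrow> 'a set \<Rightarrow> 'a set \<Rightarrow> int" where
  "incidence K n e f =
     cell_coords K n
       (hom_relboundary (int (Suc n)) (skel K (int (Suc n)))
          (skel_set K (int n)) (skel_set K (int n - 1)) (cell_class K (Suc n) e)) f"

text \<open>Complex chains are complex functions on the set of all cells that vanish off the cells of
  the relevant dimension. In a complex with a cocompact free action every cell is incident to only
  finitely many cells, so the sums in \<open>bdry\<close> and \<open>cobdry\<close> have finitely many nonzero terms
  for arbitrary chains. The incidence numbers being real, the adjoint of the boundary is given by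
  the transposed matrix.\<close>

fun bdry :: "'a cw_complex \<Rightarrow> nat \<Rightarrow> ('a set \<Rightarrow> complex) \<Rightarrow> 'a set \<Rightarrow> complex" where
  "bdry K 0 u = (\<lambda>_. 0)"
| "bdry K (Suc n) u =
     (\<lambda>f. if f \<in> cells K n then \<Sum>\<^sub>\<infinity>e\<in>cells K (Suc n). of_int (incidence K n e f) * u e else 0)"

definition cobdry :: "'a cw_complex \<Rightarrow> nat \<Rightarrow> ('a set \<Rightarrow> complex) \<Rightarrow> 'a set \<Rightarrow> complex" where
  "cobdry K n u =
     (\<lambda>e. if e \<in> cells K (Suc n) then \<Sum>\<^sub>\<infinity>f\<in>cells K n. of_int (incidence K n e f) * u f else 0)"

definition fin_chains :: "'a cw_complex \<Rightarrow> nat \<Rightarrow> ('a set \<Rightarrow> complex) set" where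
  "fin_chains K n = {u. finite {e. u e \<noteq> 0} \<and> {e. u e \<noteq> 0} \<subseteq> cells K n}"

definition boundary_space :: "'a cw_complex \<Rightarrow> nat \<Rightarrow> ('a set \<Rightarrow> complex) set" where
  "boundary_space K k = bdry K (Suc k) ` fin_chains K (Suc k)"

definition coboundary_space :: "'a cw_complex \<Rightarrow> nat \<Rightarrow> ('a set \<Rightarrow> complex) set" where
  "coboundary_space K k = (case k of 0 \<Rightarrow> {\<lambda>_. 0} | Suc j \<Rightarrow> cobdry K j ` fin_chains K j)"


section \<open>Group actions on CW-complexes\<close>

definition orbit_space :: "('g, 'm) monoid_scheme \<Rightarrow> 'a topology \<Rightarrow> ('g \<Rightarrow> 'a \<Rightarrow> 'a) \<Rightarrow> 'a set topology"
  where "orbit_space G X \<phi> =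
    topology (\<lambda>U. U \<subseteq> orbits G (topspace X) \<phi> \<and> openin X {x \<in> topspace X. orbit G \<phi> x \<in> U})"

lemma openin_orbit_space:
  "openin (orbit_space G X \<phi>) U \<longleftrightarrow>
     U \<subseteq> orbits G (topspace X) \<phi> \<and> openin X {x \<in> topspace X. orbit G \<phi> x \<in> U}"
proof -
  let ?T = "\<lambda>U. U \<subseteq> orbits G (topspace X) \<phi> \<and> openin X {x \<in> topspace X. orbit G \<phi> x \<in> U}"
  have "?T (S \<inter> T)" if "?T S" "?T T" for S T
  proof -
    have "{x \<in> topspace X. orbit G \<phi> x \<in> S \<inter> T} =
        {x \<in> topspace X. orbit G \<phi> x \<in> S} \<inter> {x \<in> topspace X. orbit G \<phi> x \<in> T}" by auto
    with that show ?thesis by auto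
  qed
  moreover have "?T (\<Union>\<K>)" if "\<forall>S\<in>\<K>. ?T S" for \<K>
  proof -
    have "{x \<in> topspace X. orbit G \<phi> x \<in> \<Union>\<K>} =
        (\<Union>S\<in>\<K>. {x \<in> topspace X. orbit G \<phi> x \<in> S})" by auto
    moreover have "openin X (\<Union>S\<in>\<K>. {x \<in> topspace X. orbit G \<phi> x \<in> S})"
      by (rule openin_Union) (use that in auto)
    ultimately show ?thesis using that by auto
  qed
  ultimately have "istopology ?T" unfolding istopology_def by blast
  then show ?thesis by (simp add: orbit_space_def)
qed

definition cocompact_cw_complex ::
  "('g, 'm) monoid_scheme \<Rightarrow> 'a cw_complex \<Rightarrow> ('g \<Rightarrow> 'a \<Rightarrow> 'a) \<Rightarrow> bool" where
  "cocompact_cw_complex G K \<phi> \<longleftrightarrow>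
     is_cw_complex K \<and>
     group_action G (topspace (cw_top K)) \<phi> \<and>
     (\<forall>g \<in> carrier G. continuous_map (cw_top K) (cw_top K) (\<phi> g)) \<and>
     (\<forall>g \<in> carrier G. \<forall>n. \<forall>e \<in> cells K n. \<phi> g ` e \<in> cells K n) \<and>
     (\<forall>g \<in> carrier G. \<forall>e \<in> all_cells K. \<phi> g ` e = e \<longrightarrow> g = \<one>\<^bsub>G\<^esub>) \<and>
     compact_space (orbit_space G (cw_top K) \<phi>)"

definition fundamental_domain ::
  "('g, 'm) monoid_scheme \<Rightarrow> 'a cw_complex \<Rightarrow> ('g \<Rightarrow> 'a \<Rightarrow> 'a) \<Rightarrow> 'a set set \<Rightarrow> bool" where
  "fundamental_domain G K \<phi> D \<longleftrightarrow>
     D \<subseteq> all_cells K \<and> (\<forall>e \<in> all_cells K. \<exists>!d. d \<in> D \<and> (\<exists>g \<in> carrier G. e = \<phi> g ` d))"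

text \<open>The linear extension of the map induced by \<open>g\<close> on the cellular chain group. It sends a cell
  \<open>e\<close> to plus or minus the cell \<open>\<phi> g ` e\<close>, according to whether \<open>\<phi> g\<close> respects the chosen
  orientations of these cells, which are not required to be invariant.\<close>

definition chain_action ::
  "'a cw_complex \<Rightarrow> ('g \<Rightarrow> 'a \<Rightarrow> 'a) \<Rightarrow> nat \<Rightarrow> 'g \<Rightarrow> ('a set \<Rightarrow> complex) \<Rightarrow> 'a set \<Rightarrow> complex" where
  "chain_action K \<phi> n g u =
     (\<lambda>f. if f \<in> cells K n then
        \<Sum>\<^sub>\<infinity>e\<in>cells K n.
          of_int (cell_coords K n
            (hom_induced (int n) (skel K (int n)) (skel_set K (int n - 1))
               (skel K (int n)) (skel_set K (int n - 1)) (\<phi> g) (cell_class K n e)) f) * u e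
      else 0)"


section \<open>Complex square-summable functions\<close>

definition ell2 :: "'e set \<Rightarrow> ('e \<Rightarrow> complex) set" where
  "ell2 E = {u. (\<forall>x. x \<notin> E \<longrightarrow> u x = 0) \<and> (\<lambda>x. (cmod (u x))\<^sup>2) summable_on UNIV}"

definition ell2_inner :: "('e \<Rightarrow> complex) \<Rightarrow> ('e \<Rightarrow> complex) \<Rightarrow> complex" where
  "ell2_inner u v = (\<Sum>\<^sub>\<infinity>x. u x * cnj (v x))"

definition ell2_norm :: "('e \<Rightarrow> complex) \<Rightarrow> real" where
  "ell2_norm u = sqrt (\<Sum>\<^sub>\<infinity>x. (cmod (u x))\<^sup>2)"

definition ell2_closure :: "'e set \<Rightarrow> ('e \<Rightarrow> complex) set \<Rightarrow> ('e \<Rightarrow> complex) set" where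
  "ell2_closure E A =
     {v \<in> ell2 E. \<exists>s. (\<forall>n. s n \<in> A) \<and> (\<lambda>n::nat. ell2_norm (\<lambda>x. s n x - v x)) \<longlonglongrightarrow> 0}"

definition orth_complement :: "'e set \<Rightarrow> ('e \<Rightarrow> complex) set \<Rightarrow> ('e \<Rightarrow> complex) set" where
  "orth_complement E A = {v \<in> ell2 E. \<forall>w \<in> A. ell2_inner v w = 0}"

definition closed_subspace :: "'e set \<Rightarrow> ('e \<Rightarrow> complex) set \<Rightarrow> bool" where
  "closed_subspace E H \<longleftrightarrow>
     H \<subseteq> ell2 E \<and> (\<lambda>_. 0) \<in> H \<and>
     (\<forall>u \<in> H. \<forall>v \<in> H. (\<lambda>x. u x + v x) \<in> H) \<and>
     (\<forall>c. \<forall>u \<in> H. (\<lambda>x. c * u x) \<in> H) \<and>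
     ell2_closure E H \<subseteq> H"

definition orth_proj :: "('e \<Rightarrow> complex) set \<Rightarrow> ('e \<Rightarrow> complex) \<Rightarrow> 'e \<Rightarrow> complex" where
  "orth_proj H u = (THE v. v \<in> H \<and> (\<forall>w \<in> H. ell2_inner (\<lambda>x. u x - v x) w = 0))"

definition proj_matrix :: "('e \<Rightarrow> complex) set \<Rightarrow> 'e \<Rightarrow> 'e \<Rightarrow> complex" where
  "proj_matrix H x y = orth_proj H (\<lambda>z. if z = y then 1 else 0) x"


section \<open>Determinantal probability measures\<close>

definition minor_det :: "('e \<Rightarrow> 'e \<Rightarrow> complex) \<Rightarrow> 'e set \<Rightarrow> complex" where
  "minor_det Q S = (\<Sum>p | p permutes S. of_int (sign p) * (\<Prod>i\<in>S. Q i (p i)))"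

definition is_determinantal_measure ::
  "'e set \<Rightarrow> ('e \<Rightarrow> complex) set \<Rightarrow> 'e set measure \<Rightarrow> bool" where
  "is_determinantal_measure E H P \<longleftrightarrow>
     prob_space P \<and> space P = Pow E \<and>
     sets P = sigma_sets (Pow E) {{F \<in> Pow E. x \<in> F} | x. x \<in> E} \<and>
     (\<forall>S. finite S \<and> S \<subseteq> E \<longrightarrow>
        complex_of_real (measure P {F \<in> Pow E. S \<subseteq> F}) = minor_det (proj_matrix H) S)"


section \<open>Von Neumann dimension\<close>

definition left_translation ::
  "('g, 'm) monoid_scheme \<Rightarrow> 'g \<Rightarrow> ('g \<times> nat \<Rightarrow> complex) \<Rightarrow> 'g \<times> nat \<Rightarrow> complex" where
  "left_translation G g v =
     (\<lambda>(x, i). if x \<in> carrier G then v (inv\<^bsub>G\<^esub> g \<otimes>\<^bsub>G\<^esub> x, i) else 0)"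

definition invariant_under ::
  "('g, 'm) monoid_scheme \<Rightarrow> ('g \<Rightarrow> 'v \<Rightarrow> 'v) \<Rightarrow> 'v set \<Rightarrow> bool" where
  "invariant_under G L H \<longleftrightarrow> (\<forall>g \<in> carrier G. \<forall>u \<in> H. L g u \<in> H)"

text \<open>\<open>T\<close> embeds the Hilbert module \<open>H\<close>, on which \<open>G\<close> acts by \<open>L\<close>, into the direct sum
  \<open>\<ell>\<^sup>2(G)\<^sup>n\<close>, realized as \<open>\<ell>\<^sup>2(G \<times> {0,\<dots>,n-1})\<close>.\<close>

definition module_embedding ::
  "('g, 'm) monoid_scheme \<Rightarrow> ('g \<Rightarrow> ('e \<Rightarrow> complex) \<Rightarrow> 'e \<Rightarrow> complex) \<Rightarrow> ('e \<Rightarrow> complex) set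
    \<Rightarrow> nat \<Rightarrow> (('e \<Rightarrow> complex) \<Rightarrow> 'g \<times> nat \<Rightarrow> complex) \<Rightarrow> bool" where
  "module_embedding G L H n T \<longleftrightarrow>
     T ` H \<subseteq> ell2 (carrier G \<times> {..<n}) \<and>
     (\<forall>u \<in> H. \<forall>v \<in> H. T (\<lambda>x. u x + v x) = (\<lambda>y. T u y + T v y)) \<and>
     (\<forall>c. \<forall>u \<in> H. T (\<lambda>x. c * u x) = (\<lambda>y. c * T u y)) \<and>
     (\<forall>u \<in> H. ell2_norm (T u) = ell2_norm u) \<and>
     (\<forall>g \<in> carrier G. \<forall>u \<in> H. T (L g u) = left_translation G g (T u))"

text \<open>The dimension is the von Neumann trace of the projection onto the image of any embedding;
  it does not depend on the embedding.\<close>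

definition vn_dim ::
  "('g, 'm) monoid_scheme \<Rightarrow> ('g \<Rightarrow> ('e \<Rightarrow> complex) \<Rightarrow> 'e \<Rightarrow> complex) \<Rightarrow> ('e \<Rightarrow> complex) set \<Rightarrow> real"
  where "vn_dim G L H =
    (THE d. \<exists>n T. module_embedding G L H n T \<and>
       complex_of_real d = (\<Sum>i<n. proj_matrix (T ` H) (\<one>\<^bsub>G\<^esub>, i) (\<one>\<^bsub>G\<^esub>, i)))"


section \<open>Harmonic chains and Betti numbers\<close>

definition harmonic_chains :: "'a cw_complex \<Rightarrow> nat \<Rightarrow> ('a set \<Rightarrow> complex) set" where
  "harmonic_chains K k =
     {u \<in> ell2 (cells K k). bdry K k u = (\<lambda>_. 0) \<and> cobdry K k u = (\<lambda>_. 0)}"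

definition l2_betti ::
  "('g, 'm) monoid_scheme \<Rightarrow> 'a cw_complex \<Rightarrow> ('g \<Rightarrow> 'a \<Rightarrow> 'a) \<Rightarrow> nat \<Rightarrow> real" where
  "l2_betti G K \<phi> k = vn_dim G (chain_action K \<phi> k) (harmonic_chains K k)"

end

theory Submission
  imports Defs
begin

text \<open>Write \<open>Q\<^sub>H\<close> for the matrix of the projection onto \<open>H\<close>. Compactness of the orbit space makes
  the set of \<open>k\<close>-cells in \<open>D\<close> finite, so the expectation is the sum of \<open>Q\<^sub>H(e, e)\<close> over these
  cells. Since the action is free, the cells in \<open>D\<close> identify \<open>\<ell>\<^sup>2\<close> of the \<open>k\<close>-cells with a finite
  direct sum of copies of \<open>\<ell>\<^sup>2(\<Gamma>)\<close>, up to the signs by which group elements change orientations,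
  and the same sum becomes the von Neumann trace.

  For the second claim, incidence numbers are equivariant up to these signs, hence locally finite, and
  the harmonic chains form the orthogonal complement of the closure of \<open>B\<^sup>k\<^sub>c\<close> in \<open>B\<^sub>k\<^sup>\<bottom>\<close>; the traces of
  the projections subtract accordingly.

  That the cell classes are a basis of their span in \<open>H\<^sub>n(X\<^sup>n, X\<^sup>n\<^sup>-\<^sup>1)\<close>, which contains all
  boundaries and all translates of cell classes, follows by attaching one cell at a time.\<close>


section \<open>Discs and attached cells\<close>

text \<open>\<open>cell_coords\<close>, \<open>disc_class\<close>, \<open>orth_proj\<close> and
  \<open>vn_dim\<close> are given by description operators, so nothing can be computed from them
  before existence and, for \<open>THE\<close>, uniqueness are settled; this shapes the development.
  Coordinates are needed only for elements carried by finitely many cells, which finite induction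
  reaches. Their uniqueness concerns possibly infinitely many cells and comes from collapsing all
  cells but one, which leaves an infinite cyclic group. For the dimension, uniqueness means that any
  two embeddings, of possibly different rank, have the same trace; the comparison goes through
  vectors of the module itself that represent the coordinate functions of each embedding.

  The chosen orientations need not be invariant, so the group acts on chains by signed permutations.
  A sign is at first only an integer, the exponent in a cyclic group; the cocycle identity makes it
  a unit. Signs have modulus 1 and leave the diagonal entries of projections unchanged, which is why
  the sum over \<open>D\<close> is still the trace.\<close>

abbreviation sqn :: "nat \<Rightarrow> (nat \<Rightarrow> real) \<Rightarrow> real" where
  "sqn n x \<equiv> \<Sum>i<n. (x i)\<^sup>2"

lemma topspace_disc: "topspace (disc n) = {x. (\<forall>i\<ge>n. x i = 0) \<and> sqn n x \<le> 1}"
  by (auto simp: disc_def topspace_Euclidean_space)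

lemma disc_bdry_eq: "disc_bdry n = {x. (\<forall>i\<ge>n. x i = 0) \<and> sqn n x = 1}"
  by (auto simp: disc_bdry_def topspace_disc)

text \<open>Coordinates become projections of a product, so continuity into a disc can be checked
  one coordinate at a time.\<close>

lemma disc_powertop: "disc n = subtopology (powertop_real UNIV) (topspace (disc n))"
  unfolding topspace_disc unfolding disc_def Euclidean_space_def subtopology_subtopology
  by (rule arg_cong2[where f=subtopology]) auto

lemma open_disc_subtopology: "open_disc n = subtopology (disc n) (topspace (disc n) - disc_bdry n)"
  unfolding topspace_disc disc_bdry_eq unfolding open_disc_def disc_def Euclidean_space_def
      subtopology_subtopology
  by (rule arg_cong2[where f=subtopology]) auto

lemma continuous_map_disc_coord: "continuous_map (disc n) euclideanreal (\<lambda>x. x i)"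
  by (subst disc_powertop) (auto intro: continuous_map_from_subtopology continuous_map_product_projection)

lemma continuous_map_into_disc:
  assumes "\<And>i. continuous_map X euclideanreal (\<lambda>x. f x i)" "\<And>x. x \<in> topspace X \<Longrightarrow> f x \<in> topspace (disc n)"
  shows "continuous_map X (disc n) f"
  by (subst disc_powertop, rule continuous_map_into_subtopology)
     (use assms in \<open>auto simp: continuous_map_componentwise_UNIV\<close>)

lemma continuous_map_sqn: "continuous_map (disc n) euclideanreal (sqn n)"
  by (intro continuous_map_sum continuous_map_disc_coord continuous_intros) auto

lemma Hausdorff_disc: "Hausdorff_space (disc n)"
  by (subst disc_powertop) (auto intro!: Hausdorff_space_subtopology simp: Hausdorff_space_product_topology)

text \<open>The disc is a closed subset of the product of the intervals [-1,1] over all indices,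
  which is compact by Tychonoff.\<close>

lemma compact_disc: "compact_space (disc n)"
proof -
  let ?P = "PiE (UNIV::nat set) (\<lambda>i. {-1..1::real})"
  have sub: "topspace (disc n) \<subseteq> ?P"
  proof
    fix x assume x: "x \<in> topspace (disc n)"
    have "x i \<in> {-1..1}" for i
    proof (cases "i < n")
      case True
      then have "(x i)\<^sup>2 \<le> sqn n x" by (intro member_le_sum) auto
      then have "(x i)\<^sup>2 \<le> 1" using x by (auto simp: topspace_disc)
      then have "\<bar>x i\<bar> \<le> 1" by (simp add: abs_square_le_1)
      then show ?thesis by (auto simp: abs_le_iff)
    qed (use x in \<open>auto simp: topspace_disc\<close>)
    then show "x \<in> ?P" by auto
  qed
  have c: "compactin (powertop_real UNIV) ?P"
    by (subst compactin_PiE) auto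
  have m: "continuous_map (powertop_real UNIV) euclideanreal (\<lambda>x. x i)" for i :: nat
    by (rule continuous_map_product_projection) simp
  have q: "continuous_map (powertop_real UNIV) euclideanreal (sqn n)"
    by (intro continuous_map_sum m continuous_intros) auto
  have "closedin (powertop_real UNIV) (topspace (disc n))"
  proof -
    have "topspace (disc n) = (\<Inter>i\<in>{n..}. {x \<in> topspace (powertop_real UNIV). x i \<in> {0}}) \<inter>
       {x \<in> topspace (powertop_real UNIV). sqn n x \<in> {..1}}"
      by (auto simp: topspace_disc)
    also have "closedin (powertop_real UNIV) \<dots>"
      by (intro closedin_Int closedin_INT closedin_continuous_map_preimage[OF m]
          closedin_continuous_map_preimage[OF q]) auto
    finally show ?thesis .
  qed
  with c sub have "compactin (powertop_real UNIV) (topspace (disc n))"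
    using closed_compactin by blast
  then show ?thesis
    by (subst disc_powertop) (rule compact_space_subtopology)
qed

section \<open>Radial expansion of the disc\<close>

definition collar :: "nat \<Rightarrow> (nat \<Rightarrow> real) set" where
  "collar n = {x \<in> topspace (disc n). 1/4 \<le> sqn n x}"

text \<open>For t \<le> 1 the denominator is at least 1/2, so the formula is continuous at the
  origin too, and at least the radius, so the disc is preserved. On the disc it is 1 at t = 0. At t
  = 1 every point of radius at least 1/2 lands on the sphere; the bound 1/4 in \<open>collar\<close>
  is the square of this radius.\<close>

definition push :: "nat \<Rightarrow> real \<Rightarrow> (nat \<Rightarrow> real) \<Rightarrow> nat \<Rightarrow> real" where
  "push n t x = (\<lambda>i. x i / max (sqrt (sqn n x)) (1 - t/2))"

lemma sqn_push: "sqn n (push n t x) = sqn n x / (max (sqrt (sqn n x)) (1 - t/2))\<^sup>2"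
  by (simp add: push_def power_divide sum_divide_distrib)

lemma push_in_disc:
  assumes "x \<in> topspace (disc n)" "t \<le> 1"
  shows "push n t x \<in> topspace (disc n)"
proof -
  have "sqn n x = (sqrt (sqn n x))\<^sup>2" by (simp add: sum_nonneg)
  also have "\<dots> \<le> (max (sqrt (sqn n x)) (1 - t/2))\<^sup>2"
    by (intro power_mono) (auto simp: sum_nonneg)
  finally have "sqn n (push n t x) \<le> 1" unfolding sqn_push
    by (subst divide_le_eq_1) (use assms(2) in auto)
  with assms show ?thesis unfolding topspace_disc by (auto simp: push_def)
qed

lemma push_fixes_bdry:
  assumes "x \<in> disc_bdry n" "0 \<le> t"
  shows "push n t x = x"
  using assms by (auto simp: push_def disc_bdry_eq)

lemma push_0: "x \<in> topspace (disc n) \<Longrightarrow> push n 0 x = x"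
  by (auto simp: push_def topspace_disc max_def)

lemma push_1_collar:
  assumes "x \<in> collar n" shows "push n 1 x \<in> disc_bdry n"
proof -
  have "sqrt (sqn n x) \<ge> sqrt (1/4)" using assms by (auto simp: collar_def)
  then have "sqrt (sqn n x) \<ge> 1/2" by (simp add: real_sqrt_divide)
  then have "max (sqrt (sqn n x)) (1 - 1/2) = sqrt (sqn n x)" by auto
  then have "sqn n (push n 1 x) = 1" unfolding sqn_push using assms
    by (auto simp: collar_def)
  moreover have "push n 1 x \<in> topspace (disc n)" using assms
    by (intro push_in_disc) (auto simp: collar_def)
  ultimately show ?thesis by (auto simp: disc_bdry_def)
qed

text \<open>The denominator is at most 1 on the disc, so the radius never decreases along the
  expansion.\<close>

lemma push_collar:
  assumes "x \<in> collar n" "0 \<le> t" "t \<le> 1" shows "push n t x \<in> collar n"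
proof -
  have x: "x \<in> topspace (disc n)" using assms by (auto simp: collar_def)
  let ?m = "max (sqrt (sqn n x)) (1 - t/2)"
  have "?m \<le> 1" using x assms(2) by (auto simp: topspace_disc)
  moreover have "0 < ?m" using assms by auto
  ultimately have "?m\<^sup>2 \<le> 1" by (simp add: power_le_one)
  then have "sqn n x \<le> sqn n x / ?m\<^sup>2" using \<open>0 < ?m\<close>
    by (subst le_divide_eq) (auto simp: mult_left_le sum_nonneg)
  then have "sqn n (push n t x) \<ge> sqn n x" by (simp add: sqn_push)
  then show ?thesis using assms push_in_disc[OF x] by (auto simp: collar_def)
qed

abbreviation unit_interval :: "real topology" where "unit_interval \<equiv> top_of_set {0..1}"

lemma continuous_map_push:
  "continuous_map (prod_topology unit_interval (disc n)) (disc n) (\<lambda>(t, x). push n t x)"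
proof (rule continuous_map_into_disc)
  let ?P = "prod_topology unit_interval (disc n)"
  have c: "continuous_map ?P euclideanreal (\<lambda>p. snd p i)" for i
    using continuous_map_compose[OF continuous_map_snd continuous_map_disc_coord, of unit_interval n i]
    by (simp add: o_def)
  have s: "continuous_map ?P euclideanreal (\<lambda>p. sqn n (snd p))"
    using continuous_map_compose[OF continuous_map_snd continuous_map_sqn, of unit_interval n]
    by (simp add: o_def)
  have f: "continuous_map ?P euclideanreal fst"
    by (rule continuous_map_into_fulltopology[OF continuous_map_fst])
  have r: "continuous_map ?P euclideanreal (\<lambda>p. sqrt (sqn n (snd p)))"
    by (rule continuous_map_compose[OF s, of euclideanreal sqrt, unfolded o_def])
       (simp add: continuous_on_real_sqrt[OF continuous_on_id])
  have "continuous_map ?P euclideanreal (\<lambda>p. snd p i / max (sqrt (sqn n (snd p))) (1 - fst p / 2))" for i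
    by (intro continuous_map_real_divide c continuous_map_real_max r
        continuous_map_diff continuous_map_const[THEN iffD2] f) auto
  then show "continuous_map ?P euclideanreal (\<lambda>p. (case p of (t, x) \<Rightarrow> push n t x) i)" for i
    by (simp add: push_def case_prod_beta)
  show "(case p of (t, x) \<Rightarrow> push n t x) \<in> topspace (disc n)" if "p \<in> topspace ?P" for p
    using that by (auto intro: push_in_disc)
qed


section \<open>Relative homology of an attached cell\<close>

locale cell_attachment =
  fixes n :: nat and Z :: "'a topology" and Y :: "'a set" and \<theta> :: "(nat \<Rightarrow> real) \<Rightarrow> 'a"
  assumes hausdorff: "Hausdorff_space Z"
    and closed_base: "closedin Z Y"
    and cont: "continuous_map (disc n) Z \<theta>"
    and bdry: "\<theta> ` disc_bdry n \<subseteq> Y"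
    and homeo: "homeomorphic_map (open_disc n) (subtopology Z (topspace Z - Y)) \<theta>"
begin

abbreviation (input) interior_disc where "interior_disc \<equiv> topspace (disc n) - disc_bdry n"

lemma topspace_open: "topspace (open_disc n) = interior_disc"
  by (auto simp: open_disc_subtopology)

lemma image_interior: "\<theta> ` interior_disc = topspace Z - Y"
  using homeomorphic_imp_surjective_map[OF homeo] by (simp add: topspace_open Int_absorb1)

lemma inj_interior: "inj_on \<theta> interior_disc"
  using homeomorphic_imp_injective_map[OF homeo] by (simp add: topspace_open)

lemma base_subset: "Y \<subseteq> topspace Z"
  using closed_base closedin_subset by blast

lemma base_iff: "x \<in> topspace (disc n) \<Longrightarrow> \<theta> x \<in> Y \<longleftrightarrow> x \<in> disc_bdry n"
  using image_interior bdry by blast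

lemma covers: "topspace Z = Y \<union> \<theta> ` topspace (disc n)"
  using image_interior base_subset cont continuous_map_image_subset_topspace by fastforce

text \<open>Radial expansion of the disc fixes its boundary, hence descends to a deformation of \<open>Z\<close> over
  \<open>Y\<close> that ends by retracting a closed neighbourhood of \<open>Y\<close> into \<open>Y\<close>. With excision this
  compares the pairs \<open>(disc n, disc_bdry n)\<close> and \<open>(Z, Y)\<close>.\<close>

definition flow :: "real \<Rightarrow> 'a \<Rightarrow> 'a" where
  "flow t z = (if z \<in> Y then z else \<theta> (push n t (inv_into interior_disc \<theta> z)))"

text \<open>Valid on the sphere as well, where \<open>push\<close> fixes every point. Continuity is
  derived from this formula, since the inverse map in the definition of \<open>flow\<close> has no
  continuity up to the sphere.\<close>

lemma flow_char: "x \<in> topspace (disc n) \<Longrightarrow> 0 \<le> t \<Longrightarrow> flow t (\<theta> x) = \<theta> (push n t x)"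
  using inv_into_f_f[OF inj_interior] by (auto simp: flow_def base_iff push_fixes_bdry)

text \<open>\<open>Y\<close> and the image of the disc form a closed cover of \<open>Z\<close>. Over
  \<open>Y\<close> the map is the projection; over the image of the disc it is induced by
  \<open>push\<close> through a quotient map.\<close>

lemma continuous_flow: "continuous_map (prod_topology unit_interval Z) Z (\<lambda>(t, z). flow t z)"
proof -
  let ?P = "prod_topology unit_interval Z"
  let ?K = "\<theta> ` topspace (disc n)"
  have K: "compactin Z ?K"
    by (rule image_compactin[OF _ cont]) (use compact_disc compact_space_def in blast)
  have Kc: "closedin Z ?K" by (rule compactin_imp_closedin[OF hausdorff K])
  define T where "T b = {0..1::real} \<times> (if b then Y else ?K)" for b :: bool
  show ?thesis
  proof (rule pasting_lemma_closed[where I=UNIV and T=T and f="\<lambda>_ (t, z). flow t z"])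
    show "closedin ?P (T b)" for b
      unfolding T_def by (subst closedin_prod_Times_iff) (auto simp: closed_base Kc)
    show "continuous_map (subtopology ?P (T b)) Z (\<lambda>(t, z). flow t z)" for b
    proof (cases b)
      case True
      have "continuous_map (subtopology ?P (T b)) Z snd"
        by (intro continuous_map_from_subtopology continuous_map_snd)
      then show ?thesis
        by (rule continuous_map_eq) (use True in \<open>auto simp: T_def flow_def\<close>)
    next
      case False
      let ?D = "prod_topology unit_interval (disc n)"
      let ?S = "prod_topology unit_interval (subtopology Z ?K)"
      have S: "subtopology ?P (T b) = ?S"
        using False by (simp add: T_def prod_topology_subtopology subtopology_subtopology)
      have tK: "topspace Z \<inter> ?K = ?K" using covers by auto
      \<comment> \<open>A continuous surjection from a compact space onto a Hausdorff space is a
        quotient map; this is applied with the interval factor included.\<close>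
      have q: "quotient_map ?D ?S (\<lambda>(t, x). (t, \<theta> x))"
      proof (rule continuous_imp_quotient_map)
        show "continuous_map ?D ?S (\<lambda>(t, x). (t, \<theta> x))"
          by (rule continuous_map_prod_top[THEN iffD2])
             (auto intro: continuous_map_into_subtopology[OF cont])
        show "compact_space ?D"
          by (simp add: compact_space_prod_topology compact_disc compact_space_subtopology)
        show "Hausdorff_space ?S"
          by (simp add: Hausdorff_space_prod_topology Hausdorff_space_subtopology hausdorff)
        show "(\<lambda>(t, x). (t, \<theta> x)) ` topspace ?D = topspace ?S"
          using tK by (auto simp: image_iff)
      qed
      have "continuous_map ?D Z (\<theta> \<circ> (\<lambda>(t, x). push n t x))"
        by (rule continuous_map_compose[OF continuous_map_push cont])
      then have "continuous_map ?D Z ((\<lambda>(t, z). flow t z) \<circ> (\<lambda>(t, x). (t, \<theta> x)))"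
        by (rule continuous_map_eq) (auto simp: flow_char)
      then have "continuous_map ?S Z (\<lambda>(t, z). flow t z)"
        by (rule continuous_compose_quotient_map[OF q])
      then show ?thesis by (simp add: S)
    qed
  next
    fix x assume "x \<in> topspace ?P"
    then show "\<exists>j. j \<in> UNIV \<and> x \<in> T j \<and> (case x of (t, z) \<Rightarrow> flow t z) = (case x of (t, z) \<Rightarrow> flow t z)"
      using covers by (cases x) (auto simp: T_def)
  qed auto
qed

definition thick :: "'a set" where "thick = Y \<union> \<theta> ` collar n"

lemma thick_subset: "thick \<subseteq> topspace Z"
  using covers by (auto simp: thick_def collar_def)

lemma continuous_flow_at: "0 \<le> t \<Longrightarrow> t \<le> 1 \<Longrightarrow> continuous_map Z Z (flow t)"
  using continuous_map_compose[OF _ continuous_flow, of Z "\<lambda>z. (t, z)"]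
  by (simp add: o_def continuous_map_pairedI)

lemma flow_thick: "0 \<le> t \<Longrightarrow> t \<le> 1 \<Longrightarrow> z \<in> thick \<Longrightarrow> flow t z \<in> thick"
proof -
  assume *: "0 \<le> t" "t \<le> 1" "z \<in> thick"
  then consider "z \<in> Y" | x where "x \<in> collar n" "z = \<theta> x"
    unfolding thick_def by blast
  then show ?thesis
  proof cases
    case 2
    then have "flow t z = \<theta> (push n t x)"
      using * by (simp add: flow_char collar_def)
    then show ?thesis using push_collar[OF 2(1) *(1,2)] by (simp add: thick_def)
  qed (simp add: flow_def thick_def)
qed

lemma flow_base: "z \<in> Y \<Longrightarrow> flow t z = z"
  by (simp add: flow_def)

lemma flow_0: "z \<in> topspace Z \<Longrightarrow> flow 0 z = z"
proof -
  assume "z \<in> topspace Z"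
  then consider "z \<in> Y" | x where "x \<in> topspace (disc n)" "z = \<theta> x"
    using covers by blast
  then show ?thesis
    by cases (simp_all add: flow_base flow_char push_0)
qed

lemma flow_1_thick: "z \<in> thick \<Longrightarrow> flow 1 z \<in> Y"
proof -
  assume "z \<in> thick"
  then consider "z \<in> Y" | x where "x \<in> collar n" "z = \<theta> x"
    unfolding thick_def by blast
  then show ?thesis
  proof cases
    case 2
    then have "flow 1 z = \<theta> (push n 1 x)"
      by (simp add: flow_char collar_def)
    then show ?thesis using push_1_collar[OF 2(1)] bdry by auto
  qed (simp add: flow_base)
qed

text \<open>The inclusion of pairs has the homotopy inverse \<open>flow 1\<close>, which carries
  \<open>thick\<close> into \<open>Y\<close>. The connecting homotopy \<open>flow t\<close>
  preserves both \<open>Y\<close> and \<open>thick\<close>.\<close>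

lemma iso_thick: "hom_induced p Z Y Z thick id \<in> iso (relative_homology_group p Z Y)
    (relative_homology_group p Z thick)"
proof -
  have h: "homotopic_with (\<lambda>h. h \<in> S \<rightarrow> S) Z Z (flow 1) id" if "\<And>t z. 0 \<le> t \<Longrightarrow> t
      \<le> 1 \<Longrightarrow> z \<in> S \<Longrightarrow> flow t z \<in> S" "S \<subseteq> topspace Z" for S
  proof -
    have "homotopic_with (\<lambda>h. h \<in> S \<rightarrow> S) Z Z (flow 0) (flow 1)"
      unfolding homotopic_with_def
      by (rule exI[of _ "\<lambda>(t, z). flow t z"]) (use that continuous_flow in \<open>auto\<close>)
    then have "homotopic_with (\<lambda>h. h \<in> S \<rightarrow> S) Z Z (flow 1) (flow 0)"
      by (rule homotopic_with_symD)
    then show ?thesis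
      by (rule homotopic_with_eq) (use that flow_0 in \<open>auto simp: Pi_iff subset_iff\<close>)
  qed
  have Yt: "Y \<subseteq> thick" by (auto simp: thick_def)
  show ?thesis
  proof (rule homotopy_equivalence_relative_homology_group_isomorphism[where g="flow 1"])
    show "homotopic_with (\<lambda>h. h \<in> Y \<rightarrow> Y) Z Z (flow 1 \<circ> id) id"
      using h[of Y] base_subset by (simp add: flow_base)
    show "homotopic_with (\<lambda>h. h \<in> thick \<rightarrow> thick) Z Z (id \<circ> flow 1) id"
      using h[of thick] thick_subset flow_thick by simp
  qed (use continuous_flow_at Yt flow_1_thick in auto)
qed

text \<open>Excision of \<open>Y\<close> requires its closure to lie in the interior of
  \<open>thick\<close>. The image of the concentric disc of radius 1/2 is compact, hence closed, and
  its complement is an open set between \<open>Y\<close> and \<open>thick\<close>.\<close>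

lemma iso_excision:
  "hom_induced p (subtopology Z (topspace Z - Y)) (thick - Y) Z thick id
     \<in> iso (relative_homology_group p (subtopology Z (topspace Z - Y)) (thick - Y))
         (relative_homology_group p Z thick)"
proof -
  let ?core = "{x \<in> topspace (disc n). sqn n x \<in> {..1/4}}"
  have "closedin (disc n) ?core"
    by (rule closedin_continuous_map_preimage[OF continuous_map_sqn]) auto
  then have "compactin (disc n) ?core" using compact_disc closedin_compact_space by blast
  then have "closedin Z (\<theta> ` ?core)"
    by (intro compactin_imp_closedin[OF hausdorff] image_compactin[OF _ cont])
  then have o: "openin Z (topspace Z - \<theta> ` ?core)" by blast
  have inner: "topspace Z - \<theta> ` ?core \<subseteq> thick"
  proof
    fix z assume z: "z \<in> topspace Z - \<theta> ` ?core"
    show "z \<in> thick"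
    proof (cases "z \<in> Y")
      case False
      then obtain x where x: "x \<in> topspace (disc n)" "z = \<theta> x" using z covers by auto
      then have "\<not> sqn n x \<le> 1/4" using z by auto
      then show ?thesis using x by (auto simp: thick_def collar_def)
    qed (simp add: thick_def)
  qed
  have "Y \<subseteq> topspace Z - \<theta> ` ?core"
  proof
    fix z assume "z \<in> Y"
    then have "z \<noteq> \<theta> x" if "x \<in> ?core" for x
      using base_iff[of x] that by (auto simp: disc_bdry_eq)
    with \<open>z \<in> Y\<close> show "z \<in> topspace Z - \<theta> ` ?core" using base_subset by blast
  qed
  then have "Y \<subseteq> Z interior_of thick"
    using interior_of_maximal[OF inner o] by (rule subset_trans)
  then have "Z closure_of Y \<subseteq> Z interior_of thick"
    by (simp only: closure_of_closedin[OF closed_base])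
  from homology_excision_axiom[OF this thick_subset, of p] show ?thesis
    by (simp only: subtopology_topspace)
qed

lemma iso_interior:
  "hom_induced p (open_disc n) (collar n - disc_bdry n) (subtopology Z (topspace Z - Y)) (thick - Y) \<theta>
     \<in> iso (relative_homology_group p (open_disc n) (collar n - disc_bdry n))
           (relative_homology_group p (subtopology Z (topspace Z - Y)) (thick - Y))"
proof (rule homeomorphic_map_relative_homology_iso[OF homeo])
  show "\<theta> ` (collar n - disc_bdry n) = thick - Y"
    using base_iff by (auto simp: thick_def collar_def)
qed (auto simp: topspace_open collar_def)

lemma iso_open_disc:
  "hom_induced p (open_disc n) (collar n - disc_bdry n) Z thick \<theta>
     \<in> iso (relative_homology_group p (open_disc n) (collar n - disc_bdry n)) (relative_homology_group p
         Z thick)"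
proof -
  have "hom_induced p (open_disc n) (collar n - disc_bdry n) Z thick (id \<circ> \<theta>) =
      hom_induced p (subtopology Z (topspace Z - Y)) (thick - Y) Z thick id \<circ>
      hom_induced p (open_disc n) (collar n - disc_bdry n) (subtopology Z (topspace Z - Y)) (thick - Y) \<theta>"
    by (rule hom_induced_compose)
       (use homeo base_iff in \<open>auto simp: homeomorphic_imp_continuous_map thick_def collar_def\<close>)
  then show ?thesis
    using iso_set_trans[OF iso_interior iso_excision] by (simp add: o_def)
qed

end

text \<open>The disc is itself its sphere with one cell attached, so every comparison proved for
  \<open>Z\<close> also holds for the disc, with \<open>collar\<close> in the role of
  \<open>thick\<close>.\<close>

lemma cell_attachment_disc: "cell_attachment n (disc n) (disc_bdry n) id"
proof
  show "closedin (disc n) (disc_bdry n)"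
    using closedin_continuous_map_preimage[OF continuous_map_sqn, of "{1}" n]
    by (simp add: disc_bdry_def)
qed (auto simp: Hausdorff_disc open_disc_subtopology)

context cell_attachment begin

text \<open>The open disc maps isomorphically both to the disc relative to its collar and to
  \<open>Z\<close> relative to \<open>thick\<close>, so the map between the latter two pairs is an
  isomorphism. The commuting square that enlarges the sphere to the collar and \<open>Y\<close> to
  \<open>thick\<close> transfers this to the original pairs.\<close>

theorem iso_attachment:
  "hom_induced p (disc n) (disc_bdry n) Z Y \<theta>
     \<in> iso (relative_homology_group p (disc n) (disc_bdry n)) (relative_homology_group p Z Y)"
proof -
  interpret D: cell_attachment n "disc n" "disc_bdry n" id by (rule cell_attachment_disc)
  let ?C = "collar n" and ?O = "open_disc n" and ?S = "disc_bdry n" and ?D = "disc n"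
  have [simp]: "D.thick = ?C"
    unfolding D.thick_def by (auto simp: collar_def disc_bdry_def)
  have SC: "?S \<subseteq> ?C" using D.thick_def by auto
  have cO: "continuous_map ?O ?D id"
    by (simp add: open_disc_subtopology continuous_map_from_subtopology)
  have chC: "\<theta> \<in> ?C \<rightarrow> thick" by (auto simp: thick_def)
  have bj: "bij_betw h (carrier G) (carrier H)" if "h \<in> iso G H"
      for h and G :: "('x, 'y) monoid_scheme" and H :: "('z, 'w) monoid_scheme"
    using that by (auto simp: iso_def)
  have "hom_induced p ?O (?C - ?S) Z thick (\<theta> \<circ> id) = hom_induced p ?D ?C Z thick \<theta> \<circ> hom_induced p ?O
      (?C - ?S) ?D ?C id"
    by (rule hom_induced_compose) (use cO cont chC in auto)
  then have "bij_betw (hom_induced p ?D ?C Z thick \<theta> \<circ> hom_induced p ?O (?C - ?S) ?D ?C id)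
      (carrier (relative_homology_group p ?O (?C - ?S))) (carrier (relative_homology_group p Z thick))"
    using bj[OF iso_open_disc[of p]] by (simp only: o_id comp_id)
  moreover have "bij_betw (hom_induced p ?O (?C - ?S) ?D ?C id) (carrier (relative_homology_group p ?O
      (?C - ?S))) (carrier (relative_homology_group p ?D ?C))"
    using bj[OF D.iso_open_disc[of p]] by (simp only: \<open>D.thick = ?C\<close>)
  ultimately have 1: "bij_betw (hom_induced p ?D ?C Z thick \<theta>) (carrier (relative_homology_group p ?D
      ?C)) (carrier (relative_homology_group p Z thick))"
    using bij_betw_comp_iff by blast
  have "hom_induced p ?D ?C Z thick \<theta> \<circ> hom_induced p ?D ?S ?D ?C id = hom_induced p ?D ?S Z thick (\<theta> \<circ> id)"
    by (rule hom_induced_compose[symmetric]) (use cont chC SC in auto)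
  moreover have "hom_induced p Z Y Z thick id \<circ> hom_induced p ?D ?S Z Y \<theta>
      = hom_induced p ?D ?S Z thick (id \<circ> \<theta>)"
    by (rule hom_induced_compose[symmetric]) (use cont bdry in \<open>auto simp: thick_def\<close>)
  moreover have "id \<circ> \<theta> = \<theta> \<circ> id" by simp
  ultimately have eq: "hom_induced p Z Y Z thick id \<circ> hom_induced p ?D ?S Z Y \<theta>
      = hom_induced p ?D ?C Z thick \<theta> \<circ> hom_induced p ?D ?S ?D ?C id"
    by (simp only:)
  have "bij_betw (hom_induced p ?D ?S ?D ?C id) (carrier (relative_homology_group p ?D ?S)) (carrier
      (relative_homology_group p ?D ?C))"
    using bj[OF D.iso_thick[of p]] by (simp only: \<open>D.thick = ?C\<close>)
  from bij_betw_trans[OF this 1]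
  have "bij_betw (hom_induced p Z Y Z thick id \<circ> hom_induced p ?D ?S Z Y \<theta>) (carrier
      (relative_homology_group p ?D ?S)) (carrier (relative_homology_group p Z thick))"
    by (simp only: eq)
  then have "bij_betw (hom_induced p ?D ?S Z Y \<theta>) (carrier (relative_homology_group p ?D ?S)) (carrier
      (relative_homology_group p Z Y))"
    by (subst bij_betw_comp_iff2[OF bj[OF iso_thick]]) (auto simp: hom_induced_carrier)
  then show ?thesis by (auto simp: iso_def hom_induced_hom)
qed

end

section \<open>The homology of a disc\<close>

text \<open>An isomorphism \<open>h\<close> to the integers sends powers of \<open>c\<close> to
  multiples of \<open>h c\<close>. Since 1 is among these multiples, \<open>h c\<close> is nonzero
  and distinct powers stay distinct.\<close>

lemma infinite_cyclic_generator:
  assumes "group G" "G \<cong> integer_group" "c \<in> carrier G" "subgroup_generated G {c} = G"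
  shows "carrier G = range (\<lambda>i::int. c [^]\<^bsub>G\<^esub> i)" "inj (\<lambda>i::int. c [^]\<^bsub>G\<^esub> i)"
proof -
  interpret group G by fact
  show car: "carrier G = range (\<lambda>i::int. c [^]\<^bsub>G\<^esub> i)"
    using carrier_subgroup_generated_by_singleton[OF assms(3)] assms(4) by simp
  obtain h where h: "h \<in> Group.iso G integer_group" using assms(2) by (auto simp: is_iso_def)
  then have hh: "h \<in> hom G integer_group" and bij: "bij_betw h (carrier G) UNIV" by (auto simp: iso_def)
  have hp: "h (c [^]\<^bsub>G\<^esub> i) = i * h c" for i :: int
    using hom_int_pow[OF hh assms(3) \<open>group G\<close> group_integer_group] by simp
  have "1 \<in> h ` carrier G" using bij by (auto simp: bij_betw_def)
  then obtain i where "1 = i * h c" using car hp by auto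
  then have "h c \<noteq> 0" by auto
  then show "inj (\<lambda>i::int. c [^]\<^bsub>G\<^esub> i)"
    by (intro injI) (metis hp mult_right_cancel)
qed

lemma contractible_disc: "contractible_space (disc n)"
proof -
  let ?P = "prod_topology unit_interval (disc n)"
  let ?h = "\<lambda>(t, x) i. (1 - t) * x i :: real"
  have c: "continuous_map ?P euclideanreal (\<lambda>p. snd p i)" for i
    using continuous_map_compose[OF continuous_map_snd continuous_map_disc_coord, of unit_interval n i]
    by (simp add: o_def)
  have f: "continuous_map ?P euclideanreal fst"
    by (rule continuous_map_into_fulltopology[OF continuous_map_fst])
  have "continuous_map ?P (disc n) ?h"
  proof (rule continuous_map_into_disc)
    have "continuous_map ?P euclideanreal (\<lambda>p. (1 - fst p) * snd p i)" for i
      by (intro continuous_map_real_mult continuous_map_diff continuous_map_const[THEN iffD2] c f) auto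
    then show "continuous_map ?P euclideanreal (\<lambda>p. ?h p i)" for i
      by (simp add: case_prod_beta)
    fix p assume p: "p \<in> topspace ?P"
    obtain t x where [simp]: "p = (t, x)" by (cases p)
    have "sqn n (?h p) = (1 - t)\<^sup>2 * sqn n x"
      by (simp add: power_mult_distrib sum_distrib_left)
    also have "\<dots> \<le> 1 * 1"
      using p by (intro mult_mono) (auto simp: topspace_disc power_le_one sum_nonneg)
    finally show "?h p \<in> topspace (disc n)"
      using p by (auto simp: topspace_disc)
  qed
  then have "homotopic_with (\<lambda>_. True) (disc n) (disc n) id (\<lambda>_ _. 0)"
    unfolding homotopic_with_def by (intro exI[of _ ?h]) auto
  then show ?thesis unfolding contractible_space_def by blast
qed

lemma disc_homology: "relative_homology_group (int n) (disc n) (disc_bdry n) \<cong> integer_group"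
proof (cases n)
  case 0
  have "topspace (disc 0) = {\<lambda>_. 0}" by (auto simp: topspace_disc)
  moreover have "disc_bdry 0 = {}" by (auto simp: disc_bdry_eq)
  ultimately show ?thesis using homology_coefficients[of "disc 0" "\<lambda>_. 0"] 0 by simp
next
  case (Suc m)
  \<comment> \<open>A point of the sphere: the isomorphism for a contractible space relative to a
    subset requires the subset to be nonempty, which is why degree 0 is treated apart.\<close>
  have "(\<lambda>i. if i = 0 then 1 else 0) \<in> topspace (disc n) \<inter> disc_bdry n"
    using Suc by (auto simp: topspace_disc disc_bdry_eq if_distrib[of "\<lambda>x. x\<^sup>2"] cong: if_cong)
  then have "relative_homology_group (int n) (disc n) (disc_bdry n) \<cong>
      reduced_homology_group (int n - 1) (subtopology (disc n) (disc_bdry n))"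
    by (intro isomorphic_group_relative_homology_of_contractible contractible_disc) auto
  also have "subtopology (disc n) (disc_bdry n) = nsphere m"
    unfolding disc_bdry_eq unfolding disc_def Euclidean_space_def nsphere Suc subtopology_subtopology
    by (rule arg_cong2[where f=subtopology]) (auto simp: lessThan_Suc_atMost Suc_le_eq)
  also have "int n - 1 = int m" using Suc by simp
  also have "reduced_homology_group (int m) (nsphere m) \<cong> integer_group"
    by (rule reduced_homology_group_nsphere)
  finally (iso_trans) show ?thesis .
qed

text \<open>A cyclic group has a generator, so the choice made by \<open>disc_class\<close> does
  pick one.\<close>

lemma disc_class:
  fixes n defines "G \<equiv> relative_homology_group (int n) (disc n) (disc_bdry n)"
  shows "disc_class n \<in> carrier G" "carrier G = range (\<lambda>i::int. disc_class n [^]\<^bsub>G\<^esub> i)"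
    "inj (\<lambda>i::int. disc_class n [^]\<^bsub>G\<^esub> i)"
proof -
  have iso: "G \<cong> integer_group" unfolding G_def by (rule disc_homology)
  have g: "group G" unfolding G_def by simp
  have "cyclic_group G"
    using isomorphic_group_cyclicity[OF iso g] by simp
  then have "\<exists>c. c \<in> carrier G \<and> subgroup_generated G {c} = G" by (auto simp: cyclic_group_def)
  then have *: "disc_class n \<in> carrier G \<and> subgroup_generated G {disc_class n} = G"
    unfolding disc_class_def G_def[symmetric] Let_def by (rule someI_ex)
  then show "disc_class n \<in> carrier G" by simp
  show "carrier G = range (\<lambda>i::int. disc_class n [^]\<^bsub>G\<^esub> i)" "inj (\<lambda>i::int. disc_class n [^]\<^bsub>G\<^esub> i)"
    using infinite_cyclic_generator[OF g iso] * by auto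
qed

section \<open>Integral linear combinations\<close>

text \<open>The product may run over any finite set containing the support, so that two combinations
  can be compared over a common set. \<open>lincomb_iff_support\<close> returns to the form used in
  \<open>cell_coords\<close>.\<close>

definition lincomb :: "('g, 'm) monoid_scheme \<Rightarrow> 'i set \<Rightarrow> ('i \<Rightarrow> 'g) \<Rightarrow> 'g \<Rightarrow> ('i \<Rightarrow> int) \<Rightarrow> bool" where
  "lincomb G B b z c \<longleftrightarrow>
     (\<exists>F. finite F \<and> F \<subseteq> B \<and> {e. c e \<noteq> 0} \<subseteq> F \<and> z = finprod G (\<lambda>e. b e [^]\<^bsub>G\<^esub> c e) F)"

lemma hom_finprod:
  assumes "comm_group G" "comm_group H" "h \<in> hom G H" "f \<in> A \<rightarrow> carrier G"
  shows "h (finprod G f A) = finprod H (\<lambda>x. h (f x)) A"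
proof -
  interpret G: comm_group G by fact
  interpret H: comm_group H by fact
  interpret group_hom G H h using assms by unfold_locales
  show ?thesis using assms(4)
  proof (induction A rule: infinite_finite_induct)
    case (insert x F)
    then have "h (f x \<otimes>\<^bsub>G\<^esub> finprod G f F) = h (f x) \<otimes>\<^bsub>H\<^esub> finprod H (\<lambda>x. h (f x)) F"
      by (subst hom_mult) auto
    then show ?case using insert
      by (subst G.finprod_insert) (auto simp: H.finprod_insert Pi_iff)
  qed auto
qed

context comm_group begin

lemma lincomb_superset:
  assumes "b \<in> B \<rightarrow> carrier G" "lincomb G B b z c" "finite F" "F \<subseteq> B" "{e. c e \<noteq> 0} \<subseteq> F"
  shows "z = finprod G (\<lambda>e. b e [^] c e) F"
proof -
  obtain F' where F': "finite F'" "F' \<subseteq> B" "{e. c e \<noteq> 0} \<subseteq> F'" "z = finprod G (\<lambda>e. b e [^] c e) F'"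
    using assms(2) by (auto simp: lincomb_def)
  have "finprod G (\<lambda>e. b e [^] c e) F' = finprod G (\<lambda>e. b e [^] c e) F"
  proof (rule finprod_mono_neutral_cong)
    show "b i [^] c i = \<one>" if "i \<in> F - F'" for i
    proof -
      have "c i = 0" using that F'(3) by auto
      then show ?thesis by simp
    qed
    show "b i [^] c i = \<one>" if "i \<in> F' - F" for i
    proof -
      have "c i = 0" using that assms(5) by auto
      then show ?thesis by simp
    qed
    show "(\<lambda>e. b e [^] c e) \<in> F' \<rightarrow> carrier G" "(\<lambda>e. b e [^] c e) \<in> F \<rightarrow> carrier G"
      using assms(1,4) F'(2) by (auto intro!: int_pow_closed)
  qed (use F'(1) assms(3) in auto)
  with F'(4) show ?thesis by (rule trans)
qed

lemma lincomb_finite_support: "lincomb G B b z c \<Longrightarrow> finite {e. c e \<noteq> 0} \<and> {e. c e \<noteq> 0} \<subseteq> B"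
  unfolding lincomb_def by (meson finite_subset order_trans)

lemma lincomb_iff_support:
  assumes "b \<in> B \<rightarrow> carrier G"
  shows "lincomb G B b z c \<longleftrightarrow> finite {e. c e \<noteq> 0} \<and> {e. c e \<noteq> 0} \<subseteq> B \<and>
     z = finprod G (\<lambda>e. b e [^] c e) {e. c e \<noteq> 0}"
  using lincomb_superset[OF assms, of z c "{e. c e \<noteq> 0}"] lincomb_finite_support[of B b z c]
  by (auto simp: lincomb_def)

lemma lincomb_one: "lincomb G B b \<one> (\<lambda>_. 0)"
  unfolding lincomb_def by (intro exI[of _ "{}"]) simp

lemma lincomb_single:
  assumes "b \<in> B \<rightarrow> carrier G" "e \<in> B"
  shows "lincomb G B b (b e) (\<lambda>f. if f = e then 1 else 0)"
  unfolding lincomb_def by (intro exI[of _ "{e}"]) (use assms in \<open>auto simp: Pi_iff\<close>)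

lemma lincomb_closed:
  assumes "b \<in> B \<rightarrow> carrier G" "lincomb G B b z c"
  shows "z \<in> carrier G"
  using assms by (auto simp: lincomb_def Pi_iff subset_iff intro!: finprod_closed)

lemma lincomb_mult:
  assumes b: "b \<in> B \<rightarrow> carrier G" and "lincomb G B b z c" "lincomb G B b w d"
  shows "lincomb G B b (z \<otimes> w) (\<lambda>e. c e + d e)"
proof -
  let ?F = "{e. c e \<noteq> 0} \<union> {e. d e \<noteq> 0}"
  have F: "finite ?F" "?F \<subseteq> B"
    using lincomb_finite_support assms by blast+
  have bF: "b e \<in> carrier G" if "e \<in> ?F" for e
    using b F(2) that by blast
  have "z = finprod G (\<lambda>e. b e [^] c e) ?F" "w = finprod G (\<lambda>e. b e [^] d e) ?F"
    using lincomb_superset[OF b _ F] assms by auto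
  moreover have "finprod G (\<lambda>e. b e [^] c e \<otimes> b e [^] d e) ?F
     = finprod G (\<lambda>e. b e [^] c e) ?F \<otimes> finprod G (\<lambda>e. b e [^] d e) ?F"
    by (rule finprod_multf) (use bF in \<open>simp_all add: Pi_iff\<close>)
  moreover have "finprod G (\<lambda>e. b e [^] c e \<otimes> b e [^] d e) ?F = finprod G (\<lambda>e. b e [^] (c e + d e)) ?F"
    by (rule finprod_cong') (use bF in \<open>simp_all add: int_pow_mult Pi_iff\<close>)
  ultimately have "z \<otimes> w = finprod G (\<lambda>e. b e [^] (c e + d e)) ?F"
    by (simp only:)
  moreover have "{e. c e + d e \<noteq> 0} \<subseteq> ?F" by auto
  ultimately show ?thesis using F unfolding lincomb_def by blast
qed

lemma lincomb_pow:
  fixes m :: int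
  assumes b: "b \<in> B \<rightarrow> carrier G" and "lincomb G B b z c"
  shows "lincomb G B b (z [^] m) (\<lambda>e. m * c e)"
proof -
  let ?F = "{e. c e \<noteq> 0}"
  have F: "finite ?F" "?F \<subseteq> B" using lincomb_finite_support assms by blast+
  have bF: "b e \<in> carrier G" if "e \<in> ?F" for e
    using b F(2) that by blast
  have z: "z = finprod G (\<lambda>e. b e [^] c e) ?F"
    using lincomb_superset[OF b _ F] assms by auto
  have "(\<lambda>x. x [^] m) \<in> hom G G"
    by (auto simp: hom_def int_pow_distrib)
  then have "z [^] m = finprod G (\<lambda>e. (b e [^] c e) [^] m) ?F"
    unfolding z using hom_finprod[of G G "\<lambda>x. x [^] m" "\<lambda>e. b e [^] c e" ?F] bF comm_group_axioms
    by (simp add: Pi_iff)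
  also have "\<dots> = finprod G (\<lambda>e. b e [^] (m * c e)) ?F"
    by (rule finprod_cong') (use bF in \<open>simp_all add: int_pow_pow mult.commute Pi_iff\<close>)
  finally have "z [^] m = finprod G (\<lambda>e. b e [^] (m * c e)) ?F" .
  moreover have "{e. m * c e \<noteq> 0} \<subseteq> ?F" by auto
  ultimately show ?thesis using F unfolding lincomb_def by blast
qed

lemma lincomb_finprod:
  assumes b: "b \<in> B \<rightarrow> carrier G" and I: "finite I" and z: "\<And>i. i \<in> I \<Longrightarrow> lincomb G B b (z i) (c i)"
  shows "lincomb G B b (finprod G (\<lambda>i. z i [^] (m i :: int)) I) (\<lambda>e. \<Sum>i\<in>I. m i * c i e)"
  using I z
proof (induction I rule: finite_induct)
  case (insert i I)
  have "lincomb G B b (z i [^] m i \<otimes> finprod G (\<lambda>i. z i [^] m i) I) (\<lambda>e. m i * c i e + (\<Sum>i\<in>I. m i * c i e))"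
    by (intro lincomb_mult lincomb_pow b insert.IH insert.prems) auto
  moreover have "z j \<in> carrier G" if "j \<in> insert i I" for j
    using lincomb_closed[OF b] insert.prems that by blast
  ultimately show ?case using insert.hyps by (subst finprod_insert) (auto simp: Pi_iff)
qed (simp add: lincomb_one)

end

section \<open>CW-complexes\<close>

locale cw =
  fixes K :: "'a cw_complex"
  assumes cw: "is_cw_complex K"
begin

abbreviation X where "X \<equiv> cw_top K"

lemma hausdorff: "Hausdorff_space X"
  and topspace_eq: "topspace X = \<Union> (all_cells K)"
  and disjoint_all: "disjoint (all_cells K)"
  using cw by (auto simp: is_cw_complex_def)

lemma dim_unique: "e \<in> cells K m \<Longrightarrow> e \<in> cells K n \<Longrightarrow> m = n"
  using cw unfolding is_cw_complex_def by blast

lemma cells_all: "e \<in> cells K n \<Longrightarrow> e \<in> all_cells K"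
  by (auto simp: all_cells_def)

lemma cell_subset: "e \<in> cells K n \<Longrightarrow> e \<subseteq> topspace X"
  using cells_all topspace_eq by blast

lemma cells_disjoint: "e \<in> cells K m \<Longrightarrow> f \<in> cells K n \<Longrightarrow> x \<in> e \<Longrightarrow> x \<in> f \<Longrightarrow> e = f"
  using disjointD[OF disjoint_all cells_all cells_all] by blast

lemma cont_char: "e \<in> cells K n \<Longrightarrow> continuous_map (disc n) X (char_map K e)"
  and homeo_char: "e \<in> cells K n \<Longrightarrow> homeomorphic_map (open_disc n) (subtopology X e) (char_map K e)"
  and finite_bdry: "e \<in> cells K n \<Longrightarrow>
    \<exists>F. finite F \<and> F \<subseteq> (\<Union>m<n. cells K m) \<and> char_map K e ` disc_bdry n \<subseteq> \<Union>F"
proof -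
  assume e: "e \<in> cells K n"
  have "\<forall>n. \<forall>e \<in> cells K n.
        continuous_map (disc n) (cw_top K) (char_map K e) \<and>
        homeomorphic_map (open_disc n) (subtopology (cw_top K) e) (char_map K e) \<and>
        (\<exists>F. finite F \<and> F \<subseteq> (\<Union>m<n. cells K m) \<and> char_map K e ` disc_bdry n \<subseteq> \<Union>F)"
    using cw unfolding is_cw_complex_def by (elim conjE)
  note c = bspec[OF spec[OF this] e]
  show "continuous_map (disc n) X (char_map K e)"
    "homeomorphic_map (open_disc n) (subtopology X e) (char_map K e)"
    "\<exists>F. finite F \<and> F \<subseteq> (\<Union>m<n. cells K m) \<and> char_map K e ` disc_bdry n \<subseteq> \<Union>F"
    by (rule conjunct1[OF c], rule conjunct1[OF conjunct2[OF c]], rule conjunct2[OF conjunct2[OF c]])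
qed

lemma weak_topology:
  assumes "A \<subseteq> topspace X"
    and "\<And>n e. e \<in> cells K n \<Longrightarrow> closedin (disc n) {x \<in> topspace (disc n). char_map K e x \<in> A}"
  shows "closedin X A"
proof -
  have "\<forall>A \<subseteq> topspace (cw_top K).
        (\<forall>n. \<forall>e \<in> cells K n. closedin (disc n) {x \<in> topspace (disc n). char_map K e x \<in> A})
        \<longrightarrow> closedin (cw_top K) A"
    using cw unfolding is_cw_complex_def by (elim conjE)
  then show ?thesis using assms by simp
qed

lemma char_interior: "e \<in> cells K n \<Longrightarrow> char_map K e ` (topspace (disc n) - disc_bdry n) = e"
  using homeomorphic_imp_surjective_map[OF homeo_char] cell_subset
  by (auto simp: open_disc_subtopology Int_absorb1 Int_absorb2)

definition closed_cell :: "nat \<Rightarrow> 'a set \<Rightarrow> 'a set" where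
  "closed_cell n e = char_map K e ` topspace (disc n)"

lemma closed_cell_split: "e \<in> cells K n \<Longrightarrow> closed_cell n e = e \<union> char_map K e ` disc_bdry n"
  using char_interior[of e n] unfolding closed_cell_def disc_bdry_def by blast

lemma cell_nonempty: "e \<in> cells K n \<Longrightarrow> e \<noteq> {}"
proof -
  assume e: "e \<in> cells K n"
  have "(\<lambda>_. 0) \<in> topspace (disc n) - disc_bdry n"
    by (auto simp: topspace_disc disc_bdry_eq)
  then show ?thesis using char_interior[OF e] by blast
qed

lemma closed_char_image:
  assumes "e \<in> cells K n" "closedin (disc n) C"
  shows "closedin X (char_map K e ` C)"
  using assms closedin_compact_space[OF compact_disc]
  by (intro compactin_imp_closedin[OF hausdorff] image_compactin[OF _ cont_char])

lemma closed_bdry: "closedin (disc n) (disc_bdry n)"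
  using cell_attachment.closed_base[OF cell_attachment_disc] .

lemma closedin_closed_cell: "e \<in> cells K n \<Longrightarrow> closedin X (closed_cell n e)"
  unfolding closed_cell_def by (rule closed_char_image) auto

definition subcomplex :: "'a set set \<Rightarrow> bool" where
  "subcomplex \<S> \<longleftrightarrow> \<S> \<subseteq> all_cells K \<and>
     (\<forall>n. \<forall>e \<in> \<S> \<inter> cells K n. char_map K e ` disc_bdry n \<subseteq> \<Union>\<S>)"

text \<open>Induction on the dimension. If \<open>e\<close> does not belong to the subcomplex, the
  intersection lies in the image of the sphere, which is covered by finitely many cells of lower
  dimension; it is then a finite union of intersections with their closed cells, cut down to that
  closed image.\<close>

lemma subcomplex_Int_closed_cell:
  assumes S: "subcomplex \<S>"
  shows "e \<in> cells K m \<Longrightarrow> closedin X (\<Union>\<S> \<inter> closed_cell m e)"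
proof (induction m arbitrary: e rule: less_induct)
  case (less m)
  show ?case
  proof (cases "e \<in> \<S>")
    case True
    then have "closed_cell m e \<subseteq> \<Union>\<S>"
      using S less.prems unfolding closed_cell_split[OF less.prems] subcomplex_def by blast
    then show ?thesis using closedin_closed_cell[OF less.prems] by (simp add: Int_absorb1)
  next
    case False
    then have "\<Union>\<S> \<inter> e = {}"
      using S less.prems cells_disjoint unfolding subcomplex_def all_cells_def by blast
    obtain F where F: "finite F" "F \<subseteq> (\<Union>m<m. cells K m)" "char_map K e ` disc_bdry m \<subseteq> \<Union>F"
      using finite_bdry[OF less.prems] by blast
    define d where "d f = (SOME i. i < m \<and> f \<in> cells K i)" for f
    have d: "d f < m \<and> f \<in> cells K (d f)" if "f \<in> F" for f
      unfolding d_def by (rule someI_ex) (use F that in auto)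
    have sub: "f \<subseteq> closed_cell (d f) f" if "f \<in> F" for f
      using closed_cell_split d that by auto
    have "\<Union>\<S> \<inter> closed_cell m e =
        char_map K e ` disc_bdry m \<inter> (\<Union>f\<in>F. \<Union>\<S> \<inter> closed_cell (d f) f)"
    proof (intro equalityI subsetI)
      fix x assume x: "x \<in> \<Union>\<S> \<inter> closed_cell m e"
      then have xb: "x \<in> char_map K e ` disc_bdry m"
        using \<open>\<Union>\<S> \<inter> e = {}\<close> unfolding closed_cell_split[OF less.prems] by blast
      then obtain f where "f \<in> F" "x \<in> f" using F(3) by blast
      then have "x \<in> (\<Union>f\<in>F. \<Union>\<S> \<inter> closed_cell (d f) f)" using sub x by blast
      with xb show "x \<in> char_map K e ` disc_bdry m \<inter> (\<Union>f\<in>F. \<Union>\<S> \<inter> closed_cell (d f) f)"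
        by (rule IntI)
    next
      fix x assume "x \<in> char_map K e ` disc_bdry m \<inter> (\<Union>f\<in>F. \<Union>\<S> \<inter> closed_cell (d f) f)"
      then show "x \<in> \<Union>\<S> \<inter> closed_cell m e"
        unfolding closed_cell_split[OF less.prems] by (elim IntE UN_E) (intro IntI UnI2)
    qed
    moreover have "closedin X (\<Union>f\<in>F. \<Union>\<S> \<inter> closed_cell (d f) f)"
      using F(1) d less.IH by (intro closedin_Union) auto
    ultimately show ?thesis
      using closed_char_image[OF less.prems closed_bdry] by (simp add: closedin_Int)
  qed
qed

text \<open>A characteristic map only sees the part of the union inside its own closed cell, so the
  weak topology reduces the claim to single closed cells.\<close>

lemma closedin_subcomplex:
  assumes S: "subcomplex \<S>"
  shows "closedin X (\<Union>\<S>)"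
proof (rule weak_topology)
  show "\<Union>\<S> \<subseteq> topspace X" using S topspace_eq by (auto simp: subcomplex_def)
  fix n e assume e: "e \<in> cells K n"
  have "{x \<in> topspace (disc n). char_map K e x \<in> \<Union>\<S>} =
      {x \<in> topspace (disc n). char_map K e x \<in> \<Union>\<S> \<inter> closed_cell n e}"
    by (auto simp: closed_cell_def)
  then show "closedin (disc n) {x \<in> topspace (disc n). char_map K e x \<in> \<Union>\<S>}"
    using closedin_continuous_map_preimage[OF cont_char[OF e] subcomplex_Int_closed_cell[OF S e]] by simp
qed

section \<open>Cellular homology\<close>

definition lower :: "nat \<Rightarrow> 'a set" where "lower n = skel_set K (int n - 1)"

text \<open>The spaces between two consecutive skeleta; enlarging \<open>F\<close> attaches
  \<open>n\<close>-cells one at a time.\<close>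

definition stage :: "nat \<Rightarrow> 'a set set \<Rightarrow> 'a set" where "stage n F = lower n \<union> \<Union>F"

lemma lower_eq: "lower n = \<Union> (\<Union>m<n. cells K m)"
proof -
  have "{m. int m \<le> int n - 1} = {..<n}" by auto
  then show ?thesis by (auto simp: lower_def skel_set_def)
qed

lemma stage_empty: "stage n {} = lower n" by (simp add: stage_def)

lemma skel_set_eq: "skel_set K (int n) = stage n (cells K n)"
proof -
  have "{m. int m \<le> int n} = {..<n} \<union> {n}" by auto
  then show ?thesis by (auto simp: stage_def lower_eq skel_set_def)
qed

lemma lower_Suc: "lower (Suc n) = skel_set K (int n)"
  by (simp add: lower_def)

lemma lower_subset_stage: "lower n \<subseteq> stage n F" by (simp add: stage_def)

lemma stage_mono: "F \<subseteq> F' \<Longrightarrow> stage n F \<subseteq> stage n F'" by (auto simp: stage_def)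

lemma bdry_lower: "e \<in> cells K n \<Longrightarrow> char_map K e ` disc_bdry n \<subseteq> lower n"
  using finite_bdry[of e n] unfolding lower_eq by blast

lemma lower_mono: "m \<le> n \<Longrightarrow> lower m \<subseteq> lower n"
  unfolding lower_eq by (intro Union_mono) (auto intro: order_less_le_trans)

lemma closedin_stage: assumes "F \<subseteq> cells K n" shows "closedin X (stage n F)"
proof -
  have "subcomplex ((\<Union>m<n. cells K m) \<union> F)"
    unfolding subcomplex_def
  proof (intro conjI allI ballI)
    show "(\<Union>m<n. cells K m) \<union> F \<subseteq> all_cells K"
      using assms by (auto simp: all_cells_def)
    fix k e assume e: "e \<in> ((\<Union>m<n. cells K m) \<union> F) \<inter> cells K k"
    have "k \<le> n"
    proof (cases "e \<in> F")
      case True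
      then show ?thesis using e assms dim_unique[of e n k] by auto
    next
      case False
      then obtain m where "m < n" "e \<in> cells K m" using e by blast
      then show ?thesis using e dim_unique[of e m k] by auto
    qed
    have "char_map K e ` disc_bdry k \<subseteq> lower k" using bdry_lower e by blast
    also have "lower k \<subseteq> lower n" by (rule lower_mono) fact
    finally show "char_map K e ` disc_bdry k \<subseteq> \<Union> ((\<Union>m<n. cells K m) \<union> F)"
      unfolding lower_eq Union_Un_distrib by (rule le_supI1)
  qed
  then show ?thesis using closedin_subcomplex unfolding stage_def lower_eq by fastforce
qed

lemma stage_subset: "F \<subseteq> cells K n \<Longrightarrow> stage n F \<subseteq> topspace X"
  using closedin_stage closedin_subset by blast

lemma disjoint_stage:
  assumes "e \<in> cells K n" "F \<subseteq> cells K n" "e \<notin> F"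
  shows "e \<inter> stage n F = {}"
proof -
  have "e \<inter> f = {}" if f: "f \<in> (\<Union>m<n. cells K m) \<union> F" for f
  proof -
    have "\<exists>m. f \<in> cells K m \<and> e \<noteq> f"
    proof (cases "f \<in> F")
      case False
      then obtain m where "m < n" "f \<in> cells K m" using f by blast
      then show ?thesis using dim_unique[of e n m] assms(1) by blast
    qed (use assms in blast)
    then show ?thesis using cells_disjoint[OF assms(1)] by blast
  qed
  then show ?thesis unfolding stage_def lower_eq by blast
qed

text \<open>\<open>F\<close> may be infinite. Taking all \<open>n\<close>-cells other than
  \<open>e\<close> exhibits the whole \<open>n\<close>-skeleton as the attachment of
  \<open>e\<close> alone, which is how coordinates are separated.\<close>

lemma attachment:
  assumes e: "e \<in> cells K n" and F: "F \<subseteq> cells K n" "e \<notin> F"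
  shows "cell_attachment n (subtopology X (stage n (insert e F))) (stage n F) (char_map K e)"
proof
  let ?T = "stage n (insert e F)"
  have T: "topspace (subtopology X ?T) = ?T"
    using stage_subset[of "insert e F" n] e F by (simp add: Int_absorb1)
  show "Hausdorff_space (subtopology X ?T)" by (rule Hausdorff_space_subtopology[OF hausdorff])
  show "closedin (subtopology X ?T) (stage n F)"
    by (rule closedin_subset_topspace[OF closedin_stage[OF F(1)]]) (auto simp: stage_def)
  have "char_map K e ` topspace (disc n) \<subseteq> ?T"
    using closed_cell_split[OF e] bdry_lower[OF e] unfolding closed_cell_def stage_def by blast
  then show "continuous_map (disc n) (subtopology X ?T) (char_map K e)"
    by (intro continuous_map_into_subtopology[OF cont_char[OF e]]) auto
  show "char_map K e ` disc_bdry n \<subseteq> stage n F"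
    using bdry_lower[OF e] by (auto simp: stage_def)
  have "?T - stage n F = e" using disjoint_stage[OF e F] by (auto simp: stage_def)
  moreover have "?T \<inter> e = e" by (auto simp: stage_def)
  ultimately show "homeomorphic_map (open_disc n) (subtopology (subtopology X ?T)
      (topspace (subtopology X ?T) - stage n F)) (char_map K e)"
    using homeo_char[OF e] unfolding T by (simp add: subtopology_subtopology)
qed

lemma cont_stage:
  assumes e: "e \<in> cells K n" and F: "F \<subseteq> cells K n" "e \<in> F"
  shows "continuous_map (disc n) (subtopology X (stage n F)) (char_map K e)"
proof -
  have "F - {e} \<subseteq> cells K n" using F by blast
  from cell_attachment.cont[OF attachment[OF e this]] show ?thesis using F by (simp add: insert_absorb)
qed

lemma skel_eq: "skel K (int n) = subtopology X (stage n (cells K n))"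
  by (simp add: skel_def skel_set_eq)

lemma char_bdry_Pi: "e \<in> cells K n \<Longrightarrow> char_map K e \<in> disc_bdry n \<rightarrow> lower n"
  using bdry_lower by blast

text \<open>The class of a cell with the cells of \<open>F'\<close> collapsed. With
  \<open>F'\<close> empty and \<open>F\<close> all \<open>n\<close>-cells it is
  \<open>cell_class\<close>; with \<open>F'\<close> all cells but \<open>e\<close> it is the
  generator that measures the coordinate at \<open>e\<close>.\<close>

definition relcls :: "nat \<Rightarrow> 'a set set \<Rightarrow> 'a set set \<Rightarrow> 'a set \<Rightarrow> 'a chain set" where
  "relcls n F F' e = hom_induced (int n) (disc n) (disc_bdry n)
     (subtopology X (stage n F)) (stage n F') (char_map K e) (disc_class n)"

abbreviation relgrp :: "nat \<Rightarrow> 'a set set \<Rightarrow> 'a set set \<Rightarrow> 'a chain set monoid" where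
  "relgrp n F F' \<equiv> relative_homology_group (int n) (subtopology X (stage n F)) (stage n F')"

abbreviation incl :: "nat \<Rightarrow> 'a set set \<Rightarrow> 'a set set \<Rightarrow> 'a set set \<Rightarrow> 'a set set \<Rightarrow> 'a chain set \<Rightarrow> 'a chain
    set" where
  "incl n F F' G G' \<equiv> hom_induced (int n) (subtopology X (stage n F)) (stage n F')
     (subtopology X (stage n G)) (stage n G') id"

lemma cell_group_eq: "cell_group K n = relgrp n (cells K n) {}"
  by (simp add: cell_group_def skel_eq stage_empty lower_def)

lemma cell_class_eq: "cell_class K n e = relcls n (cells K n) {} e"
  by (simp add: cell_class_def relcls_def skel_eq stage_empty lower_def)

lemma relcls_carrier: "relcls n F F' e \<in> carrier (relgrp n F F')"
  by (simp add: relcls_def hom_induced_carrier)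

lemma cont_incl:
  assumes "F \<subseteq> G"
  shows "continuous_map (subtopology X (stage n F)) (subtopology X (stage n G)) id"
  by (rule continuous_map_into_subtopology)
     (use stage_mono[OF assms, of n] in \<open>auto intro: continuous_map_from_subtopology\<close>)

lemma incl_relcls:
  assumes "e \<in> cells K n" "e \<in> F" "F \<subseteq> cells K n" "F \<subseteq> G" "F' \<subseteq> G'"
  shows "incl n F F' G G' (relcls n F F' e) = relcls n G G' e"
proof -
  have "continuous_map (subtopology X (stage n F)) (subtopology X (stage n G)) id"
    by (rule cont_incl[OF assms(4)])
  moreover have "char_map K e \<in> disc_bdry n \<rightarrow> stage n F'"
    using char_bdry_Pi[OF assms(1)] lower_subset_stage by blast
  moreover have "id \<in> stage n F' \<rightarrow> stage n G'"
    using stage_mono[OF assms(5), of n] by auto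
  ultimately show ?thesis unfolding relcls_def
    by (subst hom_induced_compose'[OF cont_stage[OF assms(1,3,2)]]) simp_all
qed

lemma relcls_generates:
  assumes e: "e \<in> cells K n" and F: "F \<subseteq> cells K n" "e \<notin> F"
  defines "R \<equiv> relgrp n (insert e F) F"
  shows "carrier R = range (\<lambda>i::int. relcls n (insert e F) F e [^]\<^bsub>R\<^esub> i)"
    and "inj (\<lambda>i::int. relcls n (insert e F) F e [^]\<^bsub>R\<^esub> i)"
proof -
  let ?D = "relative_homology_group (int n) (disc n) (disc_bdry n)"
  let ?h = "hom_induced (int n) (disc n) (disc_bdry n) (subtopology X (stage n (insert e F))) (stage n
      F) (char_map K e)"
  have "?h \<in> Group.iso ?D R" unfolding R_def
    by (rule cell_attachment.iso_attachment[OF attachment[OF e F]])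
  then have h: "?h \<in> hom ?D R" "bij_betw ?h (carrier ?D) (carrier R)" by (auto simp: iso_def)
  have p: "?h (disc_class n [^]\<^bsub>?D\<^esub> i) = relcls n (insert e F) F e [^]\<^bsub>R\<^esub> i" for i :: int
    using hom_int_pow[OF h(1) disc_class(1)] by (simp add: relcls_def R_def)
  have "carrier R = ?h ` range (\<lambda>i::int. disc_class n [^]\<^bsub>?D\<^esub> i)"
    using h(2) disc_class(2) by (simp add: bij_betw_def)
  then show "carrier R = range (\<lambda>i::int. relcls n (insert e F) F e [^]\<^bsub>R\<^esub> i)"
    by (simp add: image_image p)
  have "inj_on ?h (range (\<lambda>i::int. disc_class n [^]\<^bsub>?D\<^esub> i))"
    using h(2) disc_class(2)[of n] by (simp add: bij_betw_def)
  from comp_inj_on[OF disc_class(3) this]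
  show "inj (\<lambda>i::int. relcls n (insert e F) F e [^]\<^bsub>R\<^esub> i)"
    by (simp add: o_def p)
qed

end

text \<open>As a simp rule, this replaces the unit of a homology group by a set of singular chains.\<close>

declare one_relative_homology_group [simp del]

lemma exact_seq_kernel:
  assumes "exact_seq ([A, B, C], [h, g])"
  shows "kernel B A h = g ` carrier C"
  using assms by simp

section \<open>Generation and independence of cell classes\<close>

context cw begin

lemma comm_relgrp: "comm_group (relgrp n F F')" by simp

lemma incl_hom: "incl n F F' G G' \<in> hom (relgrp n F F') (relgrp n G G')"
  by (rule hom_induced_hom)

lemma incl_compose:
  assumes "F \<subseteq> G" "G \<subseteq> M" "F' \<subseteq> G'" "G' \<subseteq> M'"
  shows "incl n G G' M M' (incl n F F' G G' z) = incl n F F' M M' z"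
proof -
  have i: "id \<in> stage n F \<rightarrow> stage n G" if "F \<subseteq> G" for F G
    using stage_mono[OF that, of n] by auto
  show ?thesis using hom_induced_compose'[OF cont_incl[OF assms(1)] i[OF assms(3)] cont_incl[OF
      assms(2)] i[OF assms(4)]]
    by simp
qed

text \<open>The image of the relative homology of \<open>F\<close> is spanned by the classes of its cells: the exact
  sequence of the triple \<open>(F \<union> {e}, F, {})\<close> splits off one cell at a time.\<close>

lemma lincomb_stage:
  assumes "finite F" "F \<subseteq> cells K n"
  shows "w \<in> carrier (relgrp n F {}) \<Longrightarrow>
    \<exists>c. lincomb (cell_group K n) (cells K n) (cell_class K n) (incl n F {} (cells K n) {} w) c"
  using assms
proof (induction F arbitrary: w rule: finite_induct)
  case empty
  interpret H: comm_group "cell_group K n" unfolding cell_group_eq by simp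
  have t: "topspace (subtopology X (stage n {})) = stage n {}"
    using stage_subset[of "{}" n] by (simp add: Int_absorb1)
  have "trivial_group (relgrp n {} {})"
    using trivial_relative_homology_group_topspace[of "int n" "subtopology X (stage n {})"] unfolding t .
  then have "w = \<one>\<^bsub>relgrp n {} {}\<^esub>" using empty by (auto simp: trivial_group_def)
  then have "incl n {} {} (cells K n) {} w = \<one>\<^bsub>cell_group K n\<^esub>"
    using hom_one[OF incl_hom] unfolding cell_group_eq by simp
  then show ?case using H.lincomb_one by metis
next
  case (insert e F)
  then have e: "e \<in> cells K n" and F: "F \<subseteq> cells K n" "e \<notin> F" by auto
  let ?G = "insert e F"
  interpret H: comm_group "cell_group K n" unfolding cell_group_eq by simp
  interpret R: comm_group "relgrp n ?G {}" by simp
  interpret Q: comm_group "relgrp n ?G F" by simp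
  have b: "cell_class K n \<in> cells K n \<rightarrow> carrier (cell_group K n)"
    by (simp add: cell_class_eq cell_group_eq relcls_carrier)
  define u where "u = relcls n ?G {} e"
  have u: "u \<in> carrier (relgrp n ?G {})" by (simp add: u_def relcls_carrier)
  let ?j = "incl n ?G {} ?G F"
  interpret j: group_hom "relgrp n ?G {}" "relgrp n ?G F" ?j
    by unfold_locales (rule incl_hom)
  let ?k = "incl n ?G {} (cells K n) {}"
  interpret k: group_hom "relgrp n ?G {}" "cell_group K n" ?k
    unfolding cell_group_eq by (intro group_hom.intro group_hom_axioms.intro incl_hom) simp_all
  have ju: "?j u = relcls n ?G F e"
    unfolding u_def by (rule incl_relcls) (use e F in auto)
  have ku: "?k u = cell_class K n e"
    unfolding u_def cell_class_eq by (rule incl_relcls) (use e F in auto)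
  have "?j w \<in> carrier (relgrp n ?G F)" by (rule hom_induced_carrier)
  then obtain m :: int where m: "?j w = relcls n ?G F e [^]\<^bsub>relgrp n ?G F\<^esub> m"
    using relcls_generates(1)[OF e F] by blast
  \<comment> \<open>Removing from \<open>w\<close> its multiple of the new cell leaves an element
    that vanishes relative to \<open>F\<close>. By exactness the remainder comes from
    \<open>F\<close>, where the induction hypothesis applies.\<close>
  define v where "v = w \<otimes>\<^bsub>relgrp n ?G {}\<^esub> inv\<^bsub>relgrp n ?G {}\<^esub> (u [^]\<^bsub>relgrp n ?G {}\<^esub> m)"
  have v: "v \<in> carrier (relgrp n ?G {})" unfolding v_def using insert.prems(1) u by simp
  have w: "w = v \<otimes>\<^bsub>relgrp n ?G {}\<^esub> u [^]\<^bsub>relgrp n ?G {}\<^esub> m"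
    unfolding v_def using insert.prems(1) u by (simp add: R.m_assoc)
  have "?j v = ?j w \<otimes>\<^bsub>relgrp n ?G F\<^esub> inv\<^bsub>relgrp n ?G F\<^esub> (?j u [^]\<^bsub>relgrp n ?G F\<^esub> m)"
    unfolding v_def using insert.prems(1) u by (simp add: j.hom_int_pow)
  also have "\<dots> = \<one>\<^bsub>relgrp n ?G F\<^esub>"
    unfolding m ju using relcls_carrier by simp
  finally have "v \<in> kernel (relgrp n ?G {}) (relgrp n ?G F) ?j" using v by (simp add: kernel_def)
  moreover have "exact_seq ([relgrp n ?G F, relgrp n ?G {}, relgrp n F {}], [?j, incl n F {} ?G {}])"
  proof -
    have "subtopology (subtopology X (stage n ?G)) (stage n F) = subtopology X (stage n F)"
      using stage_mono[of F ?G n] by (simp add: subtopology_subtopology subset_insertI Int_absorb1)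
    then show ?thesis
      using homology_exactness_triple_3[of "stage n {}" "stage n F" "int n" "subtopology X (stage n
          ?G)"] stage_mono[of "{}" F n]
      by simp
  qed
  ultimately obtain t where t: "t \<in> carrier (relgrp n F {})" "v = incl n F {} ?G {} t"
    using exact_seq_kernel by blast
  have kv: "?k v = incl n F {} (cells K n) {} t"
    unfolding t(2) by (rule incl_compose) (use e F in auto)
  obtain c where c: "lincomb (cell_group K n) (cells K n) (cell_class K n) (?k v) c"
    using insert.IH[OF t(1) F(1)] unfolding kv by blast
  have "?k w = ?k v \<otimes>\<^bsub>cell_group K n\<^esub> cell_class K n e [^]\<^bsub>cell_group K n\<^esub> m"
    unfolding w using v u ku by (simp add: k.hom_int_pow)
  then show ?case
    using H.lincomb_mult[OF b c H.lincomb_pow[OF b H.lincomb_single[OF b e]], of m] by metis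
qed

text \<open>Collapses every \<open>n\<close>-cell except \<open>e\<close>. The target is infinite
  cyclic, and a combination of cell classes goes to the power of \<open>coord_gen\<close> whose
  exponent is its coefficient at \<open>e\<close>.\<close>

definition coord_map :: "nat \<Rightarrow> 'a set \<Rightarrow> 'a chain set \<Rightarrow> 'a chain set" where
  "coord_map n e = incl n (cells K n) {} (cells K n) (cells K n - {e})"

abbreviation coord_grp :: "nat \<Rightarrow> 'a set \<Rightarrow> 'a chain set monoid" where
  "coord_grp n e \<equiv> relgrp n (cells K n) (cells K n - {e})"

abbreviation coord_gen :: "nat \<Rightarrow> 'a set \<Rightarrow> 'a chain set" where
  "coord_gen n e \<equiv> relcls n (cells K n) (cells K n - {e}) e"

text \<open>The class of a cell other than \<open>e\<close> factors through the homology of a space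
  relative to itself, which is trivial.\<close>

lemma coord_map_class:
  assumes "e \<in> cells K n" "f \<in> cells K n"
  shows "coord_map n e (cell_class K n f) = (if f = e then coord_gen n e else \<one>\<^bsub>coord_grp n e\<^esub>)"
proof -
  have eq: "coord_map n e (cell_class K n f) = relcls n (cells K n) (cells K n - {e}) f"
    unfolding coord_map_def cell_class_eq by (rule incl_relcls) (use assms in auto)
  show ?thesis
  proof (cases "f = e")
    case False
    let ?F = "cells K n - {e}"
    have "f \<in> ?F" using False assms by auto
    then have i: "incl n ?F ?F (cells K n) ?F (relcls n ?F ?F f) = relcls n (cells K n) ?F f"
      by (intro incl_relcls) (use assms in auto)
    have t: "topspace (subtopology X (stage n ?F)) = stage n ?F"
      using stage_subset[of ?F n] by (simp add: Int_absorb1 Diff_subset)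
    have "trivial_group (relgrp n ?F ?F)"
      using trivial_relative_homology_group_topspace[of "int n" "subtopology X (stage n ?F)"] unfolding t .
    then have "relcls n ?F ?F f = \<one>\<^bsub>relgrp n ?F ?F\<^esub>"
      using relcls_carrier[of n ?F ?F f] by (auto simp: trivial_group_def)
    then have "relcls n (cells K n) ?F f = \<one>\<^bsub>coord_grp n e\<^esub>"
      using i hom_one[OF incl_hom[of n ?F ?F "cells K n" ?F]] by simp
    then show ?thesis using False eq by simp
  qed (use eq in simp)
qed

lemma cell_class_funcset: "cell_class K n \<in> B \<rightarrow> carrier (cell_group K n)"
  by (simp add: cell_class_eq cell_group_eq relcls_carrier)

lemma comm_cell_group: "comm_group (cell_group K n)"
  unfolding cell_group_eq by simp

lemma lincomb_coord:
  assumes "lincomb (cell_group K n) (cells K n) (cell_class K n) z c" "e \<in> cells K n"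
  shows "coord_map n e z = coord_gen n e [^]\<^bsub>coord_grp n e\<^esub> c e"
proof -
  interpret H: comm_group "cell_group K n" by (rule comm_cell_group)
  interpret Q: comm_group "coord_grp n e" by simp
  have h: "coord_map n e \<in> hom (cell_group K n) (coord_grp n e)"
    unfolding coord_map_def cell_group_eq by (rule incl_hom)
  interpret group_hom "cell_group K n" "coord_grp n e" "coord_map n e"
    by unfold_locales (rule h)
  \<comment> \<open>The coefficient at \<open>e\<close> may be zero; adding \<open>e\<close> to the
    support makes the product contain its factor in every case.\<close>
  let ?F = "insert e {f. c f \<noteq> 0}"
  have F: "finite ?F" "?F \<subseteq> cells K n"
    using H.lincomb_finite_support[OF assms(1)] assms(2) by auto
  have cl: "cell_class K n f \<in> carrier (cell_group K n)" for f
    using cell_class_funcset by blast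
  have z: "z = finprod (cell_group K n) (\<lambda>f. cell_class K n f [^]\<^bsub>cell_group K n\<^esub> c f) ?F"
    by (rule H.lincomb_superset[OF cell_class_funcset assms(1) F]) auto
  have "coord_map n e z = finprod (coord_grp n e) (\<lambda>f. coord_map n e (cell_class K n f [^]\<^bsub>cell_group K
      n\<^esub> c f)) ?F"
    unfolding z by (rule hom_finprod[OF comm_cell_group comm_relgrp h]) (use cl in auto)
  also have "\<dots> = finprod (coord_grp n e) (\<lambda>f. if f = e then coord_gen n e [^]\<^bsub>coord_grp n e\<^esub> c e else
      \<one>\<^bsub>coord_grp n e\<^esub>) ?F"
  proof (rule Q.finprod_cong'[OF refl])
    fix f assume f: "f \<in> ?F"
    then have "f \<in> cells K n" using F by blast
    then show "coord_map n e (cell_class K n f [^]\<^bsub>cell_group K n\<^esub> c f) =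
       (if f = e then coord_gen n e [^]\<^bsub>coord_grp n e\<^esub> c e else \<one>\<^bsub>coord_grp n e\<^esub>)"
      using hom_int_pow[OF cl, of f "c f"] coord_map_class[OF assms(2)] by simp
  qed (use relcls_carrier in auto)
  also have "\<dots> = coord_gen n e [^]\<^bsub>coord_grp n e\<^esub> c e"
    using Q.finprod_singleton[of e ?F "\<lambda>_. coord_gen n e [^]\<^bsub>coord_grp n e\<^esub> c e"] F(1) relcls_carrier
    by (simp add: eq_commute[of _ e])
  finally show ?thesis .
qed

text \<open>On a cell, the coefficient is recovered from \<open>z\<close> as an exponent in an
  infinite cyclic group; elsewhere both functions vanish by the support condition.\<close>

lemma lincomb_unique:
  assumes "lincomb (cell_group K n) (cells K n) (cell_class K n) z c"
    "lincomb (cell_group K n) (cells K n) (cell_class K n) z d"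
  shows "c = d"
proof
  fix e
  interpret H: comm_group "cell_group K n" by (rule comm_cell_group)
  show "c e = d e"
  proof (cases "e \<in> cells K n")
    case True
    have "inj (\<lambda>i::int. coord_gen n e [^]\<^bsub>coord_grp n e\<^esub> i)"
      using relcls_generates(2)[OF True, of "cells K n - {e}"] True by (simp add: insert_absorb)
    then show ?thesis using lincomb_coord[OF assms(1) True] lincomb_coord[OF assms(2) True]
      by (simp add: inj_eq)
  next
    case False
    then have "c e = 0" "d e = 0"
      using H.lincomb_finite_support[OF assms(1)] H.lincomb_finite_support[OF assms(2)] by blast+
    then show ?thesis by simp
  qed
qed

text \<open>Gives the description in \<open>cell_coords\<close> a value as soon as some
  representation is known, which is the only way it is evaluated below.\<close>

lemma cell_coords_eq:
  assumes "lincomb (cell_group K n) (cells K n) (cell_class K n) z c"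
  shows "cell_coords K n z = c"
proof -
  interpret H: comm_group "cell_group K n" by (rule comm_cell_group)
  note iff = H.lincomb_iff_support[OF cell_class_funcset]
  show ?thesis unfolding cell_coords_def
    by (rule the_equality) (use assms lincomb_unique in \<open>auto simp: iff[symmetric]\<close>)
qed

end

section \<open>The boundary map in coordinates\<close>

context cw begin

abbreviation rep :: "nat \<Rightarrow> 'a chain set \<Rightarrow> ('a set \<Rightarrow> int) \<Rightarrow> bool" where
  "rep n \<equiv> lincomb (cell_group K n) (cells K n) (cell_class K n)"

lemma cell_class_carrier: "cell_class K n e \<in> carrier (cell_group K n)"
  using cell_class_funcset by blast

lemma rep_class: "e \<in> cells K n \<Longrightarrow> rep n (cell_class K n e) (\<lambda>f. if f = e then 1 else 0)"
  by (rule comm_group.lincomb_single[OF comm_cell_group cell_class_funcset])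

lemma rep_pow: "rep n z c \<Longrightarrow> rep n (z [^]\<^bsub>cell_group K n\<^esub> (m::int)) (\<lambda>f. m * c f)"
  by (rule comm_group.lincomb_pow[OF comm_cell_group cell_class_funcset])

text \<open>Applied to the boundary and to the group action: together with
  \<open>lincomb_unique\<close> it turns identities between homomorphisms into identities between
  integer matrices.\<close>

lemma rep_hom:
  assumes T: "T \<in> hom (cell_group K m) (cell_group K n)"
    and a: "\<And>f. f \<in> cells K m \<Longrightarrow> rep n (T (cell_class K m f)) (a f)"
    and z: "rep m z c"
  shows "rep n (T z) (\<lambda>h. \<Sum>f | c f \<noteq> 0. c f * a f h)"
proof -
  interpret M: comm_group "cell_group K m" by (rule comm_cell_group)
  interpret N: comm_group "cell_group K n" by (rule comm_cell_group)
  let ?F = "{f. c f \<noteq> 0}"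
  have F: "finite ?F" "?F \<subseteq> cells K m" using M.lincomb_finite_support[OF z] by auto
  have "z = finprod (cell_group K m) (\<lambda>f. cell_class K m f [^]\<^bsub>cell_group K m\<^esub> c f) ?F"
    by (rule M.lincomb_superset[OF cell_class_funcset z F]) auto
  then have "T z = finprod (cell_group K n) (\<lambda>f. T (cell_class K m f [^]\<^bsub>cell_group K m\<^esub> c f)) ?F"
    by (simp only:) (rule hom_finprod[OF comm_cell_group comm_cell_group T], use cell_class_carrier in auto)
  also have "\<dots> = finprod (cell_group K n) (\<lambda>f. T (cell_class K m f) [^]\<^bsub>cell_group K n\<^esub> c f) ?F"
    by (simp only: hom_int_pow[OF T cell_class_carrier M.group_axioms N.group_axioms])
  finally show ?thesis
    by (simp only:) (rule N.lincomb_finprod[OF cell_class_funcset F(1)], use a F(2) in blast)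
qed

definition bd :: "nat \<Rightarrow> 'a chain set \<Rightarrow> 'a chain set" where
  "bd n = hom_relboundary (int (Suc n)) (skel K (int (Suc n))) (skel_set K (int n)) (skel_set K (int n -
      1))"

lemma incidence_bd: "incidence K n e f = cell_coords K n (bd n (cell_class K (Suc n) e)) f"
  by (simp only: incidence_def bd_def)

lemma skel_skel: "subtopology (skel K (int (Suc n))) (skel_set K (int n)) = skel K (int n)"
proof -
  have "skel_set K (int n) \<subseteq> skel_set K (int (Suc n))"
    unfolding skel_set_def by (rule UN_mono) auto
  then show ?thesis by (simp add: skel_def subtopology_subtopology Int_absorb1)
qed

lemma bd_hom: "bd n \<in> hom (cell_group K (Suc n)) (cell_group K n)"
  using group_homomorphism_hom_relboundary[of "int (Suc n)" "skel K (int (Suc n))" "skel_set K (int n)"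
      "skel_set K (int n - 1)"]
  unfolding skel_skel cell_group_def bd_def by simp

lemma bd_eq: "bd n z = hom_induced (int n) (skel K (int n)) {} (skel K (int n)) (lower n) id
    (hom_boundary (int (Suc n)) (skel K (int (Suc n))) (skel_set K (int n)) z)"
  using skel_skel[of n] by (simp add: bd_def hom_relboundary_def lower_def)

text \<open>The attaching sphere meets only finitely many cells, so the boundary class factors
  through the homology of a \<open>stage\<close> with finitely many \<open>n\<close>-cells, where
  \<open>lincomb_stage\<close> supplies coefficients.\<close>

lemma rep_bd_class_ex:
  assumes e: "e \<in> cells K (Suc n)"
  shows "\<exists>c. rep n (bd n (cell_class K (Suc n) e)) c"
proof -
  obtain F0 where F0: "finite F0" "F0 \<subseteq> (\<Union>m<Suc n. cells K m)" "char_map K e ` disc_bdry (Suc n) \<subseteq> \<Union>F0"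
    using finite_bdry[OF e] by blast
  \<comment> \<open>Cells of dimension below \<open>n\<close> already lie in \<open>lower n\<close>;
    only the \<open>n\<close>-cells met by the sphere have to be listed.\<close>
  define F where "F = F0 \<inter> cells K n"
  have F: "finite F" "F \<subseteq> cells K n" using F0(1) by (auto simp: F_def)
  have "\<Union>F0 \<subseteq> stage n F"
  proof
    fix x assume "x \<in> \<Union>F0"
    then obtain f m where f: "x \<in> f" "f \<in> F0" "m < Suc n" "f \<in> cells K m" using F0(2) by blast
    show "x \<in> stage n F"
    proof (cases "m = n")
      case False
      then have "m < n" using f(3) by simp
      then show ?thesis using f unfolding stage_def lower_eq by blast
    qed (use f in \<open>auto simp: stage_def F_def\<close>)
  qed
  then have im: "char_map K e ` disc_bdry (Suc n) \<subseteq> stage n F" using F0(3) by (rule order_trans[rotated])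
  let ?D = "disc (Suc n)" and ?B = "disc_bdry (Suc n)" and ?T = "subtopology X (stage n F)"
  let ?SS = "skel K (int (Suc n))" and ?S = "skel K (int n)"
  have c1: "continuous_map ?D ?SS (char_map K e)"
    using cont_stage[OF e subset_refl e] by (simp only: skel_eq)
  have b1: "char_map K e \<in> ?B \<rightarrow> skel_set K (int n)"
    using char_bdry_Pi[OF e] by (simp only: lower_Suc)
  have c2: "continuous_map (subtopology ?D ?B) ?T (char_map K e)"
    by (rule continuous_map_into_subtopology[OF continuous_map_from_subtopology[OF cont_char[OF e]]])
       (use im in auto)
  have c3: "continuous_map ?T ?S id" unfolding skel_eq by (rule cont_incl[OF F(2)])
  have d: "int (Suc n) - 1 = int n" by simp
  let ?y = "hom_boundary (int (Suc n)) ?D ?B (disc_class (Suc n))"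
  have "hom_boundary (int (Suc n)) ?SS (skel_set K (int n)) (cell_class K (Suc n) e)
      = hom_induced (int n) (subtopology ?D ?B) {} ?S {} (char_map K e) ?y"
    using fun_cong[OF naturality_hom_induced[OF c1 b1, of "int (Suc n)"], of "disc_class (Suc n)"]
    by (simp only: cell_class_def o_apply d skel_skel)
  also have "\<dots> = hom_induced (int n) (subtopology ?D ?B) {} ?S {} (id \<circ> char_map K e) ?y" by simp
  also have "\<dots> = hom_induced (int n) ?T {} ?S {} id (hom_induced (int n) (subtopology ?D ?B) {} ?T {}
      (char_map K e) ?y)"
    by (rule hom_induced_compose'[symmetric, OF c2 _ c3]) auto
  finally have hb: "hom_boundary (int (Suc n)) ?SS (skel_set K (int n)) (cell_class K (Suc n) e)
      = hom_induced (int n) ?T {} ?S {} id (hom_induced (int n) (subtopology ?D ?B) {} ?T {} (char_map K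
          e) ?y)" .
  define y where "y = hom_induced (int n) (subtopology ?D ?B) {} ?T {} (char_map K e) ?y"
  have "bd n (cell_class K (Suc n) e) = hom_induced (int n) ?S {} ?S (lower n) id (hom_induced (int n)
      ?T {} ?S {} id y)"
    unfolding bd_eq hb y_def ..
  also have "\<dots> = hom_induced (int n) ?T {} ?S (lower n) (id \<circ> id) y"
    by (rule hom_induced_compose'[OF c3]) auto
  also have "\<dots> = hom_induced (int n) ?T (lower n) ?S (lower n) id (hom_induced (int n) ?T {} ?T (lower
      n) id y)"
    by (rule hom_induced_compose'[symmetric, OF _ _ c3]) auto
  also have "\<dots> = incl n F {} (cells K n) {} (hom_induced (int n) ?T {} ?T (lower n) id y)"
    by (simp only: skel_eq stage_empty)
  finally show ?thesis
    using lincomb_stage[OF F, of "hom_induced (int n) ?T {} ?T (lower n) id y"]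
    by (simp only: stage_empty hom_induced_carrier simp_thms)
qed

lemma rep_bd_class: "e \<in> cells K (Suc n) \<Longrightarrow> rep n (bd n (cell_class K (Suc n) e)) (incidence K n e)"
proof -
  assume "e \<in> cells K (Suc n)"
  then obtain c where c: "rep n (bd n (cell_class K (Suc n) e)) c" using rep_bd_class_ex by blast
  have "incidence K n e = c"
    by (rule ext) (simp only: incidence_bd cell_coords_eq[OF c])
  with c show ?thesis by simp
qed

lemma finite_incidence: "e \<in> cells K (Suc n) \<Longrightarrow> finite {f. incidence K n e f \<noteq> 0}"
  and incidence_cells: "e \<in> cells K (Suc n) \<Longrightarrow> incidence K n e f \<noteq> 0 \<Longrightarrow> f \<in> cells K n"
  using comm_group.lincomb_finite_support[OF comm_cell_group rep_bd_class, of e n] by auto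

text \<open>The composite contains two consecutive maps of the exact sequence of the pair formed by
  the skeleta of dimensions n+1 and n: absolute homology into relative homology, then the connecting
  map.\<close>

lemma bd_bd: "bd n (bd (Suc n) z) = \<one>\<^bsub>cell_group K n\<^esub>"
proof -
  let ?S = "skel K (int (Suc n))"
  define y where "y = hom_boundary (int (Suc (Suc n))) (skel K (int (Suc (Suc n)))) (skel_set K (int
      (Suc n))) z"
  have y: "y \<in> carrier (homology_group (int (Suc n)) ?S)"
    using hom_boundary_carrier[of "int (Suc (Suc n))" "skel K (int (Suc (Suc n)))" "skel_set K (int (Suc
        n))" z]
    unfolding skel_skel y_def by simp
  have ex: "exact_seq ([homology_group (int (Suc n) - 1) (subtopology ?S (skel_set K (int n))),
      relative_homology_group (int (Suc n)) ?S (skel_set K (int n)), homology_group (int (Suc n)) ?S],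
      [hom_boundary (int (Suc n)) ?S (skel_set K (int n)),
          hom_induced (int (Suc n)) ?S {} ?S (skel_set K (int n)) id])"
    by (rule homology_exactness_axiom_1)
  have "hom_boundary (int (Suc n)) ?S (skel_set K (int n)) (hom_induced (int (Suc n)) ?S {} ?S (skel_set
      K (int n)) id y)
     = \<one>\<^bsub>homology_group (int (Suc n) - 1) (subtopology ?S (skel_set K (int n)))\<^esub>"
    using exact_seq_kernel[OF ex] y by (auto simp: kernel_def)
  then have "hom_boundary (int (Suc n)) ?S (skel_set K (int n)) (bd (Suc n) z)
      = \<one>\<^bsub>homology_group (int n) (skel K (int n))\<^esub>"
    unfolding bd_eq y_def lower_Suc skel_skel by simp
  then have "bd n (bd (Suc n) z) = hom_induced (int n) (skel K (int n)) {} (skel K (int n)) (lower n) id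
      \<one>\<^bsub>homology_group (int n) (skel K (int n))\<^esub>"
    unfolding bd_eq[of n] by simp
  also have "\<dots> = \<one>\<^bsub>cell_group K n\<^esub>"
    unfolding cell_group_def lower_def by (rule hom_one[OF hom_induced_hom]) simp_all
  finally show ?thesis .
qed

lemma incidence_incidence:
  assumes "e \<in> cells K (Suc (Suc n))"
  shows "(\<Sum>f | incidence K (Suc n) e f \<noteq> 0. incidence K (Suc n) e f * incidence K n f h) = 0"
proof -
  have "rep n (bd n (bd (Suc n) (cell_class K (Suc (Suc n)) e)))
     (\<lambda>h. \<Sum>f | incidence K (Suc n) e f \<noteq> 0. incidence K (Suc n) e f * incidence K n f h)"
    by (rule rep_hom[OF bd_hom rep_bd_class rep_bd_class[OF assms]])
  then have "(\<lambda>h. \<Sum>f | incidence K (Suc n) e f \<noteq> 0. incidence K (Suc n) e f * incidence K n f h) = (\<lambda>_. 0)"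
    unfolding bd_bd by (rule lincomb_unique) (rule comm_group.lincomb_one[OF comm_cell_group])
  then show ?thesis by metis
qed

end

section \<open>Cellular group actions\<close>

locale cw_action = cw K + group \<Gamma>
  for K :: "'a cw_complex" and \<Gamma> :: "('g, 'm) monoid_scheme" (structure) +
  fixes \<phi> :: "'g \<Rightarrow> 'a \<Rightarrow> 'a"
  assumes cocompact: "cocompact_cw_complex \<Gamma> K \<phi>"
begin

lemma action: "group_action \<Gamma> (topspace X) \<phi>"
  and cont_action: "g \<in> carrier \<Gamma> \<Longrightarrow> continuous_map X X (\<phi> g)"
  and act_cells: "g \<in> carrier \<Gamma> \<Longrightarrow> e \<in> cells K n \<Longrightarrow> \<phi> g ` e \<in> cells K n"
  and act_free_all: "g \<in> carrier \<Gamma> \<Longrightarrow> e \<in> all_cells K \<Longrightarrow> \<phi> g ` e = e \<Longrightarrow> g = \<one>"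
  and compact_orbits: "compact_space (orbit_space \<Gamma> X \<phi>)"
  using cocompact unfolding cocompact_cw_complex_def by blast+

lemma act_one: "x \<in> topspace X \<Longrightarrow> \<phi> \<one> x = x"
  and act_mult: "x \<in> topspace X \<Longrightarrow> g \<in> carrier \<Gamma> \<Longrightarrow> h \<in> carrier \<Gamma> \<Longrightarrow> \<phi> (g \<otimes> h) x = \<phi> g (\<phi> h x)"
  using group_action.id_eq_one[OF action] group_action.composition_rule[OF action]
      by (metis restrict_apply)+

definition mv :: "'g \<Rightarrow> 'a set \<Rightarrow> 'a set" where "mv g e = \<phi> g ` e"

lemma mv_cells: "g \<in> carrier \<Gamma> \<Longrightarrow> e \<in> cells K n \<Longrightarrow> mv g e \<in> cells K n"
  by (simp add: mv_def act_cells)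

lemma mv_one: "e \<in> cells K n \<Longrightarrow> mv \<one> e = e"
  unfolding mv_def using cell_subset act_one by force

lemma mv_mult: "e \<in> cells K n \<Longrightarrow> g \<in> carrier \<Gamma> \<Longrightarrow> h \<in> carrier \<Gamma> \<Longrightarrow> mv (g \<otimes> h) e = mv g (mv h e)"
  unfolding mv_def image_image by (intro image_cong refl act_mult) (auto dest: subsetD[OF cell_subset])

lemma mv_inv: "e \<in> cells K n \<Longrightarrow> g \<in> carrier \<Gamma> \<Longrightarrow> mv (inv g) (mv g e) = e"
  and mv_inv2: "e \<in> cells K n \<Longrightarrow> g \<in> carrier \<Gamma> \<Longrightarrow> mv g (mv (inv g) e) = e"
  by (metis mv_mult mv_one inv_closed l_inv r_inv)+

lemma mv_inj: "e \<in> cells K n \<Longrightarrow> f \<in> cells K n \<Longrightarrow> g \<in> carrier \<Gamma> \<Longrightarrow> mv g e = mv g f \<longleftrightarrow> e = f"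
  by (metis mv_inv)

lemma mv_free:
  assumes "e \<in> cells K n" "g \<in> carrier \<Gamma>" "h \<in> carrier \<Gamma>" "mv g e = mv h e"
  shows "g = h"
proof -
  have "mv (inv h \<otimes> g) e = mv (inv h) (mv g e)"
    by (rule mv_mult) (use assms in auto)
  also have "\<dots> = e" unfolding assms(4) by (rule mv_inv[OF assms(1,3)])
  finally have "mv (inv h \<otimes> g) e = e" .
  then have "inv h \<otimes> g = \<one>"
    using act_free_all[of "inv h \<otimes> g" e] assms cells_all by (simp add: mv_def)
  then have "h \<otimes> (inv h \<otimes> g) = h" using assms by simp
  then show ?thesis using assms by (simp add: m_assoc[symmetric])
qed

lemma act_skel_set: "g \<in> carrier \<Gamma> \<Longrightarrow> \<phi> g ` skel_set K p \<subseteq> skel_set K p"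
  unfolding skel_set_def using act_cells by blast

lemma cont_skel: "g \<in> carrier \<Gamma> \<Longrightarrow> continuous_map (skel K p) (skel K p) (\<phi> g)"
  unfolding skel_def using act_skel_set[of g p]
  by (intro continuous_map_into_subtopology continuous_map_from_subtopology cont_action) auto

definition act :: "nat \<Rightarrow> 'g \<Rightarrow> 'a chain set \<Rightarrow> 'a chain set" where
  "act n g = hom_induced (int n) (skel K (int n)) (skel_set K (int n - 1))
               (skel K (int n)) (skel_set K (int n - 1)) (\<phi> g)"

lemma act_hom: "act n g \<in> hom (cell_group K n) (cell_group K n)"
  unfolding act_def cell_group_def by (rule hom_induced_hom)

lemma skel_topspace: "topspace (skel K p) \<subseteq> topspace X"
  by (simp add: skel_def)

lemma act_act:
  assumes "g \<in> carrier \<Gamma>" "h \<in> carrier \<Gamma>"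
  shows "act n g (act n h z) = act n (g \<otimes> h) z"
proof -
  let ?A = "skel_set K (int n - 1)" and ?S = "skel K (int n)"
  have P: "\<phi> g \<in> ?A \<rightarrow> ?A" if "g \<in> carrier \<Gamma>" for g using act_skel_set[OF that] by blast
  have "act n g (act n h z) = hom_induced (int n) ?S ?A ?S ?A (\<phi> g \<circ> \<phi> h) z"
    unfolding act_def by (rule hom_induced_compose'[OF cont_skel P cont_skel P]) fact+
  also have "hom_induced (int n) ?S ?A ?S ?A (\<phi> g \<circ> \<phi> h) = hom_induced (int n) ?S ?A ?S ?A (\<phi> (g \<otimes> h))"
    by (rule hom_induced_eq) (use subsetD[OF skel_topspace] act_mult assms in auto)
  finally show ?thesis by (simp add: act_def)
qed

lemma act_one_class: "z \<in> carrier (cell_group K n) \<Longrightarrow> act n \<one> z = z"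
  unfolding act_def cell_group_def
  by (rule hom_induced_id_gen) (use cont_skel subsetD[OF skel_topspace] act_one in auto)

text \<open>The translate of the closed cell lies in the stage with the single cell
  \<open>mv g e\<close>, so the translated class factors through a group generated by the class of
  that cell.\<close>

lemma act_class_ex:
  assumes g: "g \<in> carrier \<Gamma>" and e: "e \<in> cells K n"
  shows "\<exists>m::int. act n g (cell_class K n e) = cell_class K n (mv g e) [^]\<^bsub>cell_group K n\<^esub> m"
proof -
  let ?f = "mv g e" and ?D = "disc n" and ?B = "disc_bdry n"
  let ?T = "subtopology X (stage n {?f})"
  have f: "?f \<in> cells K n" by (rule mv_cells[OF g e])
  have lower: "\<phi> g ` lower n \<subseteq> lower n" unfolding lower_def by (rule act_skel_set[OF g])
  have "char_map K e ` topspace ?D \<subseteq> e \<union> lower n"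
    using closed_cell_split[OF e] bdry_lower[OF e] unfolding closed_cell_def by blast
  then have "(\<phi> g \<circ> char_map K e) ` topspace ?D \<subseteq> stage n {?f}"
    using lower unfolding stage_def mv_def by auto
  then have c: "continuous_map ?D ?T (\<phi> g \<circ> char_map K e)"
    by (intro continuous_map_into_subtopology continuous_map_compose[OF cont_char[OF e] cont_action[OF
        g]]) auto
  have b: "\<phi> g \<circ> char_map K e \<in> ?B \<rightarrow> lower n"
  proof
    fix x assume "x \<in> ?B"
    then have "char_map K e x \<in> lower n" using bdry_lower[OF e] by blast
    then show "(\<phi> g \<circ> char_map K e) x \<in> lower n" using lower by auto
  qed
  have cs: "continuous_map ?D (skel K (int n)) (char_map K e)"
    unfolding skel_eq by (rule cont_stage[OF e subset_refl e])
  have i: "continuous_map ?T (skel K (int n)) id" unfolding skel_eq by (rule cont_incl) (use f in auto)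
  define w where "w = hom_induced (int n) ?D ?B ?T (lower n) (\<phi> g \<circ> char_map K e) (disc_class n)"
  have "act n g (cell_class K n e) = hom_induced (int n) ?D ?B (skel K (int n)) (lower n) (\<phi> g \<circ>
      char_map K e) (disc_class n)"
    unfolding act_def cell_class_def lower_def
    by (rule hom_induced_compose'[OF cs _ cont_skel[OF g]])
       (use char_bdry_Pi[OF e] lower in \<open>auto simp: lower_def\<close>)
  also have "\<dots> = hom_induced (int n) ?D ?B (skel K (int n)) (lower n) (id \<circ> (\<phi> g \<circ> char_map K e))
      (disc_class n)" by simp
  also have "\<dots> = hom_induced (int n) ?T (lower n) (skel K (int n)) (lower n) id w"
    unfolding w_def by (rule hom_induced_compose'[symmetric, OF c b i]) auto
  also have "\<dots> = incl n {?f} {} (cells K n) {} w"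
    by (simp only: skel_eq stage_empty)
  finally have 1: "act n g (cell_class K n e) = incl n {?f} {} (cells K n) {} w" .
  have "w \<in> carrier (relgrp n {?f} {})"
    unfolding w_def stage_empty by (rule hom_induced_carrier)
  then obtain m :: int where m: "w = relcls n {?f} {} ?f [^]\<^bsub>relgrp n {?f} {}\<^esub> m"
    using relcls_generates(1)[OF f, of "{}"] by auto
  have "incl n {?f} {} (cells K n) {} w = incl n {?f} {} (cells K n) {} (relcls n {?f} {} ?f)
      [^]\<^bsub>cell_group K n\<^esub> m"
    unfolding m cell_group_eq by (rule hom_int_pow[OF incl_hom relcls_carrier]) simp_all
  also have "incl n {?f} {} (cells K n) {} (relcls n {?f} {} ?f) = cell_class K n ?f"
    unfolding cell_class_eq by (rule incl_relcls) (use f in auto)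
  finally show ?thesis unfolding 1 by blast
qed

text \<open>Compares the orientation transported by \<open>g\<close> with the one chosen on
  \<open>mv g e\<close>. At this point it is just an integer; \<open>orient_square\<close> shows
  that it is a sign.\<close>

definition orient :: "nat \<Rightarrow> 'g \<Rightarrow> 'a set \<Rightarrow> int" where
  "orient n g e = cell_coords K n (act n g (cell_class K n e)) (mv g e)"

lemma act_class:
  assumes g: "g \<in> carrier \<Gamma>" and e: "e \<in> cells K n"
  shows "act n g (cell_class K n e) = cell_class K n (mv g e) [^]\<^bsub>cell_group K n\<^esub> orient n g e"
    and "rep n (act n g (cell_class K n e)) (\<lambda>f. if f = mv g e then orient n g e else 0)"
proof -
  obtain m :: int where m: "act n g (cell_class K n e) = cell_class K n (mv g e) [^]\<^bsub>cell_group K n\<^esub> m"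
    using act_class_ex[OF assms] by blast
  have r: "rep n (act n g (cell_class K n e)) (\<lambda>f. m * (if f = mv g e then 1 else 0))"
    unfolding m by (rule rep_pow[OF rep_class[OF mv_cells[OF g e]]])
  then have "orient n g e = m" unfolding orient_def cell_coords_eq[OF r] by simp
  then show "act n g (cell_class K n e) = cell_class K n (mv g e) [^]\<^bsub>cell_group K n\<^esub> orient n g e"
    using m by simp
  have "(\<lambda>f. m * (if f = mv g e then 1 else 0)) = (\<lambda>f. if f = mv g e then orient n g e else 0)"
    using \<open>orient n g e = m\<close> by auto
  then show "rep n (act n g (cell_class K n e)) (\<lambda>f. if f = mv g e then orient n g e else 0)"
    using r by simp
qed

lemma orient_one: "e \<in> cells K n \<Longrightarrow> orient n \<one> e = 1"
  unfolding orient_def using cell_coords_eq[OF rep_class]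
  by (simp add: act_one_class cell_class_carrier mv_one)

text \<open>The cocycle identity, read off from functoriality of the induced maps by comparing
  exponents.\<close>

lemma orient_mult:
  assumes "g \<in> carrier \<Gamma>" "h \<in> carrier \<Gamma>" "e \<in> cells K n"
  shows "orient n (g \<otimes> h) e = orient n g (mv h e) * orient n h e"
proof -
  let ?G = "cell_group K n"
  interpret G: comm_group ?G by (rule comm_cell_group)
  have "act n (g \<otimes> h) (cell_class K n e) = act n g (cell_class K n (mv h e) [^]\<^bsub>?G\<^esub> orient n h e)"
    by (simp only: act_act[OF assms(1,2), symmetric] act_class(1)[OF assms(2,3)])
  also have "\<dots> = act n g (cell_class K n (mv h e)) [^]\<^bsub>?G\<^esub> orient n h e"
    by (rule hom_int_pow[OF act_hom cell_class_carrier]) simp_all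
  finally have "rep n (act n (g \<otimes> h) (cell_class K n e))
      (\<lambda>f. orient n h e * (if f = mv g (mv h e) then orient n g (mv h e) else 0))"
    using rep_pow[OF act_class(2)[OF assms(1) mv_cells[OF assms(2,3)]]] by simp
  from cell_coords_eq[OF this] show ?thesis
    unfolding orient_def[of n "g \<otimes> h"] by (simp add: mv_mult[OF assms(3,1,2)])
qed

text \<open>The cocycle identity for \<open>inv g\<close> and \<open>g\<close> exhibits the integer
  as a unit. The squared form is the one in which signs cancel later.\<close>

lemma orient_square:
  assumes "g \<in> carrier \<Gamma>" "e \<in> cells K n"
  shows "orient n g e * orient n g e = 1"
proof -
  have "orient n (inv g) (mv g e) * orient n g e = 1"
    using orient_mult[of "inv g" g e n] orient_one assms by simp
  then show ?thesis by (auto simp: zmult_eq_1_iff)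
qed

text \<open>A single cell is carried to \<open>mv g e\<close>, so the infinite sum in
  \<open>chain_action\<close> has one possibly nonzero term.\<close>

lemma chain_action_mv:
  assumes "g \<in> carrier \<Gamma>" "e \<in> cells K n"
  shows "chain_action K \<phi> n g u (mv g e) = of_int (orient n g e) * u e"
proof -
  have c: "cell_coords K n (act n g (cell_class K n f)) (mv g e) = (if f = e then orient n g e else 0)"
    if "f \<in> cells K n" for f
    using cell_coords_eq[OF act_class(2)[OF assms(1) that]] mv_inj[OF that assms(2,1)] by auto
  have "chain_action K \<phi> n g u (mv g e) =
      (\<Sum>\<^sub>\<infinity>f\<in>cells K n. of_int (cell_coords K n (act n g (cell_class K n f)) (mv g e)) * u f)"
    by (simp add: chain_action_def mv_cells assms act_def)
  also have "\<dots> = (\<Sum>\<^sub>\<infinity>f\<in>{e}. of_int (orient n g e) * u f)"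
    by (rule infsum_cong_neutral) (use c assms in auto)
  finally show ?thesis by simp
qed

lemma chain_action_outside: "f \<notin> cells K n \<Longrightarrow> chain_action K \<phi> n g u f = 0"
  by (simp add: chain_action_def)

text \<open>Naturality of the connecting map under \<open>\<phi> g\<close>. Both routes represent
  the same class in the cell basis, and their coefficients at \<open>mv g f\<close> must
  agree.\<close>

lemma incidence_equivariant:
  assumes g: "g \<in> carrier \<Gamma>" and e: "e \<in> cells K (Suc n)" and f: "f \<in> cells K n"
  shows "orient (Suc n) g e * incidence K n (mv g e) (mv g f) = incidence K n e f * orient n g f"
proof -
  let ?S = "skel_set K (int n)" and ?T = "skel_set K (int n - 1)"
  have "hom_relboundary (int (Suc n)) (skel K (int (Suc n))) ?S ?T \<circ>
      hom_induced (int (Suc n)) (skel K (int (Suc n))) ?S (skel K (int (Suc n))) ?S (\<phi> g) =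
      hom_induced (int (Suc n) - 1) (subtopology (skel K (int (Suc n))) ?S) ?T (subtopology (skel K (int
          (Suc n))) ?S) ?T (\<phi> g) \<circ>
      hom_relboundary (int (Suc n)) (skel K (int (Suc n))) ?S ?T"
    by (rule naturality_hom_induced_relboundary[OF cont_skel[OF g]]) (use act_skel_set[OF g] in blast)+
  from fun_cong[OF this, of "cell_class K (Suc n) e"]
  have nat: "bd n (act (Suc n) g (cell_class K (Suc n) e)) = act n g (bd n (cell_class K (Suc n) e))"
    unfolding skel_skel by (simp add: bd_def act_def)
  have "bd n (act (Suc n) g (cell_class K (Suc n) e)) = bd n (cell_class K (Suc n) (mv g e))
      [^]\<^bsub>cell_group K n\<^esub> orient (Suc n) g e"
    unfolding act_class(1)[OF g e]
    by (rule hom_int_pow[OF bd_hom cell_class_carrier]) (simp_all add: comm_group.axioms(2) comm_cell_group)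
  then have "rep n (act n g (bd n (cell_class K (Suc n) e))) (\<lambda>h. orient (Suc n) g e * incidence K n (mv
      g e) h)"
    using rep_pow[OF rep_bd_class[OF mv_cells[OF g e]]] nat by simp
  moreover have "rep n (act n g (bd n (cell_class K (Suc n) e)))
      (\<lambda>h. \<Sum>f | incidence K n e f \<noteq> 0. incidence K n e f * (if h = mv g f then orient n g f else 0))"
    by (rule rep_hom[OF act_hom act_class(2)[OF g] rep_bd_class[OF e]])
  ultimately have "(\<lambda>h. orient (Suc n) g e * incidence K n (mv g e) h) =
     (\<lambda>h. \<Sum>f | incidence K n e f \<noteq> 0. incidence K n e f * (if h = mv g f then orient n g f else 0))"
    by (rule lincomb_unique)
  then have "orient (Suc n) g e * incidence K n (mv g e) (mv g f) =
     (\<Sum>f' | incidence K n e f' \<noteq> 0. incidence K n e f' * (if mv g f = mv g f' then orient n g f' else 0))"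
    by metis
  also have "\<dots> = (\<Sum>f' | incidence K n e f' \<noteq> 0. if f' = f then incidence K n e f * orient n g f else 0)"
    by (rule sum.cong) (use mv_inj[OF f incidence_cells[OF e] g] in auto)
  also have "\<dots> = incidence K n e f * orient n g f"
    using finite_incidence[OF e] by (simp add: sum.delta)
  finally show ?thesis .
qed

end

section \<open>Square-summable functions\<close>

abbreviation sqnorm :: "('e \<Rightarrow> complex) \<Rightarrow> real" where
  "sqnorm u \<equiv> \<Sum>\<^sub>\<infinity>x. (cmod (u x))\<^sup>2"

abbreviation sqdist :: "('e \<Rightarrow> complex) \<Rightarrow> ('e \<Rightarrow> complex) \<Rightarrow> real" where
  "sqdist u v \<equiv> sqnorm (\<lambda>x. u x - v x)"

lemma ell2_summable: "u \<in> ell2 E \<Longrightarrow> (\<lambda>x. (cmod (u x))\<^sup>2) summable_on UNIV"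
  by (simp add: ell2_def)

lemma ell2_outside: "u \<in> ell2 E \<Longrightarrow> x \<notin> E \<Longrightarrow> u x = 0"
  by (auto simp: ell2_def)

lemma sqnorm_nonneg: "0 \<le> sqnorm u"
  by (rule infsum_nonneg) simp

lemma ell2_norm_sq: "(ell2_norm u)\<^sup>2 = sqnorm u"
  by (simp add: ell2_norm_def sqnorm_nonneg)

lemma sqnorm_ge_finite: "u \<in> ell2 E \<Longrightarrow> finite F \<Longrightarrow> (\<Sum>x\<in>F. (cmod (u x))\<^sup>2) \<le> sqnorm u"
  by (rule finite_sum_le_infsum) (auto simp: ell2_summable)

lemma sqnorm_ge_point: "u \<in> ell2 E \<Longrightarrow> (cmod (u x))\<^sup>2 \<le> sqnorm u"
  using sqnorm_ge_finite[of u E "{x}"] by simp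

text \<open>Bounds on finite partial sums survive pointwise limits, so this is the device by which
  limits are shown to be square-summable with controlled norm.\<close>

lemma ell2_boundI:
  assumes "\<And>F. finite F \<Longrightarrow> (\<Sum>x\<in>F. (cmod (u x))\<^sup>2) \<le> B" and "\<And>x. x \<notin> E \<Longrightarrow> u x = 0"
  shows "u \<in> ell2 E" "sqnorm u \<le> B"
proof -
  have s: "(\<lambda>x. (cmod (u x))\<^sup>2) summable_on UNIV"
    by (rule nonneg_bdd_above_summable_on) (use assms(1) in \<open>auto intro!: bdd_aboveI[where M=B]\<close>)
  then show "u \<in> ell2 E" using assms(2) by (auto simp: ell2_def)
  show "sqnorm u \<le> B"
    by (rule infsum_le_finite_sums[OF s]) (use assms(1) in auto)
qed

text \<open>A substitute for the triangle inequality that stays with squared norms; the factor 2 is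
  harmless for convergence.\<close>

lemma sq_cmod_add: "(cmod (a + b))\<^sup>2 \<le> 2 * (cmod a)\<^sup>2 + 2 * (cmod b)\<^sup>2"
proof -
  have "(cmod (a + b))\<^sup>2 \<le> (cmod a + cmod b)\<^sup>2"
    by (intro power_mono norm_triangle_ineq) auto
  also have "\<dots> \<le> 2 * (cmod a)\<^sup>2 + 2 * (cmod b)\<^sup>2"
    using zero_le_power2[of "cmod a - cmod b"] by (simp add: power2_eq_square algebra_simps)
  finally show ?thesis .
qed

lemma ell2_add:
  assumes "u \<in> ell2 E" "v \<in> ell2 E"
  shows "(\<lambda>x. u x + v x) \<in> ell2 E" "sqnorm (\<lambda>x. u x + v x) \<le> 2 * sqnorm u + 2 * sqnorm v"
proof -
  have "(\<Sum>x\<in>F. (cmod (u x + v x))\<^sup>2) \<le> 2 * sqnorm u + 2 * sqnorm v" if "finite F" for F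
  proof -
    have "(\<Sum>x\<in>F. (cmod (u x + v x))\<^sup>2) \<le> (\<Sum>x\<in>F. 2 * (cmod (u x))\<^sup>2 + 2 * (cmod (v x))\<^sup>2)"
      by (intro sum_mono sq_cmod_add)
    also have "\<dots> = 2 * (\<Sum>x\<in>F. (cmod (u x))\<^sup>2) + 2 * (\<Sum>x\<in>F. (cmod (v x))\<^sup>2)"
      by (simp add: sum.distrib sum_distrib_left)
    also have "\<dots> \<le> 2 * sqnorm u + 2 * sqnorm v"
      using sqnorm_ge_finite[OF assms(1) that] sqnorm_ge_finite[OF assms(2) that] by simp
    finally show ?thesis .
  qed
  from ell2_boundI[OF this, of E] show "(\<lambda>x. u x + v x) \<in> ell2 E"
    "sqnorm (\<lambda>x. u x + v x) \<le> 2 * sqnorm u + 2 * sqnorm v"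
    using assms by (auto simp: ell2_outside)
qed

lemma ell2_scale:
  assumes "u \<in> ell2 E"
  shows "(\<lambda>x. c * u x) \<in> ell2 E" "sqnorm (\<lambda>x. c * u x) = (cmod c)\<^sup>2 * sqnorm u"
proof -
  have eq: "(\<lambda>x. (cmod (c * u x))\<^sup>2) = (\<lambda>x. (cmod c)\<^sup>2 * (cmod (u x))\<^sup>2)"
    by (simp add: norm_mult power_mult_distrib)
  show "(\<lambda>x. c * u x) \<in> ell2 E" using assms unfolding ell2_def mem_Collect_eq eq
    by (auto intro: summable_on_cmult_right)
  show "sqnorm (\<lambda>x. c * u x) = (cmod c)\<^sup>2 * sqnorm u"
    unfolding eq by (rule infsum_cmult_right')
qed

lemma ell2_zero: "(\<lambda>_. 0) \<in> ell2 E"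
  by (auto simp: ell2_def)

lemma ell2_diff: "u \<in> ell2 E \<Longrightarrow> v \<in> ell2 E \<Longrightarrow> (\<lambda>x. u x - v x) \<in> ell2 E"
  using ell2_add(1)[OF _ ell2_scale(1), of u E v "-1"] by simp

lemma sqnorm_diff_commute: "sqdist u v = sqdist v u"
  by (simp add: norm_minus_commute)

lemma sqnorm_diff_triangle:
  assumes "u \<in> ell2 E" "v \<in> ell2 E" "w \<in> ell2 E"
  shows "sqdist u w \<le> 2 * sqdist u v + 2 * sqdist v w"
  using ell2_add(2)[OF ell2_diff[OF assms(1,2)] ell2_diff[OF assms(2,3)]] by simp

lemma ell2_finite_support:
  assumes "finite {x. u x \<noteq> 0}" "{x. u x \<noteq> 0} \<subseteq> E"
  shows "u \<in> ell2 E"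
proof -
  have "(\<lambda>x. (cmod (u x))\<^sup>2) summable_on UNIV"
    using summable_on_cong_neutral[of UNIV "{x. u x \<noteq> 0}" "\<lambda>x. (cmod (u x))\<^sup>2" "\<lambda>x. (cmod (u x))\<^sup>2"]
      summable_on_finite[OF assms(1)] by auto
  then show ?thesis using assms(2) by (auto simp: ell2_def)
qed

abbreviation delta :: "'e \<Rightarrow> 'e \<Rightarrow> complex" where "delta y \<equiv> \<lambda>z. if z = y then 1 else 0"

lemma delta_ell2: "y \<in> E \<Longrightarrow> delta y \<in> ell2 E"
  by (rule ell2_finite_support) auto

lemma inner_summable:
  assumes "u \<in> ell2 E" "v \<in> ell2 F"
  shows "(\<lambda>x. u x * cnj (v x)) summable_on UNIV"
proof -
  have "(\<lambda>x. (cmod (u x))\<^sup>2 + (cmod (v x))\<^sup>2) summable_on UNIV"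
    by (intro summable_on_add ell2_summable[OF assms(1)] ell2_summable[OF assms(2)])
  then have "(\<lambda>x. norm (u x * cnj (v x))) summable_on UNIV"
  proof (rule Infinite_Sum.abs_summable_on_comparison_test')
    show "norm (u x * cnj (v x)) \<le> (cmod (u x))\<^sup>2 + (cmod (v x))\<^sup>2" for x
    proof -
      have "2 * (cmod (u x) * cmod (v x)) \<le> (cmod (u x))\<^sup>2 + (cmod (v x))\<^sup>2"
        using sum_squares_bound[of "cmod (u x)" "cmod (v x)"] by (simp add: mult.assoc)
      moreover have "0 \<le> cmod (u x) * cmod (v x)" by simp
      ultimately have "cmod (u x) * cmod (v x) \<le> (cmod (u x))\<^sup>2 + (cmod (v x))\<^sup>2" by linarith
      then show ?thesis by (simp add: norm_mult)
    qed
  qed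
  then show ?thesis by (rule abs_summable_summable)
qed

lemma inner_add_left: "u \<in> ell2 E \<Longrightarrow> v \<in> ell2 E \<Longrightarrow> w \<in> ell2 F \<Longrightarrow>
    ell2_inner (\<lambda>x. u x + v x) w = ell2_inner u w + ell2_inner v w"
  unfolding ell2_inner_def by (simp add: distrib_right infsum_add inner_summable)

lemma inner_scale_left: "ell2_inner (\<lambda>x. c * u x) w = c * ell2_inner u w"
  unfolding ell2_inner_def by (simp add: mult.assoc infsum_cmult_right')

lemma inner_commute: "ell2_inner v u = cnj (ell2_inner u v)"
  unfolding ell2_inner_def infsum_cnj[symmetric] by (simp add: mult.commute)

lemma inner_add_right: "u \<in> ell2 E \<Longrightarrow> v \<in> ell2 E \<Longrightarrow> w \<in> ell2 F \<Longrightarrow>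
    ell2_inner w (\<lambda>x. u x + v x) = ell2_inner w u + ell2_inner w v"
  by (subst (1 2 3) inner_commute) (simp add: inner_add_left)

lemma inner_scale_right: "ell2_inner w (\<lambda>x. c * u x) = cnj c * ell2_inner w u"
  by (subst (1 2) inner_commute) (simp add: inner_scale_left)

lemma inner_diff_left: "u \<in> ell2 E \<Longrightarrow> v \<in> ell2 E \<Longrightarrow> w \<in> ell2 F \<Longrightarrow>
    ell2_inner (\<lambda>x. u x - v x) w = ell2_inner u w - ell2_inner v w"
  using inner_add_left[OF _ ell2_scale(1), of u E v w F "-1"] inner_scale_left[of "-1" v w] by simp

lemma inner_diff_right: "u \<in> ell2 E \<Longrightarrow> v \<in> ell2 E \<Longrightarrow> w \<in> ell2 F \<Longrightarrow>
    ell2_inner w (\<lambda>x. u x - v x) = ell2_inner w u - ell2_inner w v"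
  by (subst (1 2 3) inner_commute) (simp add: inner_diff_left)

lemma inner_self:
  assumes u: "u \<in> ell2 E"
  shows "ell2_inner u u = of_real (sqnorm u)"
proof -
  have "ell2_inner u u = (\<Sum>\<^sub>\<infinity>x. complex_of_real ((cmod (u x))\<^sup>2))"
    unfolding ell2_inner_def by (simp only: complex_norm_square)
  also have "\<dots> = of_real (sqnorm u)"
    using has_sum_infsum[OF ell2_summable[OF u]] by (intro infsumI) (subst has_sum_of_real_iff)
  finally show ?thesis .
qed

lemma inner_zero: "ell2_inner (\<lambda>_. 0) u = 0" "ell2_inner u (\<lambda>_. 0) = 0"
  by (simp_all add: ell2_inner_def)

lemma inner_delta_right: "ell2_inner u (delta y) = u y"
proof -
  have "ell2_inner u (delta y) = (\<Sum>\<^sub>\<infinity>x\<in>{y}. u x)"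
    unfolding ell2_inner_def by (rule infsum_cong_neutral) auto
  then show ?thesis by simp
qed

lemma sqnorm_add:
  assumes "u \<in> ell2 E" "v \<in> ell2 E"
  shows "sqnorm (\<lambda>x. u x + v x) = sqnorm u + sqnorm v + 2 * Re (ell2_inner u v)"
proof -
  note uv = ell2_add(1)[OF assms]
  have "ell2_inner (\<lambda>x. u x + v x) (\<lambda>x. u x + v x) =
     ell2_inner u u + ell2_inner v v + (ell2_inner u v + cnj (ell2_inner u v))"
    unfolding inner_add_left[OF assms uv] inner_add_right[OF assms assms(1)] inner_add_right[OF assms
        assms(2)]
    by (simp add: inner_commute[of v u])
  then have "complex_of_real (sqnorm (\<lambda>x. u x + v x)) = of_real (sqnorm u + sqnorm v + 2 * Re
      (ell2_inner u v))"
    unfolding inner_self[OF assms(1)] inner_self[OF assms(2)] inner_self[OF uv]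
        by (simp add: complex_add_cnj)
  then show ?thesis by (simp only: of_real_eq_iff)
qed

lemma sqnorm_zero:
  assumes "u \<in> ell2 E" "sqnorm u = 0" shows "u = (\<lambda>_. 0)"
proof
  fix x show "u x = 0" using sqnorm_ge_point[OF assms(1), of x] assms(2) by simp
qed

text \<open>Pythagoras, after removing from \<open>u\<close> its component along \<open>w\<close>.
  Nonnegativity of the result yields Cauchy-Schwarz; the decrease shows that the residual of a
  nearest point is orthogonal to the subspace.\<close>

lemma sqnorm_reduce:
  assumes "u \<in> ell2 E" "w \<in> ell2 E" "sqnorm w \<noteq> 0"
  shows "sqnorm (\<lambda>x. u x + - (ell2_inner u w / of_real (sqnorm w)) * w x)
      = sqnorm u - (cmod (ell2_inner u w))\<^sup>2 / sqnorm w"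
proof -
  let ?c = "- (ell2_inner u w / of_real (sqnorm w))"
  have "sqnorm (\<lambda>x. u x + ?c * w x) = sqnorm u + (cmod ?c)\<^sup>2 * sqnorm w + 2 * Re (cnj ?c * ell2_inner u w)"
    by (simp only: sqnorm_add[OF assms(1) ell2_scale(1)[OF assms(2)]] ell2_scale(2)[OF assms(2)]
        inner_scale_right)
  also have "(cmod ?c)\<^sup>2 * sqnorm w = (cmod (ell2_inner u w))\<^sup>2 / sqnorm w"
    using assms(3) by (simp add: norm_divide power_divide power2_eq_square)
  also have "cnj ?c * ell2_inner u w = - of_real ((cmod (ell2_inner u w))\<^sup>2 / sqnorm w)"
    by (simp add: complex_norm_square mult.commute del: of_real_power)
  finally show ?thesis by simp
qed

lemma Cauchy_Schwarz_ell2: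
  assumes "u \<in> ell2 E" "w \<in> ell2 E"
  shows "(cmod (ell2_inner u w))\<^sup>2 \<le> sqnorm u * sqnorm w"
proof (cases "sqnorm w = 0")
  case True
  then have "w = (\<lambda>_. 0)" using sqnorm_zero[OF assms(2)] by simp
  then show ?thesis by (simp add: inner_zero)
next
  case False
  then have pos: "sqnorm w > 0" using sqnorm_nonneg[of w] by simp
  have "0 \<le> sqnorm u - (cmod (ell2_inner u w))\<^sup>2 / sqnorm w"
    unfolding sqnorm_reduce[OF assms False, symmetric] by (rule sqnorm_nonneg)
  then show ?thesis using pos by (simp add: field_simps)
qed

lemma ell2_norm_tendsto_iff:
  "((\<lambda>n. ell2_norm (f n)) \<longlonglongrightarrow> 0) \<longleftrightarrow> ((\<lambda>n. sqnorm (f n)) \<longlonglongrightarrow> 0)"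
proof
  assume "(\<lambda>n. ell2_norm (f n)) \<longlonglongrightarrow> 0"
  from tendsto_power[OF this, of 2] show "(\<lambda>n. sqnorm (f n)) \<longlonglongrightarrow> 0"
    by (simp add: ell2_norm_sq)
next
  assume "(\<lambda>n. sqnorm (f n)) \<longlonglongrightarrow> 0"
  from tendsto_real_sqrt[OF this] show "(\<lambda>n. ell2_norm (f n)) \<longlonglongrightarrow> 0"
    by (simp add: ell2_norm_def)
qed

text \<open>The coordinates are Cauchy, which provides a pointwise limit. On each finite set the
  distance estimate passes to this limit, and \<open>ell2_boundI\<close> extends it to the full
  norm.\<close>

lemma ell2_complete:
  fixes s :: "nat \<Rightarrow> 'e \<Rightarrow> complex"
  assumes s: "\<And>n. s n \<in> ell2 E"
    and cauchy: "\<And>e. e > 0 \<Longrightarrow> \<exists>M. \<forall>m\<ge>M. \<forall>n\<ge>M. sqdist (s m) (s n) < e"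
  shows "\<exists>v \<in> ell2 E. (\<forall>x. (\<lambda>n. s n x) \<longlonglongrightarrow> v x) \<and> (\<lambda>n. sqdist (s n) v) \<longlonglongrightarrow> 0"
proof -
  have "Cauchy (\<lambda>n. s n x)" for x
  proof (rule CauchyI)
    fix e :: real assume "0 < e"
    then obtain M where M: "\<And>m n. m \<ge> M \<Longrightarrow> n \<ge> M \<Longrightarrow> sqdist (s m) (s n) < e\<^sup>2"
      using cauchy[of "e\<^sup>2"] by auto
    have "cmod (s m x - s n x) < e" if "m \<ge> M" "n \<ge> M" for m n
    proof -
      have "(cmod (s m x - s n x))\<^sup>2 < e\<^sup>2"
        using sqnorm_ge_point[OF ell2_diff[OF s[of m] s[of n]], of x] M[OF that] by linarith
      then show ?thesis using \<open>0 < e\<close> by (simp add: power_less_imp_less_base)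
    qed
    then show "\<exists>M. \<forall>m\<ge>M. \<forall>n\<ge>M. cmod (s m x - s n x) < e" by blast
  qed
  then have "\<exists>l. (\<lambda>n. s n x) \<longlonglongrightarrow> l" for x
    by (simp add: Cauchy_convergent_iff convergent_def)
  then obtain v where v: "\<And>x. (\<lambda>n. s n x) \<longlonglongrightarrow> v x" by metis
  have out: "v x = 0" if "x \<notin> E" for x
    using v[of x] that ell2_outside[OF s] by (simp add: LIMSEQ_const_iff)
  have bound: "\<exists>M. \<forall>m\<ge>M. (\<lambda>x. s m x - v x) \<in> ell2 E \<and> sqdist (s m) v \<le> e" if e0: "e > 0" for e
  proof -
    obtain M where M: "\<And>m n. m \<ge> M \<Longrightarrow> n \<ge> M \<Longrightarrow> sqdist (s m) (s n) < e"
      using cauchy[OF e0] by auto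
    have "(\<lambda>x. s m x - v x) \<in> ell2 E \<and> sqdist (s m) v \<le> e" if m: "m \<ge> M" for m
    proof -
      have "(\<Sum>x\<in>F. (cmod (s m x - v x))\<^sup>2) \<le> e" if F: "finite F" for F
      proof (rule LIMSEQ_le_const2)
        show "(\<lambda>n. \<Sum>x\<in>F. (cmod (s m x - s n x))\<^sup>2) \<longlonglongrightarrow> (\<Sum>x\<in>F. (cmod (s m x - v x))\<^sup>2)"
          by (intro tendsto_intros v)
        show "\<exists>N. \<forall>n\<ge>N. (\<Sum>x\<in>F. (cmod (s m x - s n x))\<^sup>2) \<le> e"
          using sqnorm_ge_finite[OF ell2_diff[OF s s] F] M[OF m] by (meson less_imp_le order_trans)
      qed
      from ell2_boundI[OF this, of E] show ?thesis
        using out ell2_outside[OF s] by auto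
    qed
    then show ?thesis by blast
  qed
  obtain M where "(\<lambda>x. s M x - v x) \<in> ell2 E" using bound[of 1] by auto
  from ell2_diff[OF s[of M] this] have "v \<in> ell2 E" by simp
  moreover have "(\<lambda>n. sqdist (s n) v) \<longlonglongrightarrow> 0"
  proof (rule LIMSEQ_I)
    fix r :: real assume "0 < r"
    then obtain M where M: "\<forall>m\<ge>M. sqdist (s m) v \<le> r / 2" using bound[of "r/2"] by auto
    have "norm (sqdist (s m) v - 0) < r" if "m \<ge> M" for m
    proof -
      have "sqdist (s m) v \<le> r / 2" using M that by blast
      then show ?thesis using \<open>0 < r\<close> sqnorm_nonneg[of "\<lambda>x. s m x - v x"] by simp
    qed
    then show "\<exists>M. \<forall>n\<ge>M. norm (sqdist (s n) v - 0) < r" by blast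
  qed
  ultimately show ?thesis using v by blast
qed

lemma convergent_Cauchy:
  fixes s :: "nat \<Rightarrow> 'e \<Rightarrow> complex"
  assumes s: "\<And>n. s n \<in> ell2 E" "v \<in> ell2 E" and lim: "(\<lambda>n. sqdist (s n) v) \<longlonglongrightarrow> 0"
    and "e > 0"
  shows "\<exists>M. \<forall>m\<ge>M. \<forall>n\<ge>M. sqdist (s m) (s n) < e"
proof -
  obtain M where M': "\<And>n. n \<ge> M \<Longrightarrow> norm (sqdist (s n) v - 0) < e / 4"
    using LIMSEQ_D[OF lim, of "e/4"] \<open>e > 0\<close> by (metis divide_pos_pos zero_less_numeral)
  have M: "sqdist (s n) v < e / 4" if "n \<ge> M" for n
    using M'[OF that] by (simp add: abs_of_nonneg[OF sqnorm_nonneg])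
  have "sqdist (s m) (s n) < e" if "m \<ge> M" "n \<ge> M" for m n
    using sqnorm_diff_triangle[OF s(1)[of m] s(2) s(1)[of n]] M[OF that(1)] M[OF that(2)]
    by (simp add: sqnorm_diff_commute[of v "s n"])
  then show ?thesis by blast
qed

lemma limit_pointwise:
  fixes s :: "nat \<Rightarrow> 'e \<Rightarrow> complex"
  assumes s: "\<And>n. s n \<in> ell2 E" "v \<in> ell2 E" and lim: "(\<lambda>n. sqdist (s n) v) \<longlonglongrightarrow> 0"
  shows "(\<lambda>n. s n x) \<longlonglongrightarrow> v x"
proof -
  have "(\<lambda>n. (cmod (s n x - v x))\<^sup>2) \<longlonglongrightarrow> 0"
    by (rule tendsto_sandwich[OF _ _ tendsto_const lim])
       (use sqnorm_ge_point[OF ell2_diff[OF s]] in auto)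
  from tendsto_real_sqrt[OF this] have "(\<lambda>n. s n x - v x) \<longlonglongrightarrow> 0"
    by (simp add: tendsto_norm_zero_iff)
  then show ?thesis by (rule LIM_zero_cancel)
qed

section \<open>Closed subspaces and projections\<close>

lemma sqnorm_parallelogram:
  assumes "a \<in> ell2 E" "b \<in> ell2 E"
  shows "sqdist a b = 2 * sqnorm a + 2 * sqnorm b - sqnorm (\<lambda>x. a x + b x)"
proof -
  have "sqnorm (\<lambda>x. a x + (-1) * b x) = sqnorm a + (cmod (-1))\<^sup>2 * sqnorm b + 2 * Re (cnj (-1) *
      ell2_inner a b)"
    by (simp only: sqnorm_add[OF assms(1) ell2_scale(1)[OF assms(2)]] ell2_scale(2)[OF assms(2)]
        inner_scale_right)
  then show ?thesis using sqnorm_add[OF assms] by simp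
qed

locale ell2_subspace =
  fixes E :: "'e set" and H
  assumes closed: "closed_subspace E H"
begin

lemma sub: "H \<subseteq> ell2 E" and zero: "(\<lambda>_. 0) \<in> H"
  and add: "u \<in> H \<Longrightarrow> v \<in> H \<Longrightarrow> (\<lambda>x. u x + v x) \<in> H"
  and scale: "u \<in> H \<Longrightarrow> (\<lambda>x. c * u x) \<in> H"
  using closed by (auto simp: closed_subspace_def)

lemma in_ell2: "u \<in> H \<Longrightarrow> u \<in> ell2 E" using sub by blast

lemma diff: "u \<in> H \<Longrightarrow> v \<in> H \<Longrightarrow> (\<lambda>x. u x - v x) \<in> H"
  using add[OF _ scale, of u v "-1"] by simp

lemma limit:
  assumes "\<And>n::nat. s n \<in> H" "v \<in> ell2 E" "(\<lambda>n. sqdist (s n) v) \<longlonglongrightarrow> 0"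
  shows "v \<in> H"
proof -
  have "v \<in> ell2_closure E H"
    using assms unfolding ell2_closure_def by (auto simp: ell2_norm_tendsto_iff)
  then show ?thesis using closed by (auto simp: closed_subspace_def)
qed

text \<open>A minimizing sequence is Cauchy by the parallelogram law, because midpoints stay in
  \<open>H\<close> and are no closer to \<open>u\<close> than the infimum. The limit attains the
  infimum by passing to the limit in finite partial sums.\<close>

lemma nearest_point:
  assumes u: "u \<in> ell2 E"
  shows "\<exists>v\<in>H. \<forall>w\<in>H. sqdist u v \<le> sqdist u w"
proof -
  define d where "d = (INF w\<in>H. sqdist u w)"
  have bdd: "bdd_below ((\<lambda>w. sqdist u w) ` H)"
    by (rule bdd_belowI[of _ 0]) (auto intro: sqnorm_nonneg)
  have d: "d \<le> sqdist u w" if "w \<in> H" for w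
    unfolding d_def by (rule cINF_lower[OF bdd that])
  have "\<exists>w\<in>H. sqdist u w < d + 1 / real (Suc n)" for n
  proof -
    have "(INF w\<in>H. sqdist u w) < d + 1 / real (Suc n)" by (simp add: d_def)
    then show ?thesis by (subst (asm) cINF_less_iff) (use zero bdd in auto)
  qed
  then obtain s where s: "\<And>n. s n \<in> H" and sd: "\<And>n. sqdist u (s n) < d + 1 / real (Suc n)"
    by metis
  have sE: "s n \<in> ell2 E" for n using s in_ell2 by blast
  have dist: "sqdist (s m) (s n) \<le> 2 / real (Suc m) + 2 / real (Suc n)" for m n
  proof -
    let ?a = "\<lambda>x. u x - s n x" and ?b = "\<lambda>x. u x - s m x"
    have mid: "(\<lambda>x. 1/2 * (s m x + s n x)) \<in> H" by (intro scale add s)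
    \<comment> \<open>The sum of the two residuals is twice the residual of the midpoint, so its
      squared norm is at least 4 d.\<close>
    have "sqnorm (\<lambda>x. ?a x + ?b x) = sqnorm (\<lambda>x. 2 * (u x - 1/2 * (s m x + s n x)))"
      by (rule arg_cong[where f=sqnorm]) (auto simp: algebra_simps)
    also have "\<dots> = (cmod 2)\<^sup>2 * sqnorm (\<lambda>x. u x - 1/2 * (s m x + s n x))"
      by (rule ell2_scale(2)[OF ell2_diff[OF u in_ell2[OF mid]]])
    also have "\<dots> \<ge> 4 * d" using d[OF mid] by simp
    finally have ge: "sqnorm (\<lambda>x. ?a x + ?b x) \<ge> 4 * d" .
    have "sqdist (s m) (s n) = sqnorm (\<lambda>x. ?a x - ?b x)"
      by (rule arg_cong[where f=sqnorm]) auto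
    also have "\<dots> = 2 * sqnorm ?a + 2 * sqnorm ?b - sqnorm (\<lambda>x. ?a x + ?b x)"
      by (rule sqnorm_parallelogram[OF ell2_diff[OF u sE] ell2_diff[OF u sE]])
    also have "\<dots> \<le> 2 * (d + 1 / real (Suc n)) + 2 * (d + 1 / real (Suc m)) - 4 * d"
      by (intro diff_mono add_mono mult_left_mono less_imp_le[OF sd] ge) simp_all
    also have "\<dots> = 2 / real (Suc m) + 2 / real (Suc n)"
      by (simp add: distrib_left)
    finally show ?thesis .
  qed
  have cau: "\<exists>M. \<forall>m\<ge>M. \<forall>n\<ge>M. sqdist (s m) (s n) < e" if e0: "e > 0" for e
  proof -
    have "0 < e / 4" using e0 by simp
    then obtain M where M: "1 / real (Suc M) < e / 4" by (rule nat_approx_posE)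
    have "sqdist (s m) (s n) < e" if "m \<ge> M" "n \<ge> M" for m n
    proof -
      have "1 / real (Suc m) \<le> 1 / real (Suc M)" "1 / real (Suc n) \<le> 1 / real (Suc M)"
        using that by (auto intro!: divide_left_mono)
      then show ?thesis using dist[of m n] M by linarith
    qed
    then show ?thesis by blast
  qed
  obtain v where v: "v \<in> ell2 E" "\<And>x. (\<lambda>n. s n x) \<longlonglongrightarrow> v x" "(\<lambda>n. sqdist (s n) v) \<longlonglongrightarrow> 0"
    using ell2_complete[OF sE cau] by blast
  have "v \<in> H" by (rule limit[OF s v(1,3)])
  moreover have "sqdist u v \<le> d"
  proof (rule ell2_boundI(2)[of _ _ E])
    fix F :: "'e set" assume F: "finite F"
    show "(\<Sum>x\<in>F. (cmod (u x - v x))\<^sup>2) \<le> d"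
    proof (rule LIMSEQ_le)
      show "(\<lambda>n. \<Sum>x\<in>F. (cmod (u x - s n x))\<^sup>2) \<longlonglongrightarrow> (\<Sum>x\<in>F. (cmod (u x - v x))\<^sup>2)"
        by (intro tendsto_intros v(2))
      show "(\<lambda>n. d + 1 / real (Suc n)) \<longlonglongrightarrow> d"
        using tendsto_add[OF tendsto_const[of d] LIMSEQ_inverse_real_of_nat]
            by (simp add: inverse_eq_divide)
      show "\<exists>N. \<forall>n\<ge>N. (\<Sum>x\<in>F. (cmod (u x - s n x))\<^sup>2) \<le> d + 1 / real (Suc n)"
        using sqnorm_ge_finite[OF ell2_diff[OF u sE] F] sd by (meson less_imp_le order_trans)
    qed
  qed (use ell2_outside[OF u] ell2_outside[OF v(1)] in simp)
  ultimately show ?thesis using d order_trans by blast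
qed

text \<open>The nearest point works: a residual not orthogonal to some \<open>w\<close> in
  \<open>H\<close> could be shortened by moving along \<open>w\<close>.\<close>

lemma projection_exists:
  assumes u: "u \<in> ell2 E"
  shows "\<exists>v\<in>H. \<forall>w\<in>H. ell2_inner (\<lambda>x. u x - v x) w = 0"
proof -
  obtain v where v: "v \<in> H" and min: "\<And>w. w \<in> H \<Longrightarrow> sqdist u v \<le> sqdist u w"
    using nearest_point[OF u] by blast
  have uv: "(\<lambda>x. u x - v x) \<in> ell2 E" using ell2_diff[OF u in_ell2[OF v]] .
  have "ell2_inner (\<lambda>x. u x - v x) w = 0" if w: "w \<in> H" for w
  proof (cases "sqnorm w = 0")
    case True
    then show ?thesis using sqnorm_zero[OF in_ell2[OF w]] by (simp add: inner_zero)
  next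
    case False
    let ?i = "ell2_inner (\<lambda>x. u x - v x) w"
    let ?c = "?i / of_real (sqnorm w)"
    have "sqdist u v \<le> sqnorm (\<lambda>x. u x - (v x + ?c * w x))"
      by (rule min[OF add[OF v scale[OF w]]])
    also have "\<dots> = sqnorm (\<lambda>x. (u x - v x) + - ?c * w x)"
      by (rule arg_cong[where f=sqnorm]) (simp add: fun_eq_iff)
    also have "\<dots> = sqdist u v - (cmod ?i)\<^sup>2 / sqnorm w"
      by (rule sqnorm_reduce[OF uv in_ell2[OF w] False])
    finally have "(cmod ?i)\<^sup>2 / sqnorm w \<le> 0" by linarith
    moreover have "sqnorm w > 0" using False sqnorm_nonneg[of w] by linarith
    ultimately have "(cmod ?i)\<^sup>2 \<le> 0" by (simp add: divide_le_0_iff)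
    then show ?thesis by simp
  qed
  then show ?thesis using v by blast
qed

lemma orth_proj_eqI:
  assumes u: "u \<in> ell2 E" and v: "v \<in> H" "\<And>w. w \<in> H \<Longrightarrow> ell2_inner (\<lambda>x. u x - v x) w = 0"
  shows "orth_proj H u = v"
  unfolding orth_proj_def
proof (rule the_equality)
  show "v \<in> H \<and> (\<forall>w\<in>H. ell2_inner (\<lambda>x. u x - v x) w = 0)" using v by blast
  fix v' assume v': "v' \<in> H \<and> (\<forall>w\<in>H. ell2_inner (\<lambda>x. u x - v' x) w = 0)"
  let ?d = "\<lambda>x. v' x - v x"
  have d: "?d \<in> H" using diff v' v by blast
  have uv: "(\<lambda>x. u x - v x) \<in> ell2 E" "(\<lambda>x. u x - v' x) \<in> ell2 E"
    using ell2_diff[OF u] in_ell2 v v' by blast+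
  have "ell2_inner (\<lambda>x. (u x - v x) - (u x - v' x)) ?d = 0"
    unfolding inner_diff_left[OF uv in_ell2[OF d]] using v(2)[OF d] v' d by simp
  then have "ell2_inner ?d ?d = 0" by simp
  then have "sqnorm ?d = 0" unfolding inner_self[OF in_ell2[OF d]] by (simp only: of_real_eq_0_iff)
  from sqnorm_zero[OF in_ell2[OF d] this] show "v' = v" by (auto simp: fun_eq_iff)
qed

lemma
  assumes u: "u \<in> ell2 E"
  shows orth_proj_in: "orth_proj H u \<in> H"
    and orth_proj_orth: "w \<in> H \<Longrightarrow> ell2_inner (\<lambda>x. u x - orth_proj H u x) w = 0"
proof -
  obtain v where v: "v \<in> H" "\<And>w. w \<in> H \<Longrightarrow> ell2_inner (\<lambda>x. u x - v x) w = 0"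
    using projection_exists[OF u] by blast
  have "orth_proj H u = v" by (rule orth_proj_eqI[OF u v])
  then show "orth_proj H u \<in> H" "w \<in> H \<Longrightarrow> ell2_inner (\<lambda>x. u x - orth_proj H u x) w = 0"
    using v by simp_all
qed

lemma inner_orth_proj:
  assumes u: "u \<in> ell2 E" and w: "w \<in> H"
  shows "ell2_inner (orth_proj H u) w = ell2_inner u w"
  using orth_proj_orth[OF u w]
  unfolding inner_diff_left[OF u in_ell2[OF orth_proj_in[OF u]] in_ell2[OF w]] by simp

text \<open>The projection is self-adjoint and idempotent. Diagonal entries become squared norms, in
  which form traces are compared.\<close>

lemma proj_matrix_diag:
  assumes x: "x \<in> E"
  shows "proj_matrix H x x = of_real (sqnorm (orth_proj H (delta x)))"
proof -
  let ?d = "delta x" and ?p = "orth_proj H (delta x)"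
  have p: "?p \<in> H" by (rule orth_proj_in[OF delta_ell2[OF x]])
  have "of_real (sqnorm ?p) = ell2_inner ?p ?p" by (rule inner_self[OF in_ell2[OF p], symmetric])
  also have "\<dots> = ell2_inner ?d ?p" by (rule inner_orth_proj[OF delta_ell2[OF x] p])
  also have "\<dots> = cnj (?p x)" by (simp only: inner_commute[of ?d] inner_delta_right)
  finally have "?p x = cnj (of_real (sqnorm ?p))" by (metis complex_cnj_cnj)
  then show ?thesis by (simp add: proj_matrix_def)
qed

end

lemma closed_subspace_closure:
  assumes sub: "A \<subseteq> ell2 E" and zero: "(\<lambda>_. 0) \<in> A"
    and add: "\<And>u v. u \<in> A \<Longrightarrow> v \<in> A \<Longrightarrow> (\<lambda>x. u x + v x) \<in> A"
    and scale: "\<And>c u. u \<in> A \<Longrightarrow> (\<lambda>x. c * u x) \<in> A"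
  shows "closed_subspace E (ell2_closure E A)" "A \<subseteq> ell2_closure E A"
proof -
  have cl: "v \<in> ell2_closure E B \<longleftrightarrow> v \<in> ell2 E \<and> (\<exists>s. (\<forall>n::nat. s n \<in> B) \<and> (\<lambda>n. sqdist (s n) v) \<longlonglongrightarrow> 0)" for v B
    by (simp add: ell2_closure_def ell2_norm_tendsto_iff)
  show inc: "A \<subseteq> ell2_closure E A"
  proof
    fix u assume "u \<in> A"
    then show "u \<in> ell2_closure E A" unfolding cl using sub by (auto intro!: exI[of _ "\<lambda>_. u"])
  qed
  show "closed_subspace E (ell2_closure E A)"
    unfolding closed_subspace_def
  proof (intro conjI ballI allI)
    show "ell2_closure E A \<subseteq> ell2 E" by (auto simp: ell2_closure_def)
    show "(\<lambda>_. 0) \<in> ell2_closure E A" using inc zero by blast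
    fix u assume "u \<in> ell2_closure E A"
    then obtain s where u: "u \<in> ell2 E" and s: "\<And>n::nat. s n \<in> A" "(\<lambda>n. sqdist (s n) u) \<longlonglongrightarrow> 0"
      unfolding cl by blast
    have su: "(\<lambda>x. s n x - u x) \<in> ell2 E" for n using ell2_diff[OF _ u] s(1) sub by blast
    { fix c
      have "(\<lambda>n. (cmod c)\<^sup>2 * sqdist (s n) u) \<longlonglongrightarrow> 0"
        using tendsto_mult_right_zero[OF s(2)] by simp
      then have "(\<lambda>n. sqnorm (\<lambda>x. c * s n x - c * u x)) \<longlonglongrightarrow> 0"
        unfolding ell2_scale(2)[OF su, symmetric] by (simp only: right_diff_distrib)
      then show "(\<lambda>x. c * u x) \<in> ell2_closure E A"
        unfolding cl using ell2_scale(1)[OF u] scale[OF s(1)]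
        by (intro conjI exI[of _ "\<lambda>n x. c * s n x"]) simp_all }
    { fix v assume "v \<in> ell2_closure E A"
      then obtain t where v: "v \<in> ell2 E" and t: "\<And>n::nat. t n \<in> A" "(\<lambda>n. sqdist (t n) v) \<longlonglongrightarrow> 0"
        unfolding cl by blast
      have tv: "(\<lambda>x. t n x - v x) \<in> ell2 E" for n using ell2_diff[OF _ v] t(1) sub by blast
      have b: "(\<lambda>n. 2 * sqdist (s n) u + 2 * sqdist (t n) v) \<longlonglongrightarrow> 0"
        using tendsto_add[OF tendsto_mult_right_zero[OF s(2)] tendsto_mult_right_zero[OF t(2)]] by simp
      have "(\<lambda>n. sqnorm (\<lambda>x. (s n x - u x) + (t n x - v x))) \<longlonglongrightarrow> 0"
        by (rule tendsto_sandwich[OF _ _ tendsto_const b])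
           (use ell2_add(2)[OF su tv] sqnorm_nonneg in \<open>auto intro!: always_eventually\<close>)
      then have "(\<lambda>n. sqnorm (\<lambda>x. (s n x + t n x) - (u x + v x))) \<longlonglongrightarrow> 0"
        by (simp add: algebra_simps)
      then show "(\<lambda>x. u x + v x) \<in> ell2_closure E A"
        unfolding cl using ell2_add(1)[OF u v] add[OF s(1) t(1)]
        by (intro conjI exI[of _ "\<lambda>n x. s n x + t n x"]) simp_all }
  next
    show "ell2_closure E (ell2_closure E A) \<subseteq> ell2_closure E A"
    proof
      fix v assume "v \<in> ell2_closure E (ell2_closure E A)"
      then obtain s where v: "v \<in> ell2 E" and s: "\<And>n::nat. s n \<in> ell2_closure E A" "(\<lambda>n. sqdist (s n) v)
          \<longlonglongrightarrow> 0"
        unfolding cl by blast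
      \<comment> \<open>Diagonal choice: each member of the sequence in the closure is replaced by
        an element of \<open>A\<close> at a squared distance that tends to zero.\<close>
      have "\<exists>a\<in>A. sqdist a (s n) < 1 / real (Suc n)" for n
      proof -
        obtain t where t: "\<And>m::nat. t m \<in> A" "(\<lambda>m. sqdist (t m) (s n)) \<longlonglongrightarrow> 0"
          using s(1)[of n] unfolding cl by blast
        have "\<forall>\<^sub>F m in sequentially. sqdist (t m) (s n) < 1 / real (Suc n)"
          using order_tendstoD(2)[OF t(2), of "1 / real (Suc n)"] by simp
        then obtain m where "sqdist (t m) (s n) < 1 / real (Suc n)"
          unfolding eventually_sequentially by blast
        then show ?thesis using t(1) by blast
      qed
      then obtain a where a: "\<And>n. a n \<in> A" "\<And>n. sqdist (a n) (s n) < 1 / real (Suc n)" by metis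
      have aE: "a n \<in> ell2 E" and sE: "s n \<in> ell2 E" for n using a(1) sub s(1) cl by blast+
      have b: "(\<lambda>n. 2 * (1 / real (Suc n)) + 2 * sqdist (s n) v) \<longlonglongrightarrow> 0"
        using tendsto_add[OF tendsto_mult_right_zero[OF LIMSEQ_inverse_real_of_nat]
            tendsto_mult_right_zero[OF s(2)]]
        by (simp add: inverse_eq_divide)
      have le: "sqdist (a n) v \<le> 2 * (1 / real (Suc n)) + 2 * sqdist (s n) v" for n
        using sqnorm_diff_triangle[OF aE[of n] sE[of n] v] a(2)[of n] by linarith
      have "(\<lambda>n. sqdist (a n) v) \<longlonglongrightarrow> 0"
        by (rule tendsto_sandwich[OF _ _ tendsto_const b])
           (use le sqnorm_nonneg in \<open>auto intro!: always_eventually\<close>)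
      then show "v \<in> ell2_closure E A" unfolding cl using v a(1) by blast
    qed
  qed
qed

lemma inner_zero_limit:
  assumes s: "\<And>n::nat. s n \<in> ell2 E" and v: "v \<in> ell2 E" and w: "w \<in> ell2 E"
    and lim: "(\<lambda>n. sqdist (s n) v) \<longlonglongrightarrow> 0" and z: "\<And>n. ell2_inner (s n) w = 0"
  shows "ell2_inner v w = 0"
proof -
  have "(cmod (ell2_inner v w))\<^sup>2 \<le> sqdist (s n) v * sqnorm w" for n
  proof -
    have "ell2_inner (\<lambda>x. s n x - v x) w = - ell2_inner v w"
      by (simp add: inner_diff_left[OF s v w] z)
    then show ?thesis using Cauchy_Schwarz_ell2[OF ell2_diff[OF s v] w, of n] by simp
  qed
  moreover have "(\<lambda>n. sqdist (s n) v * sqnorm w) \<longlonglongrightarrow> 0"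
    using tendsto_mult_left_zero[OF lim] .
  ultimately have "(cmod (ell2_inner v w))\<^sup>2 \<le> 0"
    using LIMSEQ_le_const by blast
  then show ?thesis by simp
qed

lemma closed_subspace_orth_complement:
  assumes A: "A \<subseteq> ell2 E"
  shows "closed_subspace E (orth_complement E A)"
  unfolding closed_subspace_def
proof (intro conjI ballI allI)
  fix u assume u: "u \<in> orth_complement E A"
  show "(\<lambda>x. c * u x) \<in> orth_complement E A" for c
    using u by (auto simp: orth_complement_def ell2_scale inner_scale_left)
  show "(\<lambda>x. u x + v x) \<in> orth_complement E A" if v: "v \<in> orth_complement E A" for v
    unfolding orth_complement_def
  proof (intro CollectI conjI ballI)
    show "(\<lambda>x. u x + v x) \<in> ell2 E" using u v by (simp add: orth_complement_def ell2_add)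
    fix w assume "w \<in> A"
    then have w: "w \<in> ell2 E" "ell2_inner u w = 0" "ell2_inner v w
        = 0" using A u v by (auto simp: orth_complement_def)
    show "ell2_inner (\<lambda>x. u x + v x) w = 0"
      using inner_add_left[of u E v w E] u v w by (simp add: orth_complement_def)
  qed
next
  show "ell2_closure E (orth_complement E A) \<subseteq> orth_complement E A"
  proof
    fix v assume "v \<in> ell2_closure E (orth_complement E A)"
    then obtain s where v: "v \<in> ell2 E" and s: "\<And>n::nat. s n \<in> orth_complement E A" "(\<lambda>n. sqdist (s n)
        v) \<longlonglongrightarrow> 0"
      by (auto simp: ell2_closure_def ell2_norm_tendsto_iff)
    have "ell2_inner v w = 0" if "w \<in> A" for w
      by (rule inner_zero_limit[OF _ v _ s(2)]) (use s(1) that A in \<open>auto simp: orth_complement_def\<close>)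
    then show "v \<in> orth_complement E A" using v by (simp add: orth_complement_def)
  qed
qed (auto simp: orth_complement_def ell2_zero inner_zero)

lemma orth_complement_closure:
  assumes A: "A \<subseteq> ell2 E"
  shows "orth_complement E (ell2_closure E A) = orth_complement E A"
proof (intro equalityI subsetI)
  fix v assume v: "v \<in> orth_complement E (ell2_closure E A)"
  have "w \<in> ell2_closure E A" if "w \<in> A" for w
    using A that by (auto simp: ell2_closure_def ell2_norm_def intro!: exI[of _ "\<lambda>_. w"])
  then show "v \<in> orth_complement E A" using v by (auto simp: orth_complement_def)
next
  fix v assume v: "v \<in> orth_complement E A"
  have "ell2_inner v w = 0" if w: "w \<in> ell2_closure E A" for w
  proof -
    obtain s where wE: "w \<in> ell2 E" and s: "\<And>n::nat. s n \<in> A" "(\<lambda>n. sqdist (s n) w) \<longlonglongrightarrow> 0"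
      using w by (auto simp: ell2_closure_def ell2_norm_tendsto_iff)
    have "ell2_inner (s n) v = 0" for n
      using v s(1) by (subst inner_commute) (simp add: orth_complement_def)
    then have "ell2_inner w v = 0"
      by (intro inner_zero_limit[OF _ wE _ s(2)]) (use s(1) A v in \<open>auto simp: orth_complement_def\<close>)
    then show ?thesis by (subst inner_commute) simp
  qed
  then show "v \<in> orth_complement E (ell2_closure E A)" using v by (simp add: orth_complement_def)
qed

lemma closed_subspace_Int:
  assumes "closed_subspace E A" "closed_subspace E B"
  shows "closed_subspace E (A \<inter> B)"
proof -
  have "ell2_closure E (A \<inter> B) \<subseteq> ell2_closure E A \<inter> ell2_closure E B"
    unfolding ell2_closure_def by blast
  then show ?thesis using assms unfolding closed_subspace_def by blast
qed

text \<open>Every \<open>w\<close> in \<open>F\<close> is its projection to \<open>W\<close> plus a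
  remainder in \<open>F\<close> orthogonal to \<open>W\<close>. The residual of the sum of the two
  smaller projections is orthogonal to both pieces, so that sum is the projection onto
  \<open>F\<close>.\<close>

lemma proj_matrix_split:
  assumes F: "closed_subspace E F" and W: "closed_subspace E W" and sub: "W \<subseteq> F" and x: "x \<in> E"
  shows "proj_matrix F x x = proj_matrix W x x + proj_matrix (F \<inter> orth_complement E W) x x"
proof -
  let ?H = "F \<inter> orth_complement E W"
  interpret F: ell2_subspace E F by unfold_locales fact
  interpret W: ell2_subspace E W by unfold_locales fact
  interpret H: ell2_subspace E ?H
    by unfold_locales (intro closed_subspace_Int F closed_subspace_orth_complement W.sub)
  let ?u = "delta x"
  have u: "?u \<in> ell2 E" by (rule delta_ell2[OF x])
  define p where "p = orth_proj W ?u"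
  define q where "q = orth_proj ?H ?u"
  have p: "p \<in> W" "p \<in> ell2 E" and q: "q \<in> ?H" "q \<in> ell2 E"
    unfolding p_def q_def using W.orth_proj_in[OF u] H.orth_proj_in[OF u] W.in_ell2 H.in_ell2 by blast+
  have "orth_proj F ?u = (\<lambda>x. p x + q x)"
  proof (rule F.orth_proj_eqI[OF u])
    show pq: "(\<lambda>x. p x + q x) \<in> F" using p q sub by (intro F.add) auto
    let ?r = "\<lambda>x. ?u x - (p x + q x)"
    have r: "?r \<in> ell2 E" by (intro ell2_diff u ell2_add p q)
    fix w assume w: "w \<in> F"
    then have wE: "w \<in> ell2 E" by (rule F.in_ell2)
    let ?a = "orth_proj W w"
    let ?b = "\<lambda>x. w x - ?a x"
    have a: "?a \<in> W" by (rule W.orth_proj_in[OF wE])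
    have b: "?b \<in> ?H"
      using F.diff[OF w, of ?a] a sub W.orth_proj_orth[OF wE] ell2_diff[OF wE W.in_ell2[OF a]]
      by (auto simp: orth_complement_def)
    have aE: "?a \<in> ell2 E" and bE: "?b \<in> ell2 E" using a b W.in_ell2 H.in_ell2 by blast+
    have up: "(\<lambda>x. ?u x - p x) \<in> ell2 E" and uq: "(\<lambda>x. ?u x - q x) \<in> ell2 E"
      by (intro ell2_diff u p q)+
    have i1: "ell2_inner (\<lambda>x. (?u x - p x) - q x) ?a = 0"
      unfolding inner_diff_left[OF up q(2) aE]
      using W.orth_proj_orth[OF u a] q(1) a by (simp add: p_def orth_complement_def)
    have i2: "ell2_inner (\<lambda>x. (?u x - q x) - p x) ?b = 0"
    proof -
      have "ell2_inner p ?b = cnj (ell2_inner ?b p)" by (rule inner_commute)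
      also have "\<dots> = 0" using b p(1) by (simp add: orth_complement_def)
      finally show ?thesis unfolding inner_diff_left[OF uq p(2) bE]
        using H.orth_proj_orth[OF u b] by (simp add: q_def)
    qed
    have e1: "(\<lambda>x. (?u x - p x) - q x) = ?r" and e2: "(\<lambda>x. (?u x - q x) - p x) = ?r"
      by (simp_all add: algebra_simps)
    have "ell2_inner ?r ?a + ell2_inner ?r ?b = 0"
      using i1 i2 unfolding e1 e2 by (simp only: add_0_left)
    then have "ell2_inner ?r (\<lambda>x. ?a x + ?b x) = 0"
      by (simp only: inner_add_right[OF aE bE r])
    then show "ell2_inner ?r w = 0" by simp
  qed
  then show ?thesis by (simp add: proj_matrix_def p_def q_def)
qed

section \<open>Von Neumann dimension\<close>

context ell2_subspace begin

text \<open>The projected point mass is the Riesz representer, within \<open>H\<close>, of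
  evaluation at \<open>y\<close>. This description can be carried along isometries.\<close>

lemma orth_proj_representer:
  assumes "y \<in> E" "a \<in> H" "\<And>u. u \<in> H \<Longrightarrow> ell2_inner u a = u y"
  shows "orth_proj H (delta y) = a"
proof (rule orth_proj_eqI[OF delta_ell2[OF assms(1)] assms(2)])
  fix w assume w: "w \<in> H"
  have "ell2_inner (delta y) w = cnj (w y)" "ell2_inner a w = cnj (w y)"
    by (subst inner_commute, simp only: inner_delta_right) (subst inner_commute, simp only: assms(3)[OF w])
  then show "ell2_inner (\<lambda>x. delta y x - a x) w = 0"
    by (simp only: inner_diff_left[OF delta_ell2[OF assms(1)] in_ell2[OF assms(2)] in_ell2[OF w]]) simp
qed

lemma inner_representer:
  assumes "y \<in> E" "u \<in> H"
  shows "ell2_inner u (orth_proj H (delta y)) = u y"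
proof -
  have "ell2_inner u (orth_proj H (delta y)) = cnj (ell2_inner (orth_proj H (delta y)) u)"
      by (rule inner_commute)
  also have "\<dots> = cnj (ell2_inner (delta y) u)" by (simp only: inner_orth_proj[OF delta_ell2[OF assms(1)]
      assms(2)])
  also have "\<dots> = ell2_inner u (delta y)" by (rule inner_commute[symmetric])
  finally show ?thesis by (simp only: inner_delta_right)
qed

end

text \<open>Polarization: c = 1 gives the real part and c = \<i> the imaginary part.\<close>

lemma inner_eq_if_isometric:
  assumes u: "u \<in> ell2 E" "v \<in> ell2 E" and u': "u' \<in> ell2 E'" "v' \<in> ell2 E'"
    and iso: "\<And>c. sqnorm (\<lambda>x. u' x + c * v' x) = sqnorm (\<lambda>x. u x + c * v x)"
    and n: "sqnorm u' = sqnorm u" "sqnorm v' = sqnorm v"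
  shows "ell2_inner u' v' = ell2_inner u v"
proof -
  have "Re (cnj c * ell2_inner u' v') = Re (cnj c * ell2_inner u v)" for c
    using iso[of c] n
    unfolding sqnorm_add[OF u(1) ell2_scale(1)[OF u(2)]] sqnorm_add[OF u'(1) ell2_scale(1)[OF u'(2)]]
      ell2_scale(2)[OF u(2)] ell2_scale(2)[OF u'(2)] inner_scale_right by simp
  from this[of 1] this[of \<i>] show ?thesis by (intro complex_eqI) simp_all
qed

section \<open>Modules, embeddings and independence of the trace\<close>

locale hilbert_module = ell2_subspace E H + group G
  for E :: "'e set" and H and G :: "('g, 'm) monoid_scheme" (structure) +
  fixes L :: "'g \<Rightarrow> ('e \<Rightarrow> complex) \<Rightarrow> 'e \<Rightarrow> complex"
  assumes invariant: "invariant_under G L H"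
begin

lemma L_in: "g \<in> carrier G \<Longrightarrow> u \<in> H \<Longrightarrow> L g u \<in> H"
  using invariant by (auto simp: invariant_under_def)

end

locale embedded_module = hilbert_module E H G L
  for E :: "'e set" and H and G :: "('g, 'm) monoid_scheme" (structure) and L +
  fixes n :: nat and T :: "('e \<Rightarrow> complex) \<Rightarrow> 'g \<times> nat \<Rightarrow> complex"
  assumes embedding: "module_embedding G L H n T"
begin

abbreviation target where "target \<equiv> carrier G \<times> {..<n}"

lemma T_ell2: "u \<in> H \<Longrightarrow> T u \<in> ell2 target"
  and T_add: "u \<in> H \<Longrightarrow> v \<in> H \<Longrightarrow> T (\<lambda>x. u x + v x) = (\<lambda>y. T u y + T v y)"
  and T_scale: "u \<in> H \<Longrightarrow> T (\<lambda>x. c * u x) = (\<lambda>y. c * T u y)"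
  and T_norm: "u \<in> H \<Longrightarrow> ell2_norm (T u) = ell2_norm u"
  and T_equivariant: "g \<in> carrier G \<Longrightarrow> u \<in> H \<Longrightarrow> T (L g u) = left_translation G g (T u)"
  using embedding unfolding module_embedding_def by auto

lemma T_sqnorm: "u \<in> H \<Longrightarrow> sqnorm (T u) = sqnorm u"
  using T_norm[of u] by (metis ell2_norm_sq)

lemma T_diff: "u \<in> H \<Longrightarrow> v \<in> H \<Longrightarrow> T (\<lambda>x. u x - v x) = (\<lambda>y. T u y - T v y)"
  using T_add[OF _ scale, of u v "-1"] T_scale[of v "-1"] by simp

lemma T_inner:
  assumes "u \<in> H" "v \<in> H"
  shows "ell2_inner (T u) (T v) = ell2_inner u v"
proof (rule inner_eq_if_isometric[OF in_ell2[OF assms(1)] in_ell2[OF assms(2)] T_ell2[OF assms(1)]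
    T_ell2[OF assms(2)]])
  show "sqnorm (\<lambda>x. T u x + c * T v x) = sqnorm (\<lambda>x. u x + c * v x)" for c
    using T_sqnorm[OF add[OF assms(1) scale[OF assms(2), of c]]]
    by (simp add: T_add[OF assms(1) scale[OF assms(2)]] T_scale[OF assms(2)])
qed (use assms in \<open>simp_all add: T_sqnorm\<close>)

lemma T_inj:
  assumes "u \<in> H" "v \<in> H" "T u = T v" shows "u = v"
proof -
  have "sqdist u v = 0"
    using T_sqnorm[OF diff[OF assms(1,2)]] unfolding T_diff[OF assms(1,2)] by (simp add: assms(3))
  from sqnorm_zero[OF in_ell2[OF diff[OF assms(1,2)]] this] show ?thesis by (auto simp: fun_eq_iff)
qed

text \<open>A convergent sequence of images comes from a Cauchy sequence in \<open>H\<close> by the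
  isometry; its limit lies in \<open>H\<close> and is mapped to the given limit.\<close>

lemma closed_image: "closed_subspace target (T ` H)"
  unfolding closed_subspace_def
proof (intro conjI ballI allI)
  show "T ` H \<subseteq> ell2 target" using T_ell2 by blast
  show "(\<lambda>_. 0) \<in> T ` H"
  proof (rule image_eqI[OF _ zero])
    show "(\<lambda>_. 0) = T (\<lambda>_. 0)" using T_scale[OF zero, of 0] by simp
  qed
next
  fix u v assume "u \<in> T ` H" "v \<in> T ` H"
  then obtain a b where "a \<in> H" "b \<in> H" "u = T a" "v = T b" by blast
  then show "(\<lambda>x. u x + v x) \<in> T ` H"
    by (intro image_eqI[OF _ add[of a b]]) (simp_all add: T_add)
next
  fix c u assume "u \<in> T ` H"
  then obtain a where "a \<in> H" "u = T a" by blast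
  then show "(\<lambda>x. c * u x) \<in> T ` H"
    by (intro image_eqI[OF _ scale[of a c]]) (simp_all add: T_scale)
next
  show "ell2_closure target (T ` H) \<subseteq> T ` H"
  proof
    fix v assume "v \<in> ell2_closure target (T ` H)"
    then obtain s where v: "v \<in> ell2 target" and s: "\<And>k::nat. s k \<in> T ` H" "(\<lambda>k. sqdist (s k) v) \<longlonglongrightarrow> 0"
      by (auto simp: ell2_closure_def ell2_norm_tendsto_iff)
    have "\<forall>k. \<exists>u. u \<in> H \<and> s k = T u" using s(1) by blast
    then obtain r where r: "\<And>k. r k \<in> H" "\<And>k. s k = T (r k)" using choice[of "\<lambda>k u. u \<in> H \<and> s k
        = T u"] by blast
    have sE: "s k \<in> ell2 target" and rE: "r k \<in> ell2 E" for k using r T_ell2 in_ell2 by simp_all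
    have eq: "sqnorm (\<lambda>x. T (r j) x - T w x) = sqdist (r j) w" if "w \<in> H" for j w
      using T_sqnorm[OF diff[OF r(1) that], of j] by (simp add: T_diff[OF r(1) that])
    have cau: "\<exists>M. \<forall>j\<ge>M. \<forall>k\<ge>M. sqdist (r j) (r k) < e" if "e > 0" for e
      using convergent_Cauchy[OF sE v s(2) that] unfolding r(2) eq[OF r(1)] .
    obtain w where w: "w \<in> ell2 E" "(\<lambda>k. sqdist (r k) w) \<longlonglongrightarrow> 0"
      using ell2_complete[OF rE cau] by blast
    have wH: "w \<in> H" by (rule limit[OF r(1) w])
    have lim: "(\<lambda>k. sqdist (s k) (T w)) \<longlonglongrightarrow> 0"
      using w(2) unfolding r(2) eq[OF wH] .
    have "v x = T w x" for x
      using LIMSEQ_unique[OF limit_pointwise[OF sE v s(2)] limit_pointwise[OF sE T_ell2[OF wH] lim]] .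
    then show "v \<in> T ` H" using wH by (auto simp: image_iff intro!: bexI[of _ w])
  qed
qed

sublocale image: ell2_subspace target "T ` H"
  by unfold_locales (rule closed_image)

text \<open>The vector of \<open>H\<close> that represents the functional taking \<open>u\<close> to
  the coordinate \<open>T u y\<close>, as stated in \<open>inner_rp\<close>. Keeping it in
  \<open>H\<close> rather than in the target allows two embeddings to be compared.\<close>

definition rp :: "'g \<times> nat \<Rightarrow> 'e \<Rightarrow> complex" where
  "rp y = (SOME u. u \<in> H \<and> T u = orth_proj (T ` H) (delta y))"

lemma rp:
  assumes "y \<in> target"
  shows "rp y \<in> H" "T (rp y) = orth_proj (T ` H) (delta y)"
proof -
  have "\<exists>u. u \<in> H \<and> T u = orth_proj (T ` H) (delta y)"
    using image.orth_proj_in[OF delta_ell2[OF assms]] by auto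
  from someI_ex[OF this] show "rp y \<in> H" "T (rp y) = orth_proj (T ` H) (delta y)"
    by (auto simp: rp_def)
qed

lemma inner_rp: "y \<in> target \<Longrightarrow> u \<in> H \<Longrightarrow> ell2_inner u (rp y) = T u y"
  using image.inner_representer[of y "T u"] T_inner[of u "rp y"] rp by simp

lemma T_translate:
  assumes "g \<in> carrier G" "h \<in> carrier G" "u \<in> H"
  shows "T (L g u) (g \<otimes> h, i) = T u (h, i)"
  using assms by (simp add: T_equivariant left_translation_def m_assoc[symmetric])

text \<open>Moving \<open>g\<close> to the other argument as its inverse turns the pairing of
  \<open>u\<close> with the translated representer into the coordinate of \<open>T u\<close> at the
  translated index.\<close>

lemma L_rp:
  assumes "g \<in> carrier G" "u \<in> H" "h \<in> carrier G" "i < n"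
  shows "L g (rp (h, i)) = rp (g \<otimes> h, i)"
proof -
  have r: "rp (h, i) \<in> H" "rp (g \<otimes> h, i) \<in> H" using rp assms by auto
  note l = L_in[OF assms(1) r(1)]
  \<comment> \<open>The group law for \<open>L\<close> on \<open>H\<close> is inherited from left
    translation, because \<open>T\<close> is injective.\<close>
  have LL: "L (inv g) (L g u) = u" if "u \<in> H" for u
  proof (rule T_inj[OF _ that])
    show "L (inv g) (L g u) \<in> H" using assms that L_in by simp
    show "T (L (inv g) (L g u)) = T u"
    proof
      fix y :: "'g \<times> nat"
      obtain x i where y: "y = (x, i)" by (cases y)
      show "T (L (inv g) (L g u)) y = T u y"
      proof (cases "x \<in> carrier G")
        case True
        then have "T (L (inv g) (L g u)) (inv g \<otimes> (g \<otimes> x), i) = T u (x, i)"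
          using assms that L_in by (simp add: T_translate del: r_inv l_inv)
        then show ?thesis using True assms by (simp add: y m_assoc[symmetric])
      next
        case False
        then show ?thesis using ell2_outside[OF T_ell2[OF that], of y] ell2_outside[OF T_ell2,
            of "L (inv g) (L g u)" y]
            assms that L_in by (simp add: y)
      qed
    qed
  qed
  \<comment> \<open>\<open>L\<close> is unitary on \<open>H\<close>, since left translation merely
    permutes the coordinates of the image.\<close>
  have inv: "ell2_inner (L h u) (L h v) = ell2_inner u v" if "h \<in> carrier G" "u \<in> H" "v \<in> H" for h u v
  proof -
    have bij: "bij_betw (\<lambda>(x, i). (inv h \<otimes> x, i)) (carrier G \<times> (UNIV::nat set)) (carrier G \<times> UNIV)"
      by (rule bij_betw_byWitness[where f'="\<lambda>(x, i). (h \<otimes> x, i)"])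
         (use that in \<open>auto simp: m_assoc[symmetric]\<close>)
    have out: "T w y = 0" if "w \<in> H" "y \<notin> carrier G \<times> UNIV" for w y
      using ell2_outside[OF T_ell2[OF that(1)], of y] that(2) by auto
    have "ell2_inner (L h u) (L h v) = ell2_inner (T (L h u)) (T (L h v))"
      using T_inner that L_in by simp
    also have "\<dots> = (\<Sum>\<^sub>\<infinity>y\<in>carrier G \<times> UNIV. T (L h u) y * cnj (T (L h v) y))"
      unfolding ell2_inner_def by (rule infsum_cong_neutral) (use out that L_in in auto)
    also have "\<dots> = (\<Sum>\<^sub>\<infinity>y\<in>carrier G \<times> UNIV. (\<lambda>y. T u y * cnj (T v y)) ((\<lambda>(x, i). (inv h \<otimes> x, i)) y))"
      by (rule infsum_cong) (use that in \<open>auto simp: T_equivariant left_translation_def\<close>)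
    also have "\<dots> = (\<Sum>\<^sub>\<infinity>y\<in>carrier G \<times> UNIV. T u y * cnj (T v y))"
      by (rule infsum_reindex_bij_betw[OF bij])
    also have "\<dots> = ell2_inner (T u) (T v)"
      unfolding ell2_inner_def by (rule infsum_cong_neutral) (use out that in auto)
    finally show ?thesis using T_inner that by simp
  qed
  have "ell2_inner u (L g (rp (h, i))) = ell2_inner u (rp (g \<otimes> h, i))" if u: "u \<in> H" for u
  proof -
    have "ell2_inner u (L g (rp (h, i))) = ell2_inner (L (inv g) u) (L (inv g) (L g (rp (h, i))))"
      using inv[of "inv g" u] assms u l by simp
    also have "\<dots> = ell2_inner (L (inv g) u) (rp (h, i))" by (simp only: LL[OF r(1)])
    also have "\<dots> = T (L (inv g) u) (h, i)"
      using inner_rp[of "(h, i)" "L (inv g) u"] assms u L_in by simp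
    also have "\<dots> = T (L (inv g) u) (inv g \<otimes> (g \<otimes> h), i)"
      using assms by (simp add: m_assoc[symmetric])
    also have "\<dots> = T u (g \<otimes> h, i)"
      by (rule T_translate) (use assms u in auto)
    also have "\<dots> = ell2_inner u (rp (g \<otimes> h, i))"
      using inner_rp[of "(g \<otimes> h, i)" u] assms u by simp
    finally show ?thesis .
  qed
  \<comment> \<open>Two vectors of \<open>H\<close> with the same pairings against all of
    \<open>H\<close> coincide: the test vector is their difference.\<close>
  from this[OF diff[OF l r(2)]]
  have "ell2_inner (\<lambda>x. L g (rp (h, i)) x - rp (g \<otimes> h, i) x) (\<lambda>x. L g (rp (h, i)) x - rp (g \<otimes> h, i) x) = 0"
    by (simp only: inner_diff_right[OF in_ell2[OF l] in_ell2[OF r(2)] in_ell2[OF diff[OF l r(2)]]]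
        diff_self)
  then have "sqnorm (\<lambda>x. L g (rp (h, i)) x - rp (g \<otimes> h, i) x) = 0"
    unfolding inner_self[OF in_ell2[OF diff[OF l r(2)]]] by (simp only: of_real_eq_0_iff)
  from sqnorm_zero[OF in_ell2[OF diff[OF l r(2)]] this] show ?thesis by (auto simp: fun_eq_iff)
qed

lemma proj_matrix_rp: "y \<in> target \<Longrightarrow> proj_matrix (T ` H) y y = of_real (sqnorm (rp y))"
  using image.proj_matrix_diag[of y] rp[of y] T_sqnorm[of "rp y"] by simp

end

lemma sqnorm_product:
  assumes "v \<in> ell2 (C \<times> {..<n::nat})"
  shows "sqnorm v = (\<Sum>j<n. \<Sum>\<^sub>\<infinity>g\<in>C. (cmod (v (g, j)))\<^sup>2)"
proof -
  let ?f = "\<lambda>x. (cmod (v x))\<^sup>2"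
  have bij: "bij_betw prod.swap ({..<n} \<times> C) (C \<times> {..<n})"
    by (rule bij_betw_byWitness[where f'=prod.swap]) auto
  have s: "?f summable_on C \<times> {..<n}"
    using summable_on_subset_banach[OF ell2_summable[OF assms]] by blast
  then have s': "(\<lambda>(j, g). ?f (g, j)) summable_on {..<n} \<times> C"
    using summable_on_reindex_bij_betw[OF bij, of ?f] by (simp add: case_prod_unfold prod.swap_def)
  have "sqnorm v = infsum ?f (C \<times> {..<n})"
    by (rule infsum_cong_neutral) (use ell2_outside[OF assms] in auto)
  also have "\<dots> = (\<Sum>\<^sub>\<infinity>p\<in>{..<n} \<times> C. ?f (prod.swap p))"
    by (rule infsum_reindex_bij_betw[OF bij, symmetric])
  also have "\<dots> = (\<Sum>\<^sub>\<infinity>(j, g)\<in>{..<n} \<times> C. ?f (g, j))"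
    by (simp add: case_prod_unfold prod.swap_def)
  also have "\<dots> = (\<Sum>\<^sub>\<infinity>j\<in>{..<n}. \<Sum>\<^sub>\<infinity>g\<in>C. ?f (g, j))"
    by (rule infsum_Sigma'_banach[OF s', symmetric])
  finally show ?thesis by simp
qed

text \<open>Both traces are the sum of \<open>|\<langle>a\<^sub>x, b\<^sub>y\<rangle>|\<^sup>2\<close> over pairs modulo the diagonal action, where
  \<open>a\<^sub>x\<close> and \<open>b\<^sub>y\<close> represent the coordinates of the two embeddings.\<close>

lemma trace_unique:
  assumes "embedded_module E H G L n T" "embedded_module E H G L m S"
  shows "(\<Sum>i<n. proj_matrix (T ` H) (\<one>\<^bsub>G\<^esub>, i) (\<one>\<^bsub>G\<^esub>, i)) = (\<Sum>i<m. proj_matrix (S ` H) (\<one>\<^bsub>G\<^esub>, i) (\<one>\<^bsub>G\<^esub>, i))"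
proof -
  interpret T: embedded_module E H G L n T by fact
  interpret S: embedded_module E H G L m S by fact
  let ?C = "carrier G"
  let ?one = "\<one>\<^bsub>G\<^esub>" and ?inv = "\<lambda>g. inv\<^bsub>G\<^esub> g"
  \<comment> \<open>The group element passes from the coordinate of \<open>S\<close> to that of
    \<open>T\<close> as its inverse. Translation brings it into the representer for
    \<open>T\<close>, and the inner product of two representers is a coordinate of either embedding
    up to conjugation.\<close>
  have c1: "cmod (S (T.rp (?one, i)) (g, j)) = cmod (T (S.rp (?one, j)) (?inv g, i))"
    if g: "g \<in> ?C" and i: "i < n" and j: "j < m" for g i j
  proof -
    have r: "T.rp (?inv g, i) \<in> H" "S.rp (?one, j) \<in> H"
      by (intro T.rp S.rp, use g i j in simp)+
    have "T.rp (?one, i) = L g (T.rp (?inv g, i))"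
      using T.L_rp[OF g r(1), of "?inv g" i] g i by simp
    then have "S (T.rp (?one, i)) (g, j) = S (L g (T.rp (?inv g, i))) (g \<otimes>\<^bsub>G\<^esub> ?one, j)"
      using g by simp
    also have "\<dots> = S (T.rp (?inv g, i)) (?one, j)"
      by (rule S.T_translate[OF g _ r(1)]) simp
    also have "\<dots> = ell2_inner (T.rp (?inv g, i)) (S.rp (?one, j))"
      by (rule S.inner_rp[symmetric, OF _ r(1)]) (use j in simp)
    also have "\<dots> = cnj (ell2_inner (S.rp (?one, j)) (T.rp (?inv g, i)))" by (rule inner_commute)
    also have "ell2_inner (S.rp (?one, j)) (T.rp (?inv g, i)) = T (S.rp (?one, j)) (?inv g, i)"
      by (rule T.inner_rp[OF _ r(2)]) (use g i in simp)
    finally show ?thesis by simp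
  qed
  have bij: "bij_betw ?inv ?C ?C"
    by (rule bij_betw_byWitness[where f'="?inv"]) auto
  have "(\<Sum>i<n. sqnorm (T.rp (?one, i))) = (\<Sum>i<n. sqnorm (S (T.rp (?one, i))))"
    by (intro sum.cong refl S.T_sqnorm[symmetric] T.rp) simp
  also have "\<dots> = (\<Sum>i<n. \<Sum>j<m. \<Sum>\<^sub>\<infinity>g\<in>?C. (cmod (S (T.rp (?one, i)) (g, j)))\<^sup>2)"
    by (intro sum.cong refl sqnorm_product S.T_ell2 T.rp) simp
  also have "\<dots> = (\<Sum>i<n. \<Sum>j<m. \<Sum>\<^sub>\<infinity>g\<in>?C. (\<lambda>g. (cmod (T (S.rp (?one, j)) (g, i)))\<^sup>2) (?inv g))"
    by (intro sum.cong refl infsum_cong) (simp add: c1)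
  also have "\<dots> = (\<Sum>i<n. \<Sum>j<m. \<Sum>\<^sub>\<infinity>g\<in>?C. (cmod (T (S.rp (?one, j)) (g, i)))\<^sup>2)"
    by (intro sum.cong refl infsum_reindex_bij_betw[OF bij])
  also have "\<dots> = (\<Sum>j<m. \<Sum>i<n. \<Sum>\<^sub>\<infinity>g\<in>?C. (cmod (T (S.rp (?one, j)) (g, i)))\<^sup>2)"
    by (rule sum.swap)
  also have "\<dots> = (\<Sum>j<m. sqnorm (T (S.rp (?one, j))))"
    by (intro sum.cong refl sqnorm_product[symmetric] T.T_ell2 S.rp) simp
  also have "\<dots> = (\<Sum>j<m. sqnorm (S.rp (?one, j)))"
    by (intro sum.cong refl T.T_sqnorm S.rp) simp
  finally have eq: "(\<Sum>i<n. sqnorm (T.rp (?one, i))) = (\<Sum>j<m. sqnorm (S.rp (?one, j)))" .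
  have "(\<Sum>i<n. proj_matrix (T ` H) (?one, i) (?one, i)) = of_real (\<Sum>i<n. sqnorm (T.rp (?one, i)))"
    unfolding of_real_sum by (intro sum.cong refl T.proj_matrix_rp) simp
  also have "\<dots> = (\<Sum>i<m. proj_matrix (S ` H) (?one, i) (?one, i))"
    unfolding eq of_real_sum by (intro sum.cong refl S.proj_matrix_rp[symmetric]) simp
  finally show ?thesis .
qed

lemma vn_dim_eqI:
  assumes "embedded_module E H G L n T"
    and "complex_of_real d = (\<Sum>i<n. proj_matrix (T ` H) (\<one>\<^bsub>G\<^esub>, i) (\<one>\<^bsub>G\<^esub>, i))"
  shows "vn_dim G L H = d"
  unfolding vn_dim_def
proof (rule the_equality)
  interpret T: embedded_module E H G L n T by fact
  show "\<exists>n T. module_embedding G L H n T \<and>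
      complex_of_real d = (\<Sum>i<n. proj_matrix (T ` H) (\<one>\<^bsub>G\<^esub>, i) (\<one>\<^bsub>G\<^esub>, i))"
    using T.embedding assms(2) by blast
  fix d' assume "\<exists>n T. module_embedding G L H n T \<and>
      complex_of_real d' = (\<Sum>i<n. proj_matrix (T ` H) (\<one>\<^bsub>G\<^esub>, i) (\<one>\<^bsub>G\<^esub>, i))"
  then obtain m S where S: "module_embedding G L H m S"
    "complex_of_real d' = (\<Sum>i<m. proj_matrix (S ` H) (\<one>\<^bsub>G\<^esub>, i) (\<one>\<^bsub>G\<^esub>, i))" by blast
  have "embedded_module E H G L m S"
    by (intro embedded_module.intro embedded_module_axioms.intro T.hilbert_module_axioms S(1))
  from trace_unique[OF assms(1) this] have "complex_of_real d' = complex_of_real d"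
    using S(2) assms(2) by simp
  then show "d' = d" by (simp only: of_real_eq_iff)
qed

text \<open>A module of functions on a free \<open>G\<close>-set with orbit representatives \<open>b \<one> i\<close>, on which \<open>G\<close> acts
  by permutations twisted by the signs \<open>s\<close>.\<close>

lemma vn_dim_signed_permutation:
  fixes G :: "('g, 'm) monoid_scheme" and n :: nat
  assumes H: "closed_subspace E H" and G: "group G" and inv: "invariant_under G L H"
    and bij: "bij_betw (\<lambda>(g, i). b g i) (carrier G \<times> {..<n}) E"
    and s: "\<And>g i. g \<in> carrier G \<Longrightarrow> i < n \<Longrightarrow> cmod (s g i) = 1"
    and L: "\<And>g h i u. g \<in> carrier G \<Longrightarrow> h \<in> carrier G \<Longrightarrow> i < n \<Longrightarrow> u \<in> H \<Longrightarrow>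
        s (g \<otimes>\<^bsub>G\<^esub> h) i * L g u (b (g \<otimes>\<^bsub>G\<^esub> h) i) = s h i * u (b h i)"
    and d: "complex_of_real d = (\<Sum>i<n. proj_matrix H (b \<one>\<^bsub>G\<^esub> i) (b \<one>\<^bsub>G\<^esub> i))"
  shows "vn_dim G L H = d"
proof -
  interpret G: group G by fact
  interpret ell2_subspace E H by unfold_locales fact
  let ?Y = "carrier G \<times> {..<n}"
  \<comment> \<open>Coordinates along the free orbits, with the sign undoing the twist so that
    \<open>G\<close> acts by pure left translation.\<close>
  define T where "T u = (\<lambda>(g, i). if g \<in> carrier G \<and> i < n then s g i * u (b g i) else 0)" for u
  have Tsq: "(cmod (T u y))\<^sup>2 = (if y \<in> ?Y then (cmod (u ((\<lambda>(g, i). b g i) y)))\<^sup>2 else 0)" for u y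
    by (cases y) (simp add: T_def norm_mult s)
  have Tell2: "T u \<in> ell2 ?Y" and Tnorm: "sqnorm (T u) = sqnorm u" if u: "u \<in> H" for u
  proof -
    have "(\<lambda>x. (cmod (u x))\<^sup>2) summable_on E"
      using summable_on_subset_banach[OF ell2_summable[OF in_ell2[OF u]]] by blast
    then have "(\<lambda>y. (cmod (u ((\<lambda>(g, i). b g i) y)))\<^sup>2) summable_on ?Y"
      using summable_on_reindex_bij_betw[OF bij, of "\<lambda>x. (cmod (u x))\<^sup>2"] by simp
    then have "(\<lambda>y. (cmod (T u y))\<^sup>2) summable_on UNIV"
      by (subst summable_on_cong_neutral[where T="?Y" and g="\<lambda>y. (cmod (u ((\<lambda>(g,
          i). b g i) y)))\<^sup>2"]) (auto simp: Tsq)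
    then show "T u \<in> ell2 ?Y" by (auto simp: ell2_def T_def split: if_splits)
    have "sqnorm (T u) = (\<Sum>\<^sub>\<infinity>y\<in>?Y. (cmod (u ((\<lambda>(g, i). b g i) y)))\<^sup>2)"
      by (rule infsum_cong_neutral) (auto simp: Tsq)
    also have "\<dots> = (\<Sum>\<^sub>\<infinity>x\<in>E. (cmod (u x))\<^sup>2)"
      by (rule infsum_reindex_bij_betw[OF bij])
    also have "\<dots> = sqnorm u"
      by (rule infsum_cong_neutral) (use ell2_outside[OF in_ell2[OF u]] in auto)
    finally show "sqnorm (T u) = sqnorm u" .
  qed
  have "module_embedding G L H n T"
    unfolding module_embedding_def
  proof (intro conjI ballI allI)
    show "T ` H \<subseteq> ell2 ?Y" using Tell2 by blast
    show "T (\<lambda>x. u x + v x) = (\<lambda>y. T u y + T v y)" for u v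
      by (auto simp: T_def fun_eq_iff distrib_left)
    show "T (\<lambda>x. c * u x) = (\<lambda>y. c * T u y)" for c u
      by (auto simp: T_def fun_eq_iff)
    show "ell2_norm (T u) = ell2_norm u" if "u \<in> H" for u
      using Tnorm[OF that] by (simp only: ell2_norm_def)
    fix g u assume g: "g \<in> carrier G" and u: "u \<in> H"
    show "T (L g u) = left_translation G g (T u)"
    proof
      fix y :: "'g \<times> nat"
      obtain x i where y: "y = (x, i)" by (cases y)
      show "T (L g u) y = left_translation G g (T u) y"
      proof (cases "x \<in> carrier G \<and> i < n")
        case True
        have "g \<otimes>\<^bsub>G\<^esub> (inv\<^bsub>G\<^esub> g \<otimes>\<^bsub>G\<^esub> x) = x" using True g by (simp add: G.m_assoc[symmetric])
        then show ?thesis using L[OF g _ _ u, of "inv\<^bsub>G\<^esub> g \<otimes>\<^bsub>G\<^esub> x" i] True g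
          by (simp add: y T_def left_translation_def)
      qed (auto simp: y T_def left_translation_def)
    qed
  qed
  then interpret T: embedded_module E H G L n T
    by unfold_locales (rule inv)
  have "proj_matrix (T ` H) (\<one>\<^bsub>G\<^esub>, i) (\<one>\<^bsub>G\<^esub>, i) = proj_matrix H (b \<one>\<^bsub>G\<^esub> i) (b \<one>\<^bsub>G\<^esub> i)" if i: "i < n" for i
  proof -
    let ?y = "(\<one>\<^bsub>G\<^esub>, i)" and ?x = "b \<one>\<^bsub>G\<^esub> i" and ?s = "s \<one>\<^bsub>G\<^esub> i"
    have x: "?x \<in> E" using bij i by (auto simp: bij_betw_def)
    let ?a = "orth_proj H (delta ?x)"
    have a: "?a \<in> H" by (rule orth_proj_in[OF delta_ell2[OF x]])
    \<comment> \<open>The inner product is conjugate linear in its second argument, so the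
      conjugated sign makes \<open>T ?c\<close> represent the coordinate \<open>?s * u ?x\<close> of
      \<open>T u\<close>.\<close>
    let ?c = "\<lambda>z. cnj ?s * ?a z"
    have c: "?c \<in> H" by (rule scale[OF a])
    have "orth_proj (T ` H) (delta ?y) = T ?c"
    proof (rule T.image.orth_proj_representer)
      show "?y \<in> ?Y" using i by simp
      show "T ?c \<in> T ` H" using c by blast
      fix w assume "w \<in> T ` H"
      then obtain u where u: "u \<in> H" "w = T u" by blast
      have "ell2_inner w (T ?c) = ell2_inner u ?c" unfolding u(2) by (rule T.T_inner[OF u(1) c])
      also have "\<dots> = ?s * u ?x" by (simp only: inner_scale_right inner_representer[OF x u(1)]
          complex_cnj_cnj)
      also have "\<dots> = w ?y" using i by (simp add: u(2) T_def)
      finally show "ell2_inner w (T ?c) = w ?y" .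
    qed
    then have "proj_matrix (T ` H) ?y ?y = of_real (sqnorm (T ?c))"
      using T.image.proj_matrix_diag[of ?y] i by simp
    also have "sqnorm (T ?c) = sqnorm ?c" by (rule T.T_sqnorm[OF c])
    also have "\<dots> = (cmod (cnj ?s))\<^sup>2 * sqnorm ?a" by (rule ell2_scale(2)[OF in_ell2[OF a]])
    also have "\<dots> = sqnorm ?a" using s[of "\<one>\<^bsub>G\<^esub>" i] i by simp
    finally show ?thesis by (simp only: proj_matrix_diag[OF x])
  qed
  then show ?thesis
    by (intro vn_dim_eqI[OF T.embedded_module_axioms]) (simp add: d)
qed

section \<open>Finite-range matrices and their adjoints\<close>

lemma inner_sum_right:
  assumes "finite S" "v \<in> ell2 E" "\<And>i. i \<in> S \<Longrightarrow> w i \<in> ell2 E"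
  shows "(\<lambda>x. \<Sum>i\<in>S. c i * w i x) \<in> ell2 E \<and>
    ell2_inner v (\<lambda>x. \<Sum>i\<in>S. c i * w i x) = (\<Sum>i\<in>S. cnj (c i) * ell2_inner v (w i))"
  using assms
proof (induction S rule: finite_induct)
  case empty
  then show ?case by (simp add: ell2_zero inner_zero)
next
  case (insert i S)
  have wi: "(\<lambda>x. c i * w i x) \<in> ell2 E" using insert.prems by (intro ell2_scale) auto
  have IH: "(\<lambda>x. \<Sum>i\<in>S. c i * w i x) \<in> ell2 E"
    "ell2_inner v (\<lambda>x. \<Sum>i\<in>S. c i * w i x) = (\<Sum>i\<in>S. cnj (c i) * ell2_inner v (w i))"
    using insert.IH[OF insert.prems(1)] insert.prems(2) by auto
  have eq: "(\<lambda>x. \<Sum>i\<in>insert i S. c i * w i x) = (\<lambda>x. c i * w i x + (\<Sum>i\<in>S. c i * w i x))"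
    using insert.hyps by simp
  show ?case unfolding eq
    using ell2_add(1)[OF wi IH(1)] inner_add_right[OF wi IH(1) insert.prems(1)] insert.hyps
    by (simp add: inner_scale_right IH(2))
qed

text \<open>Common form of \<open>bdry\<close> and \<open>cobdry\<close>, which are transposes of
  each other, so the adjointness argument is carried out once and used in both directions.\<close>

definition matrix_op :: "'a set \<Rightarrow> 'b set \<Rightarrow> ('a \<Rightarrow> 'b \<Rightarrow> int) \<Rightarrow> ('a \<Rightarrow> complex) \<Rightarrow> 'b \<Rightarrow> complex" where
  "matrix_op A B M u = (\<lambda>y. if y \<in> B then \<Sum>\<^sub>\<infinity>x\<in>A. of_int (M x y) * u x else 0)"

definition finite_functions :: "'a set \<Rightarrow> ('a \<Rightarrow> complex) set" where
  "finite_functions A = {u. finite {x. u x \<noteq> 0} \<and> {x. u x \<noteq> 0} \<subseteq> A}"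

text \<open>Images of point masses have finite support. For the boundary this holds because
  attaching spheres meet finitely many cells; for the coboundary it is local finiteness, which comes
  from cocompactness.\<close>

locale row_finite =
  fixes A :: "'a set" and B :: "'b set" and M :: "'a \<Rightarrow> 'b \<Rightarrow> int"
  assumes row_finite: "x \<in> A \<Longrightarrow> finite {y \<in> B. M x y \<noteq> 0}"
begin

definition row :: "'a \<Rightarrow> 'b \<Rightarrow> complex" where
  "row x = (\<lambda>y. if y \<in> B then of_int (M x y) else 0)"

lemma row_ell2: "x \<in> A \<Longrightarrow> row x \<in> ell2 B"
proof (rule ell2_finite_support)
  assume x: "x \<in> A"
  have eq: "{y. row x y \<noteq> 0} = {y \<in> B. M x y \<noteq> 0}" by (auto simp: row_def)
  show "finite {y. row x y \<noteq> 0}" "{y. row x y \<noteq> 0} \<subseteq> B"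
    unfolding eq using row_finite[OF x] by auto
qed

lemma matrix_op_finite:
  assumes "finite S" "S \<subseteq> A" "{x. u x \<noteq> 0} \<subseteq> S"
  shows "matrix_op A B M u = (\<lambda>y. \<Sum>x\<in>S. u x * row x y)"
proof
  fix y
  show "matrix_op A B M u y = (\<Sum>x\<in>S. u x * row x y)"
  proof (cases "y \<in> B")
    case True
    have "(\<Sum>\<^sub>\<infinity>x\<in>A. of_int (M x y) * u x) = (\<Sum>\<^sub>\<infinity>x\<in>S. u x * row x y)"
      by (rule infsum_cong_neutral) (use assms True in \<open>auto simp: row_def\<close>)
    then show ?thesis using True assms(1) by (simp add: matrix_op_def)
  qed (simp add: matrix_op_def row_def)
qed

lemma inner_row:
  assumes "v \<in> ell2 B" "x \<in> A"
  shows "ell2_inner v (row x) = matrix_op B A (\<lambda>y x. M x y) v x"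
proof -
  have "ell2_inner v (row x) = (\<Sum>\<^sub>\<infinity>y\<in>B. of_int (M x y) * v y)"
    unfolding ell2_inner_def by (rule infsum_cong_neutral) (auto simp: row_def)
  then show ?thesis using assms(2) by (simp add: matrix_op_def)
qed

lemma matrix_op_inner:
  assumes "u \<in> finite_functions A" "v \<in> ell2 B"
  shows "matrix_op A B M u \<in> ell2 B \<and>
    ell2_inner v (matrix_op A B M u) = (\<Sum>x | u x \<noteq> 0. cnj (u x) * ell2_inner v (row x))"
proof -
  have u: "finite {x. u x \<noteq> 0}" "{x. u x \<noteq> 0} \<subseteq> A" using assms(1) by (auto simp: finite_functions_def)
  show ?thesis unfolding matrix_op_finite[OF u subset_refl]
    by (rule inner_sum_right[OF u(1) assms(2)]) (use u(2) row_ell2 in blast)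
qed

lemma image_subset_ell2: "matrix_op A B M ` finite_functions A \<subseteq> ell2 B"
  using matrix_op_inner[OF _ ell2_zero] by blast

text \<open>The integer entries are real, so the transposed matrix applied to \<open>v\<close> lists
  the inner products of \<open>v\<close> with the rows. Rows are images of point masses, and the
  image of any finitely supported function is a finite combination of rows.\<close>

lemma orth_complement_image:
  "orth_complement B (matrix_op A B M ` finite_functions A) = {v \<in> ell2 B. matrix_op B A (\<lambda>y x. M x y) v
      = (\<lambda>_. 0)}"
proof (intro equalityI subsetI)
  fix v assume v: "v \<in> orth_complement B (matrix_op A B M ` finite_functions A)"
  then have vE: "v \<in> ell2 B" by (simp add: orth_complement_def)
  have "matrix_op B A (\<lambda>y x. M x y) v x = 0" if x: "x \<in> A" for x
  proof -
    have d: "delta x \<in> finite_functions A" using x by (auto simp: finite_functions_def)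
    have "matrix_op A B M (delta x) = (\<lambda>y. \<Sum>z\<in>{x}. delta x z * row z y)"
      by (rule matrix_op_finite) (use x in auto)
    then have "matrix_op A B M (delta x) = row x" by simp
    then have "row x \<in> matrix_op A B M ` finite_functions A" using d by (intro image_eqI[OF sym])
    then have "ell2_inner v (row x) = 0" using v unfolding orth_complement_def by blast
    then show ?thesis using inner_row[OF vE x] by simp
  qed
  then have "matrix_op B A (\<lambda>y x. M x y) v = (\<lambda>_. 0)"
  proof (intro ext)
    fix x show "matrix_op B A (\<lambda>y x. M x y) v x = 0"
    proof (cases "x \<in> A")
      case False
      then show ?thesis by (simp add: matrix_op_def)
    qed fact
  qed
  then show "v \<in> {v \<in> ell2 B. matrix_op B A (\<lambda>y x. M x y) v = (\<lambda>_. 0)}" using vE by simp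
next
  fix v assume "v \<in> {v \<in> ell2 B. matrix_op B A (\<lambda>y x. M x y) v = (\<lambda>_. 0)}"
  then have v: "v \<in> ell2 B" "matrix_op B A (\<lambda>y x. M x y) v = (\<lambda>_. 0)" by auto
  have "ell2_inner v (matrix_op A B M u) = 0" if u: "u \<in> finite_functions A" for u
  proof -
    have "ell2_inner v (row x) = 0" if "u x \<noteq> 0" for x
    proof -
      have "x \<in> A" using u that by (auto simp: finite_functions_def)
      then show ?thesis using inner_row[OF v(1)] v(2) by simp
    qed
    then show ?thesis using matrix_op_inner[OF u v(1)] by simp
  qed
  then show "v \<in> orth_complement B (matrix_op A B M ` finite_functions A)"
    using v(1) by (auto simp: orth_complement_def)
qed

lemma image_subspace:
  "(\<lambda>_. 0) \<in> matrix_op A B M ` finite_functions A"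
  "w \<in> matrix_op A B M ` finite_functions A \<Longrightarrow> w' \<in> matrix_op A B M ` finite_functions A \<Longrightarrow>
     (\<lambda>y. w y + w' y) \<in> matrix_op A B M ` finite_functions A"
  "w \<in> matrix_op A B M ` finite_functions A \<Longrightarrow> (\<lambda>y. c * w y) \<in> matrix_op A B M ` finite_functions A"
proof -
  show "(\<lambda>_. 0) \<in> matrix_op A B M ` finite_functions A"
    by (rule image_eqI[of _ _ "\<lambda>_. 0"]) (auto simp: matrix_op_def finite_functions_def)
next
  assume "w \<in> matrix_op A B M ` finite_functions A"
  then obtain u where u: "u \<in> finite_functions A" "w = matrix_op A B M u" by blast
  have fu: "finite {x. u x \<noteq> 0}" "{x. u x \<noteq> 0} \<subseteq> A" using u by (auto simp: finite_functions_def)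
  have "{x. c * u x \<noteq> 0} \<subseteq> {x. u x \<noteq> 0}" by auto
  then have "(\<lambda>y. c * w y) = matrix_op A B M (\<lambda>x. c * u x)"
    by (simp add: u(2) matrix_op_finite[OF fu] sum_distrib_left mult.assoc)
  moreover have "(\<lambda>x. c * u x) \<in> finite_functions A"
    using fu by (auto simp: finite_functions_def elim: finite_subset[rotated])
  ultimately show "(\<lambda>y. c * w y) \<in> matrix_op A B M ` finite_functions A" by blast
  assume "w' \<in> matrix_op A B M ` finite_functions A"
  then obtain u' where u': "u' \<in> finite_functions A" "w' = matrix_op A B M u'" by blast
  have fu': "finite {x. u' x \<noteq> 0}" "{x. u' x \<noteq> 0} \<subseteq> A" using u' by (auto simp: finite_functions_def)
  let ?S = "{x. u x \<noteq> 0} \<union> {x. u' x \<noteq> 0}"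
  have S: "finite ?S" "?S \<subseteq> A" using fu fu' by auto
  have "{x. u x + u' x \<noteq> 0} \<subseteq> ?S" "{x. u x \<noteq> 0} \<subseteq> ?S" "{x. u' x \<noteq> 0} \<subseteq> ?S" by auto
  then have "(\<lambda>y. w y + w' y) = matrix_op A B M (\<lambda>x. u x + u' x)"
    by (simp add: u(2) u'(2) matrix_op_finite[OF S] sum.distrib distrib_right)
  moreover have "(\<lambda>x. u x + u' x) \<in> finite_functions A"
  proof -
    have "{x. u x + u' x \<noteq> 0} \<subseteq> ?S" by auto
    then show ?thesis using finite_subset[OF _ S(1)] S(2) unfolding finite_functions_def by blast
  qed
  ultimately show "(\<lambda>y. w y + w' y) \<in> matrix_op A B M ` finite_functions A" by blast
qed

end

section \<open>Expected number of points\<close>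

lemma minor_det_singleton: "minor_det Q {x} = Q x x"
proof -
  have "{p. p permutes {x}} = {id}" by auto
  then show ?thesis by (simp add: minor_det_def sign_id)
qed

text \<open>The count is a finite sum of indicators, whose means are one-point probabilities, that
  is, minors of size one.\<close>

lemma determinantal_expectation:
  assumes P: "is_determinantal_measure E H P" and fin: "finite (D \<inter> E)"
  shows "complex_of_real (\<integral>F. real (card (F \<inter> D)) \<partial>P) = (\<Sum>e\<in>D \<inter> E. proj_matrix H e e)"
proof -
  interpret prob_space P using P by (simp add: is_determinantal_measure_def)
  have sp: "space P = Pow E" and st: "sets P = sigma_sets (Pow E) {{F \<in> Pow E. x \<in> F} | x. x \<in> E}"
    and m: "\<And>S. finite S \<Longrightarrow> S \<subseteq> E \<Longrightarrow> complex_of_real (measure P {F \<in> Pow E. S \<subseteq> F})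
        = minor_det (proj_matrix H) S"
    using P by (auto simp: is_determinantal_measure_def)
  let ?A = "\<lambda>e. {F \<in> Pow E. e \<in> F}"
  have A: "?A e \<in> sets P" if "e \<in> E" for e
    unfolding st by (rule sigma_sets.Basic) (use that in blast)
  have "(\<integral>F. real (card (F \<inter> D)) \<partial>P) = (\<integral>F. (\<Sum>e\<in>D \<inter> E. indicator (?A e) F) \<partial>P)"
  proof (rule Bochner_Integration.integral_cong[OF refl])
    fix F assume "F \<in> space P"
    then have F: "F \<subseteq> E" by (simp add: sp)
    have "(\<Sum>e\<in>D \<inter> E. indicator (?A e) F) = (\<Sum>e\<in>D \<inter> E. if e \<in> F then 1 else (0::real))"
      by (rule sum.cong) (use F in auto)
    also have "\<dots> = real (card {e \<in> D \<inter> E. e \<in> F})"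
      using fin by (simp add: sum.If_cases Int_def)
    also have "{e \<in> D \<inter> E. e \<in> F} = F \<inter> D" using F by auto
    finally show "real (card (F \<inter> D)) = (\<Sum>e\<in>D \<inter> E. indicator (?A e) F)" by simp
  qed
  also have "\<dots> = (\<Sum>e\<in>D \<inter> E. \<integral>F. indicator (?A e) F \<partial>P)"
    by (rule Bochner_Integration.integral_sum) (use A in \<open>auto simp: emeasure_eq_measure\<close>)
  also have "\<dots> = (\<Sum>e\<in>D \<inter> E. measure P (?A e))"
  proof (rule sum.cong[OF refl])
    fix e
    have "?A e \<inter> space P = ?A e" by (auto simp: sp)
    then show "(\<integral>F. indicator (?A e) F \<partial>P) = measure P (?A e)" by simp
  qed
  finally have "complex_of_real (\<integral>F. real (card (F \<inter> D)) \<partial>P)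
      = (\<Sum>e\<in>D \<inter> E. complex_of_real (measure P (?A e)))"
    by simp
  also have "\<dots> = (\<Sum>e\<in>D \<inter> E. proj_matrix H e e)"
  proof (rule sum.cong[OF refl])
    fix e assume "e \<in> D \<inter> E"
    then show "complex_of_real (measure P (?A e)) = proj_matrix H e e"
      using m[of "{e}"] by (simp add: minor_det_singleton)
  qed
  finally show ?thesis .
qed

section \<open>Fundamental domains\<close>

context cw_action begin

context
  fixes D
  assumes D: "fundamental_domain \<Gamma> K \<phi> D"
begin

lemma D_cells: "D \<subseteq> all_cells K"
  and D_unique: "e \<in> all_cells K \<Longrightarrow> \<exists>!d. d \<in> D \<and> (\<exists>g \<in> carrier \<Gamma>. e = mv g d)"
  using D by (auto simp: fundamental_domain_def mv_def)

lemma D_dim: "d \<in> D \<Longrightarrow> \<exists>n. d \<in> cells K n"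
  using D_cells by (auto simp: all_cells_def)

lemma D_inj:
  assumes "d \<in> D" "d' \<in> D" "g \<in> carrier \<Gamma>" "d' = mv g d"
  shows "d' = d"
proof -
  have d': "d' \<in> all_cells K" using assms D_cells by blast
  obtain n where "d' \<in> cells K n" using D_dim[OF assms(2)] by blast
  then have "d' = mv \<one> d'" by (simp add: mv_one)
  then show ?thesis using D_unique[OF d'] assms one_closed by blast
qed

lemma D_represent:
  assumes "e \<in> cells K n"
  shows "\<exists>d \<in> D \<inter> cells K n. \<exists>g \<in> carrier \<Gamma>. e = mv g d"
proof -
  obtain d g where d: "d \<in> D" "g \<in> carrier \<Gamma>" "e = mv g d"
    using D_unique[OF cells_all[OF assms]] by blast
  obtain m where m: "d \<in> cells K m" using D_dim[OF d(1)] by blast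
  then have "e \<in> cells K m" using d mv_cells by simp
  then have "m = n" using assms dim_unique by blast
  then show ?thesis using d m by blast
qed

text \<open>One point in each cell of \<open>D\<close> gives a closed discrete subset of the orbit space: the
  orbits of these points meet each cell once, and each closed cell lies in finitely many cells.\<close>

lemma finite_D: "finite D"
proof -
  define p where "p d = (SOME x. x \<in> d)" for d :: "'a set"
  have p: "p d \<in> d" if dD: "d \<in> D" for d
  proof -
    obtain n where "d \<in> cells K n" using D_dim[OF dD] by blast
    then have "d \<noteq> {}" by (rule cell_nonempty)
    then show ?thesis unfolding p_def by (simp add: some_in_eq)
  qed
  have pX: "p d \<in> topspace X" if "d \<in> D" for d
    using p[OF that] that D_cells topspace_eq by blast
  have orb_sub: "orbit \<Gamma> \<phi> x \<subseteq> orbit \<Gamma> \<phi> y" if y: "y \<in> topspace X" and x: "x \<in> orbit \<Gamma> \<phi> y" for x y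
  proof
    fix z assume "z \<in> orbit \<Gamma> \<phi> x"
    then obtain g h where gh: "g \<in> carrier \<Gamma>" "z = \<phi> g x" "h \<in> carrier \<Gamma>" "x = \<phi> h y"
      using x by (auto simp: orbit_def)
    then have "z = \<phi> (g \<otimes> h) y" using act_mult[OF y gh(1,3)] by simp
    then show "z \<in> orbit \<Gamma> \<phi> y" using gh by (auto simp: orbit_def)
  qed
  have act_X: "\<phi> g y \<in> topspace X" if "y \<in> topspace X" "g \<in> carrier \<Gamma>" for g y
    using continuous_map_image_subset_topspace[OF cont_action[OF that(2)]] that(1) by blast
  have orb_self: "y \<in> orbit \<Gamma> \<phi> y" if "y \<in> topspace X" for y
    using act_one[OF that] unfolding orbit_def by (auto intro!: exI[of _ \<one>])
  have orb_eq: "orbit \<Gamma> \<phi> x = orbit \<Gamma> \<phi> y" if y: "y \<in> topspace X" and x: "x \<in> orbit \<Gamma> \<phi> y" for x y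
  proof
    show "orbit \<Gamma> \<phi> x \<subseteq> orbit \<Gamma> \<phi> y" by (rule orb_sub[OF y x])
    obtain h where h: "h \<in> carrier \<Gamma>" "x = \<phi> h y" using x by (auto simp: orbit_def)
    have xX: "x \<in> topspace X" using act_X[OF y h(1)] h(2) by simp
    have "y = \<phi> (inv h) x" using act_mult[OF y, of "inv h" h] act_one[OF y] h by simp
    then have "y \<in> orbit \<Gamma> \<phi> x" using h by (auto simp: orbit_def)
    then show "orbit \<Gamma> \<phi> y \<subseteq> orbit \<Gamma> \<phi> x" by (rule orb_sub[OF xX])
  qed
  define q where "q d = orbit \<Gamma> \<phi> (p d)" for d
  let ?O = "orbit_space \<Gamma> X \<phi>"
  have top: "topspace ?O = orbits \<Gamma> (topspace X) \<phi>"
  proof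
    show "topspace ?O \<subseteq> orbits \<Gamma> (topspace X) \<phi>"
      using openin_topspace[of ?O] unfolding openin_orbit_space by simp
    have "{x \<in> topspace X. orbit \<Gamma> \<phi> x \<in> orbits \<Gamma> (topspace X) \<phi>} = topspace X"
      by (auto simp: orbits_def)
    then have "openin ?O (orbits \<Gamma> (topspace X) \<phi>)"
      unfolding openin_orbit_space by simp
    then show "orbits \<Gamma> (topspace X) \<phi> \<subseteq> topspace ?O" by (rule openin_subset)
  qed
  \<comment> \<open>A cell is a translate of one representative by one group element, so the
    translates of the chosen points leave at most one point in it.\<close>
  have once: "x = \<phi> g (p d)"
    if e: "e \<in> cells K n" and d: "d \<in> D" "g \<in> carrier \<Gamma>" "e = mv g d"
      and x: "x \<in> e" "d' \<in> D" "h \<in> carrier \<Gamma>" "x = \<phi> h (p d')" for e n d g x d' h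
  proof -
    obtain m where m: "d' \<in> cells K m" using D_dim[OF x(2)] by blast
    have "x \<in> mv h d'" using x p by (auto simp: mv_def)
    then have eq: "mv h d' = e" by (rule cells_disjoint[OF mv_cells[OF x(3) m] e _ x(1)])
    then have "d' = d" using D_unique[OF cells_all[OF e]] d x(2,3) by blast
    moreover have "h = g" using mv_free[OF m x(3) d(2)] eq d(3) \<open>d' = d\<close> by simp
    ultimately show ?thesis using x(4) by simp
  qed
  \<comment> \<open>Any subfamily of these orbits meets a closed cell in finitely many points, and
    the weak topology then makes their union closed.\<close>
  have closedA: "closedin X (\<Union>d\<in>S. q d)" if S: "S \<subseteq> D" for S
  proof (rule weak_topology)
    show "(\<Union>d\<in>S. q d) \<subseteq> topspace X"
      using act_X pX S by (auto simp: q_def orbit_def)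
    fix n e assume e: "e \<in> cells K n"
    have fin1: "finite ((\<Union>d\<in>S. q d) \<inter> f)" if f: "f \<in> cells K m" for f m
    proof -
      obtain d g where d: "d \<in> D" "g \<in> carrier \<Gamma>" "f = mv g d"
        using D_unique[OF cells_all[OF f]] by blast
      have "(\<Union>d\<in>S. q d) \<inter> f \<subseteq> {\<phi> g (p d)}"
        using once[OF f d] S by (auto simp: q_def orbit_def)
      then show ?thesis by (rule finite_subset) simp
    qed
    obtain F where F: "finite F" "F \<subseteq> (\<Union>m<n. cells K m)" "char_map K e ` disc_bdry n \<subseteq> \<Union>F"
      using finite_bdry[OF e] by blast
    have "(\<Union>d\<in>S. q d) \<inter> closed_cell n e \<subseteq> (\<Union>f\<in>insert e F. (\<Union>d\<in>S. q d) \<inter> f)"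
      using F(3) unfolding closed_cell_split[OF e] by auto
    moreover have "finite (\<Union>f\<in>insert e F. (\<Union>d\<in>S. q d) \<inter> f)"
    proof (rule finite_UN_I)
      show "finite (insert e F)" using F(1) by simp
      fix f assume "f \<in> insert e F"
      then have "\<exists>m. f \<in> cells K m" using e F(2) by blast
      then show "finite ((\<Union>d\<in>S. q d) \<inter> f)" using fin1 by blast
    qed
    ultimately have fin: "finite ((\<Union>d\<in>S. q d) \<inter> closed_cell n e)" by (rule finite_subset)
    have "closedin X ((\<Union>d\<in>S. q d) \<inter> closed_cell n e)"
      using fin closedin_subset[OF closedin_closed_cell[OF e]]
      by (intro closedin_Hausdorff_finite[OF hausdorff]) auto
    from closedin_continuous_map_preimage[OF cont_char[OF e] this]
    have "closedin (disc n) {x \<in> topspace (disc n). char_map K e x \<in> (\<Union>d\<in>S. q d) \<inter> closed_cell n e}" .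
    moreover have "{x \<in> topspace (disc n). char_map K e x \<in> (\<Union>d\<in>S. q d) \<inter> closed_cell n e}
        = {x \<in> topspace (disc n). char_map K e x \<in> (\<Union>d\<in>S. q d)}"
      by (auto simp: closed_cell_def)
    ultimately show "closedin (disc n) {x \<in> topspace (disc n). char_map K e x \<in> (\<Union>d\<in>S. q d)}" by simp
  qed
  have qO: "q ` D \<subseteq> topspace ?O"
    unfolding top using pX by (auto simp: q_def orbits_def)
  \<comment> \<open>Every subset of the image of \<open>D\<close> is therefore closed in the orbit
    space, so this image is closed and discrete there.\<close>
  have open_compl: "openin ?O (topspace ?O - R)" if R: "R \<subseteq> q ` D" for R
  proof -
    define S where "S = {d \<in> D. q d \<in> R}"
    have "{x \<in> topspace X. orbit \<Gamma> \<phi> x \<in> topspace ?O - R} = topspace X - (\<Union>d\<in>S. q d)"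
    proof (intro equalityI subsetI)
      fix x assume x: "x \<in> {x \<in> topspace X. orbit \<Gamma> \<phi> x \<in> topspace ?O - R}"
      have "x \<notin> q d" if "d \<in> S" for d
        using orb_eq[OF pX, of d x] x that by (auto simp: S_def q_def)
      then show "x \<in> topspace X - (\<Union>d\<in>S. q d)" using x by blast
    next
      fix x assume x: "x \<in> topspace X - (\<Union>d\<in>S. q d)"
      have "orbit \<Gamma> \<phi> x \<notin> R"
      proof
        assume "orbit \<Gamma> \<phi> x \<in> R"
        then obtain d where "d \<in> S" "orbit \<Gamma> \<phi> x = q d" using R by (auto simp: S_def)
        then show False using orb_self x by blast
      qed
      then show "x \<in> {x \<in> topspace X. orbit \<Gamma> \<phi> x \<in> topspace ?O - R}"
        using x unfolding top by (auto simp: orbits_def)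
    qed
    moreover have "openin X (topspace X - (\<Union>d\<in>S. q d))"
      by (rule openin_diff[OF openin_topspace closedA]) (simp add: S_def)
    ultimately show ?thesis unfolding openin_orbit_space using top by auto
  qed
  have "finite (q ` D)"
  proof (rule ccontr)
    assume "infinite (q ` D)"
    then have "?O derived_set_of (q ` D) \<noteq> {}"
      by (rule compact_space_imp_Bolzano_Weierstrass[OF compact_orbits _ qO])
    then obtain z where z: "z \<in> ?O derived_set_of (q ` D)" by blast
    \<comment> \<open>Removing all other points of the image leaves an open neighbourhood of
      \<open>z\<close>, against \<open>z\<close> being a limit point.\<close>
    let ?T = "topspace ?O - (q ` D - {z})"
    have "openin ?O ?T" by (rule open_compl) blast
    moreover have "z \<in> ?T" using z by (auto simp: in_derived_set_of)
    moreover have "\<forall>T. z \<in> T \<and> openin ?O T \<longrightarrow> (\<exists>y. y \<noteq> z \<and> y \<in> q ` D \<and> y \<in> T)"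
      using z unfolding in_derived_set_of by simp
    ultimately have "\<exists>y. y \<noteq> z \<and> y \<in> q ` D \<and> y \<in> ?T" by (simp only: simp_thms)
    then show False by blast
  qed
  moreover have "inj_on q D"
  proof (rule inj_onI)
    fix d d' assume d: "d \<in> D" "d' \<in> D" "q d = q d'"
    then have "p d' \<in> q d" using orb_self[OF pX[OF d(2)]] by (simp add: q_def)
    then obtain g where g: "g \<in> carrier \<Gamma>" "p d' = \<phi> g (p d)" by (auto simp: q_def orbit_def)
    obtain n where n: "d' \<in> cells K n" using D_dim[OF d(2)] by blast
    obtain m where m: "d \<in> cells K m" using D_dim[OF d(1)] by blast
    have "p d' \<in> mv g d" using g p[OF d(1)] by (auto simp: mv_def)
    then have "d' = mv g d"
      by (rule cells_disjoint[OF n mv_cells[OF g(1) m] p[OF d(2)]])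
    then show "d = d'" using D_inj[OF d(1,2) g(1)] by simp
  qed
  ultimately show ?thesis by (rule finite_imageD)
qed

text \<open>By freeness each \<open>k\<close>-cell is a unique translate of a unique representative,
  which gives the bijection for \<open>vn_dim_signed_permutation\<close>. The twist is
  \<open>orient\<close>, whose squares cancel in the equivariance condition.\<close>

lemma vn_dim_trace:
  assumes H: "closed_subspace (cells K k) H" and inv: "invariant_under \<Gamma> (chain_action K \<phi> k) H"
    and t: "complex_of_real t = (\<Sum>e\<in>D \<inter> cells K k. proj_matrix H e e)"
  shows "vn_dim \<Gamma> (chain_action K \<phi> k) H = t"
proof -
  let ?Dk = "D \<inter> cells K k"
  obtain d where d: "bij_betw d {..<card ?Dk} ?Dk"
    using ex_bij_betw_nat_finite[of ?Dk] finite_D by (auto simp: atLeast0LessThan)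
  then have dD: "d i \<in> D" "d i \<in> cells K k" if "i < card ?Dk" for i
    using that by (auto simp: bij_betw_def)
  show ?thesis
  proof (rule vn_dim_signed_permutation[where b="\<lambda>g i. mv g (d i)" and s="\<lambda>g i. of_int (orient k g (d
      i))", OF H group_axioms inv])
    show "bij_betw (\<lambda>(g, i). mv g (d i)) (carrier \<Gamma> \<times> {..<card ?Dk}) (cells K k)"
      unfolding bij_betw_def
    proof
      show "inj_on (\<lambda>(g, i). mv g (d i)) (carrier \<Gamma> \<times> {..<card ?Dk})"
      proof (rule inj_onI, clarify)
        fix g i h j assume *: "g \<in> carrier \<Gamma>" "i < card ?Dk" "h \<in> carrier \<Gamma>" "j < card ?Dk" "mv g (d i)
            = mv h (d j)"
        note i = dD[OF *(2)] and j = dD[OF *(4)]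
        have "mv g (d i) \<in> all_cells K" using mv_cells[OF *(1) i(2)] cells_all by blast
        then have "d i = d j" using D_unique i(1) j(1) *(1,3,5) by blast
        then have "i = j" using d *(2,4) by (auto simp: bij_betw_def inj_on_def)
        then show "g = h \<and> i = j" using mv_free[OF i(2) *(1,3)] *(5) by simp
      qed
      show "(\<lambda>(g, i). mv g (d i)) ` (carrier \<Gamma> \<times> {..<card ?Dk}) = cells K k"
      proof (intro equalityI subsetI)
        fix e assume "e \<in> (\<lambda>(g, i). mv g (d i)) ` (carrier \<Gamma> \<times> {..<card ?Dk})"
        then show "e \<in> cells K k" using dD mv_cells by auto
      next
        fix e assume "e \<in> cells K k"
        then obtain c g where "c \<in> ?Dk" "g \<in> carrier \<Gamma>" "e = mv g c" using D_represent by blast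
        moreover from this obtain i where "i < card ?Dk" "c = d i" using d by (auto simp: bij_betw_def)
        ultimately show "e \<in> (\<lambda>(g, i). mv g (d i)) ` (carrier \<Gamma> \<times> {..<card ?Dk})"
          by (intro image_eqI[of _ _ "(g, i)"]) auto
      qed
    qed
    show "cmod (of_int (orient k g (d i))) = 1" if "g \<in> carrier \<Gamma>" "i < card ?Dk" for g i
      using orient_square[OF that(1) dD(2)[OF that(2)]] by (auto simp: zmult_eq_1_iff)
    show "of_int (orient k (g \<otimes> h) (d i)) * chain_action K \<phi> k g u (mv (g \<otimes> h) (d i)) =
        of_int (orient k h (d i)) * u (mv h (d i))"
      if g: "g \<in> carrier \<Gamma>" and h: "h \<in> carrier \<Gamma>" and i: "i < card ?Dk" for g h i u
    proof -
      note c = mv_cells[OF h dD(2)[OF i]]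
      have "of_int (orient k (g \<otimes> h) (d i)) * chain_action K \<phi> k g u (mv (g \<otimes> h) (d i)) =
         of_int (orient k g (mv h (d i)) * orient k g (mv h (d i))) * (of_int (orient k h (d i)) * u (mv
             h (d i)))"
        by (simp add: mv_mult[OF dD(2)[OF i] g h] chain_action_mv[OF g c] orient_mult[OF g h dD(2)[OF i]])
      then show ?thesis by (simp only: orient_square[OF g c] of_int_1 mult_1_left)
    qed
    have "(\<Sum>e\<in>?Dk. proj_matrix H e e) = (\<Sum>i<card ?Dk. proj_matrix H (d i) (d i))"
      by (rule sum.reindex_bij_betw[OF d, symmetric])
    also have "\<dots> = (\<Sum>i<card ?Dk. proj_matrix H (mv \<one> (d i)) (mv \<one> (d i)))"
      by (rule sum.cong) (simp_all add: mv_one[OF dD(2)])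
    finally show "complex_of_real t = (\<Sum>i<card ?Dk. proj_matrix H (mv \<one> (d i)) (mv \<one> (d i)))"
      unfolding t .
  qed
qed

text \<open>Write \<open>e\<close> as a translate by \<open>g\<close> of some \<open>d\<close> in
  \<open>D\<close>. Equivariance makes the translate of \<open>f\<close> by \<open>inv g\<close>
  incident to \<open>d\<close>. There are finitely many \<open>d\<close>, each with finite boundary,
  and freeness recovers \<open>g\<close> from that translate.\<close>

lemma locally_finite:
  assumes f: "f \<in> cells K n"
  shows "finite {e \<in> cells K (Suc n). incidence K n e f \<noteq> 0}"
proof -
  let ?G = "\<lambda>d. {g \<in> carrier \<Gamma>. incidence K n d (mv (inv g) f) \<noteq> 0}"
  have fin: "finite (?G d)" if d: "d \<in> cells K (Suc n)" for d
  proof (rule finite_imageD[where f="\<lambda>g. mv (inv g) f"])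
    show "finite ((\<lambda>g. mv (inv g) f) ` ?G d)"
      by (rule finite_subset[OF _ finite_incidence[OF d]]) auto
    show "inj_on (\<lambda>g. mv (inv g) f) (?G d)"
    proof (rule inj_onI)
      fix g h assume "g \<in> ?G d" "h \<in> ?G d" "mv (inv g) f = mv (inv h) f"
      then have "inv g = inv h" using mv_free[OF f, of "inv g" "inv h"] by simp
      then have "inv (inv g) = inv (inv h)" by (simp only:)
      then show "g = h" using \<open>g \<in> ?G d\<close> \<open>h \<in> ?G d\<close> by simp
    qed
  qed
  have "{e \<in> cells K (Suc n). incidence K n e f \<noteq> 0} \<subseteq> (\<Union>d\<in>D \<inter> cells K (Suc n). (\<lambda>g. mv g d) ` ?G d)"
  proof
    fix e assume "e \<in> {e \<in> cells K (Suc n). incidence K n e f \<noteq> 0}"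
    then have e: "e \<in> cells K (Suc n)" "incidence K n e f \<noteq> 0" by auto
    obtain d g where d: "d \<in> D \<inter> cells K (Suc n)" "g \<in> carrier \<Gamma>" "e = mv g d"
      using D_represent[OF e(1)] by blast
    have f': "mv (inv g) f \<in> cells K n" using mv_cells f d(2) by simp
    have "orient (Suc n) g d * incidence K n e f = incidence K n d (mv (inv g) f) * orient n g (mv (inv
        g) f)"
      using incidence_equivariant[OF d(2) _ f', of d] d mv_inv2[OF f d(2)] by simp
    moreover have "orient (Suc n) g d \<noteq> 0" using orient_square[of g d "Suc n"] d by auto
    ultimately have "incidence K n d (mv (inv g) f) \<noteq> 0" using e(2) by auto
    then show "e \<in> (\<Union>d\<in>D \<inter> cells K (Suc n). (\<lambda>g. mv g d) ` ?G d)" using d by blast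
  qed
  moreover have "finite (\<Union>d\<in>D \<inter> cells K (Suc n). (\<lambda>g. mv g d) ` ?G d)"
    using finite_D fin by (intro finite_UN_I finite_imageI) auto
  ultimately show ?thesis by (rule finite_subset)
qed

end

end

section \<open>Harmonic chains\<close>

context cw_action begin

lemma bdry_matrix: "bdry K (Suc n) = matrix_op (cells K (Suc n)) (cells K n) (incidence K n)"
  by (rule ext) (simp add: matrix_op_def)

lemma cobdry_matrix: "cobdry K n = matrix_op (cells K n) (cells K (Suc n)) (\<lambda>f e. incidence K n e f)"
  by (rule ext) (simp add: cobdry_def matrix_op_def)

lemma fin_chains_eq: "fin_chains K n = finite_functions (cells K n)"
  by (simp add: fin_chains_def finite_functions_def)

lemma row_finite_incidence: "row_finite (cells K (Suc n)) (cells K n) (incidence K n)"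
  by unfold_locales (rule finite_subset[OF _ finite_incidence], auto)

lemma boundary_space_eq: "boundary_space K k = matrix_op (cells K (Suc k)) (cells K k) (incidence K k) `
    finite_functions (cells K (Suc k))"
  by (simp only: boundary_space_def bdry_matrix fin_chains_eq)

lemma boundary_space_ell2: "boundary_space K k \<subseteq> ell2 (cells K k)"
  unfolding boundary_space_eq by (rule row_finite.image_subset_ell2[OF row_finite_incidence])

lemma orth_boundary:
  "orth_complement (cells K k) (boundary_space K k) = {v \<in> ell2 (cells K k). cobdry K k v = (\<lambda>_. 0)}"
  unfolding boundary_space_eq cobdry_matrix
  by (rule row_finite.orth_complement_image[OF row_finite_incidence])

lemma orient_cancel: "g \<in> carrier \<Gamma> \<Longrightarrow> e \<in> cells K n \<Longrightarrow> complex_of_int (orient n g e) * (complex_of_int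
    (orient n g e) * z) = z"
proof -
  assume "g \<in> carrier \<Gamma>" "e \<in> cells K n"
  then have "complex_of_int (orient n g e * orient n g e) = 1" by (simp only: orient_square of_int_1)
  then show ?thesis by (simp add: mult.assoc[symmetric])
qed

lemma bij_mv: "g \<in> carrier \<Gamma> \<Longrightarrow> bij_betw (mv g) (cells K n) (cells K n)"
  by (rule bij_betw_byWitness[where f'="mv (inv g)"]) (auto simp: mv_inv mv_inv2 mv_cells)

lemma chain_action_ell2:
  assumes g: "g \<in> carrier \<Gamma>" and u: "u \<in> ell2 (cells K n)"
  shows "chain_action K \<phi> n g u \<in> ell2 (cells K n)"
proof -
  let ?v = "chain_action K \<phi> n g u"
  have "(\<lambda>e. (cmod (u e))\<^sup>2) summable_on cells K n"
    using summable_on_subset_banach[OF ell2_summable[OF u]] by blast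
  then have "(\<lambda>e. (cmod (?v (mv g e)))\<^sup>2) summable_on cells K n"
  proof (rule summable_on_cong[THEN iffD1, rotated])
    fix e assume e: "e \<in> cells K n"
    have "cmod (of_int (orient n g e)) = 1"
      using orient_square[OF g e] by (auto simp: zmult_eq_1_iff)
    then show "(cmod (u e))\<^sup>2 = (cmod (?v (mv g e)))\<^sup>2"
      by (simp add: chain_action_mv[OF g e] norm_mult)
  qed
  then have "(\<lambda>f. (cmod (?v f))\<^sup>2) summable_on cells K n"
    using summable_on_reindex_bij_betw[OF bij_mv[OF g, of n], of "\<lambda>f. (cmod (?v f))\<^sup>2"] by simp
  then have "(\<lambda>f. (cmod (?v f))\<^sup>2) summable_on UNIV"
    by (subst summable_on_cong_neutral[where T="cells K n" and g="\<lambda>f. (cmod (?v f))\<^sup>2"]) (auto simp: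
        chain_action_outside)
  then show ?thesis by (simp add: ell2_def chain_action_outside)
qed

lemma incidence_mv:
  assumes "g \<in> carrier \<Gamma>" "e \<in> cells K (Suc n)" "f \<in> cells K n"
  shows "incidence K n (mv g e) (mv g f) = orient (Suc n) g e * incidence K n e f * orient n g f"
proof -
  have "orient (Suc n) g e * (orient (Suc n) g e * incidence K n (mv g e) (mv g f)) =
      orient (Suc n) g e * (incidence K n e f * orient n g f)"
    by (simp only: incidence_equivariant[OF assms])
  then show ?thesis
    using orient_square[OF assms(1,2)] by (simp add: mult.assoc[symmetric])
qed

lemma cobdry_chain_action:
  assumes g: "g \<in> carrier \<Gamma>" and e: "e \<in> cells K (Suc n)"
  shows "cobdry K n (chain_action K \<phi> n g u) (mv g e) = of_int (orient (Suc n) g e) * cobdry K n u e"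
proof -
  let ?v = "chain_action K \<phi> n g u"
  have "cobdry K n ?v (mv g e) = (\<Sum>\<^sub>\<infinity>f\<in>cells K n. of_int (incidence K n (mv g e) f) * ?v f)"
    using mv_cells[OF g e] by (simp add: cobdry_def)
  also have "\<dots> = (\<Sum>\<^sub>\<infinity>f\<in>cells K n. of_int (incidence K n (mv g e) (mv g f)) * ?v (mv g f))"
    by (rule infsum_reindex_bij_betw[OF bij_mv[OF g], symmetric])
  also have "\<dots> = (\<Sum>\<^sub>\<infinity>f\<in>cells K n. of_int (orient (Suc n) g e) * (of_int (incidence K n e f) * u f))"
    by (rule infsum_cong) (simp add: incidence_mv[OF g e] chain_action_mv[OF g] mult.assoc
        orient_cancel[OF g])
  also have "\<dots> = of_int (orient (Suc n) g e) * (\<Sum>\<^sub>\<infinity>f\<in>cells K n. of_int (incidence K n e f) * u f)"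
    by (rule infsum_cmult_right')
  finally show ?thesis using e by (simp add: cobdry_def)
qed

lemma bdry_chain_action:
  assumes g: "g \<in> carrier \<Gamma>" and f: "f \<in> cells K n"
  shows "bdry K (Suc n) (chain_action K \<phi> (Suc n) g u) (mv g f)
      = of_int (orient n g f) * bdry K (Suc n) u f"
proof -
  let ?v = "chain_action K \<phi> (Suc n) g u"
  have "bdry K (Suc n) ?v (mv g f) = (\<Sum>\<^sub>\<infinity>e\<in>cells K (Suc n). of_int (incidence K n e (mv g f)) * ?v e)"
    using mv_cells[OF g f] by simp
  also have "\<dots> = (\<Sum>\<^sub>\<infinity>e\<in>cells K (Suc n). of_int (incidence K n (mv g e) (mv g f)) * ?v (mv g e))"
    by (rule infsum_reindex_bij_betw[OF bij_mv[OF g], symmetric])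
  also have "\<dots> = (\<Sum>\<^sub>\<infinity>e\<in>cells K (Suc n). of_int (orient n g f) * (of_int (incidence K n e f) * u e))"
  proof (rule infsum_cong)
    fix e assume e: "e \<in> cells K (Suc n)"
    have "of_int (incidence K n (mv g e) (mv g f)) * ?v (mv g e) =
      complex_of_int (orient n g f) * (of_int (incidence K n e f) * (of_int (orient (Suc n) g e) *
          (of_int (orient (Suc n) g e) * u e)))"
      by (simp add: incidence_mv[OF g e f] chain_action_mv[OF g e])
    then show "of_int (incidence K n (mv g e) (mv g f)) * ?v (mv g e) =
      complex_of_int (orient n g f) * (of_int (incidence K n e f) * u e)"
      by (simp only: orient_cancel[OF g e])
  qed
  also have "\<dots> = of_int (orient n g f) * (\<Sum>\<^sub>\<infinity>e\<in>cells K (Suc n). of_int (incidence K n e f) * u e)"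
    by (rule infsum_cmult_right')
  finally show ?thesis using f by simp
qed

text \<open>Every cell is a translate under \<open>g\<close>, so the equivariance formulas determine
  the boundary and coboundary of the translated chain at all cells.\<close>

lemma harmonic_invariant: "invariant_under \<Gamma> (chain_action K \<phi> k) (harmonic_chains K k)"
  unfolding invariant_under_def
proof (intro ballI)
  fix g u assume g: "g \<in> carrier \<Gamma>" and "u \<in> harmonic_chains K k"
  then have u: "u \<in> ell2 (cells K k)" "bdry K k u = (\<lambda>_. 0)" "cobdry K k u = (\<lambda>_. 0)"
    by (auto simp: harmonic_chains_def)
  let ?v = "chain_action K \<phi> k g u"
  have surj: "\<exists>f\<in>cells K n. e = mv g f" if "e \<in> cells K n" for e n
    using bij_mv[OF g, of n] that by (auto simp: bij_betw_def)
  have "cobdry K k ?v e = 0" for e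
  proof (cases "e \<in> cells K (Suc k)")
    case True
    then obtain f where "f \<in> cells K (Suc k)" "e = mv g f" using surj by blast
    then show ?thesis using cobdry_chain_action[OF g, of f k u] u(3) by simp
  qed (simp add: cobdry_def)
  moreover have "bdry K k ?v e = 0" for e
  proof (cases k)
    case (Suc j)
    show ?thesis
    proof (cases "e \<in> cells K j")
      case True
      then obtain f where "f \<in> cells K j" "e = mv g f" using surj by blast
      then show ?thesis using bdry_chain_action[OF g, of f j u] u(2) unfolding Suc by (simp del: bdry.simps)
    qed (simp add: Suc)
  qed simp
  ultimately show "?v \<in> harmonic_chains K k"
    using chain_action_ell2[OF g u(1)] by (auto simp: harmonic_chains_def)
qed

context
  fixes D
  assumes D: "fundamental_domain \<Gamma> K \<phi> D"
begin

lemma row_finite_coincidence: "row_finite (cells K n) (cells K (Suc n)) (\<lambda>f e. incidence K n e f)"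
  by unfold_locales (rule locally_finite[OF D])

lemma coboundary_space_Suc:
  "coboundary_space K (Suc j) = matrix_op (cells K j) (cells K (Suc j)) (\<lambda>f e. incidence K j e f) `
      finite_functions (cells K j)"
  by (simp add: coboundary_space_def cobdry_matrix fin_chains_eq)

lemma coboundary_space_0: "coboundary_space K 0 = {\<lambda>_. 0}"
  by (simp add: coboundary_space_def)

lemma coboundary_space_ell2: "coboundary_space K k \<subseteq> ell2 (cells K k)"
proof (cases k)
  case (Suc j)
  show ?thesis unfolding Suc coboundary_space_Suc by (rule row_finite.image_subset_ell2[OF
      row_finite_coincidence])
qed (simp add: coboundary_space_0 ell2_zero)

lemma orth_coboundary:
  "orth_complement (cells K k) (coboundary_space K k) = {v \<in> ell2 (cells K k). bdry K k v = (\<lambda>_. 0)}"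
proof (cases k)
  \<comment> \<open>In degree 0 the coboundary space is zero and \<open>bdry K 0\<close> vanishes,
    so both sides are the whole space.\<close>
  case 0
  then show ?thesis by (auto simp: coboundary_space_0 orth_complement_def inner_zero)
next
  case (Suc j)
  show ?thesis unfolding Suc coboundary_space_Suc bdry_matrix
    by (rule row_finite.orth_complement_image[OF row_finite_coincidence])
qed

lemma closed_coboundary_closure:
  "closed_subspace (cells K k) (ell2_closure (cells K k) (coboundary_space K k))"
proof (rule closed_subspace_closure(1)[OF coboundary_space_ell2])
  show "(\<lambda>_. 0) \<in> coboundary_space K k"
    by (cases k) (simp_all only: coboundary_space_0 coboundary_space_Suc row_finite.image_subspace(1)[OF
        row_finite_coincidence] singletonI)
  show "(\<lambda>x. u x + v x) \<in> coboundary_space K k" if "u \<in> coboundary_space K k" "v \<in> coboundary_space K k"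
      for u v
  proof (cases k)
    case (Suc j)
    show ?thesis using that unfolding Suc coboundary_space_Suc
      by (rule row_finite.image_subspace(2)[OF row_finite_coincidence])
  qed (use that in \<open>simp add: coboundary_space_0\<close>)
  show "(\<lambda>x. c * u x) \<in> coboundary_space K k" if "u \<in> coboundary_space K k" for c u
  proof (cases k)
    case (Suc j)
    show ?thesis using that unfolding Suc coboundary_space_Suc
      by (rule row_finite.image_subspace(3)[OF row_finite_coincidence])
  qed (use that in \<open>simp add: coboundary_space_0\<close>)
qed

text \<open>The transpose of \<open>incidence_incidence\<close>. Finite support of the cochain and
  finiteness of the boundary of \<open>e\<close> make both sums finite, so their order can be
  exchanged.\<close>

lemma cobdry_coboundary:
  assumes "w \<in> coboundary_space K k"
  shows "cobdry K k w = (\<lambda>_. 0)"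
proof (cases k)
  case 0
  then show ?thesis using assms by (auto simp: coboundary_space_0 cobdry_def)
next
  case (Suc j)
  then obtain u where u: "u \<in> finite_functions (cells K j)" and w: "w = cobdry K j u"
    using assms by (auto simp: coboundary_space_Suc cobdry_matrix)
  have fu: "finite {h. u h \<noteq> 0}" "{h. u h \<noteq> 0} \<subseteq> cells K j" using u by (auto simp: finite_functions_def)
  have wf: "w f = (\<Sum>h | u h \<noteq> 0. of_int (incidence K j f h) * u h)" if "f \<in> cells K (Suc j)" for f
  proof -
    have "w f = (\<Sum>\<^sub>\<infinity>h\<in>cells K j. of_int (incidence K j f h) * u h)" using that by (simp add: w cobdry_def)
    also have "\<dots> = (\<Sum>\<^sub>\<infinity>h\<in>{h. u h \<noteq> 0}. of_int (incidence K j f h) * u h)"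
      by (rule infsum_cong_neutral) (use fu in auto)
    finally show ?thesis using fu(1) by simp
  qed
  show ?thesis
  proof
    fix e
    show "cobdry K k w e = 0"
    proof (cases "e \<in> cells K (Suc k)")
      case True
      then have e: "e \<in> cells K (Suc (Suc j))" using Suc by simp
      let ?I = "{f. incidence K (Suc j) e f \<noteq> 0}"
      have I: "finite ?I" "?I \<subseteq> cells K (Suc j)" using finite_incidence[OF e] incidence_cells[OF e] by auto
      have "cobdry K k w e = (\<Sum>\<^sub>\<infinity>f\<in>cells K (Suc j). of_int (incidence K (Suc j) e f) * w f)"
        using e by (simp add: cobdry_def Suc)
      also have "\<dots> = (\<Sum>\<^sub>\<infinity>f\<in>?I. of_int (incidence K (Suc j) e f) * w f)"
        by (rule infsum_cong_neutral) (use I in auto)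
      also have "\<dots> = (\<Sum>f\<in>?I. of_int (incidence K (Suc j) e f) * w f)" using I by simp
      also have "\<dots> = (\<Sum>f\<in>?I. \<Sum>h | u h \<noteq> 0. of_int (incidence K (Suc j) e f * incidence K j f h) * u h)"
        by (rule sum.cong[OF refl]) (use I wf in \<open>auto simp: sum_distrib_left mult.assoc\<close>)
      also have "\<dots> = (\<Sum>h | u h \<noteq> 0. \<Sum>f\<in>?I. of_int (incidence K (Suc j) e f * incidence K j f h) * u h)"
        by (rule sum.swap)
      also have "\<dots> = (\<Sum>h | u h \<noteq> 0. of_int (\<Sum>f\<in>?I. incidence K (Suc j) e f * incidence K j f h) * u h)"
        by (simp only: sum_distrib_right[symmetric] of_int_sum)
      also have "\<dots> = 0" by (simp only: incidence_incidence[OF e] of_int_0 mult_zero_left sum.neutral_const)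
      finally show ?thesis .
    qed (simp add: cobdry_def)
  qed
qed

lemma harmonic_eq:
  "harmonic_chains K k = orth_complement (cells K k) (boundary_space K k) \<inter>
     orth_complement (cells K k) (ell2_closure (cells K k) (coboundary_space K k))"
  unfolding orth_complement_closure[OF coboundary_space_ell2] orth_boundary orth_coboundary
  by (auto simp: harmonic_chains_def)

text \<open>Coboundaries are cocycles, and the cocycles form the closed space orthogonal to
  boundaries. This is the inclusion required by \<open>proj_matrix_split\<close>.\<close>

lemma coboundary_closure_subset:
  "ell2_closure (cells K k) (coboundary_space K k) \<subseteq> orth_complement (cells K k) (boundary_space K k)"
proof -
  interpret F: ell2_subspace "cells K k" "orth_complement (cells K k) (boundary_space K k)"
    by unfold_locales (rule closed_subspace_orth_complement[OF boundary_space_ell2])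
  have "coboundary_space K k \<subseteq> orth_complement (cells K k) (boundary_space K k)"
    unfolding orth_boundary using coboundary_space_ell2 cobdry_coboundary by blast
  then have "ell2_closure (cells K k) (coboundary_space K k)
      \<subseteq> ell2_closure (cells K k) (orth_complement (cells K k) (boundary_space K k))"
    unfolding ell2_closure_def by blast
  then show ?thesis using F.closed unfolding closed_subspace_def by blast
qed

section \<open>The expectation formulas\<close>

lemma expectation_eq_vn_dim:
  assumes "closed_subspace (cells K k) H" "invariant_under \<Gamma> (chain_action K \<phi> k) H"
    "is_determinantal_measure (cells K k) H P"
  shows "(\<integral>F. real (card (F \<inter> D)) \<partial>P) = vn_dim \<Gamma> (chain_action K \<phi> k) H"
proof -
  have "finite (D \<inter> cells K k)" using finite_D[OF D] by simp
  from vn_dim_trace[OF D assms(1,2) determinantal_expectation[OF assms(3) this]] show ?thesis by simp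
qed

text \<open>The two expectations are kept as traces and only their difference is read as a
  dimension, so invariance is established just for the harmonic chains.\<close>

lemma expectation_difference:
  assumes PF: "is_determinantal_measure (cells K k) (orth_complement (cells K k) (boundary_space K k)) PF"
    and PW: "is_determinantal_measure (cells K k) (ell2_closure (cells K k) (coboundary_space K k)) PW"
  shows "(\<integral>F. real (card (F \<inter> D)) \<partial>PF) - (\<integral>F. real (card (F \<inter> D)) \<partial>PW) = l2_betti \<Gamma> K \<phi> k"
proof -
  let ?E = "cells K k"
  let ?F = "orth_complement ?E (boundary_space K k)" and ?W = "ell2_closure ?E (coboundary_space K k)"
  have fin: "finite (D \<inter> ?E)" using finite_D[OF D] by simp
  have F: "closed_subspace ?E ?F" by (rule closed_subspace_orth_complement[OF boundary_space_ell2])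
  have W: "closed_subspace ?E ?W" by (rule closed_coboundary_closure)
  have "?W \<subseteq> ell2 ?E" using W by (simp add: closed_subspace_def)
  then have H: "closed_subspace ?E (harmonic_chains K k)"
    unfolding harmonic_eq by (intro closed_subspace_Int F closed_subspace_orth_complement)
  have "complex_of_real ((\<integral>F. real (card (F \<inter> D)) \<partial>PF) - (\<integral>F. real (card (F \<inter> D)) \<partial>PW)) =
      (\<Sum>e\<in>D \<inter> ?E. proj_matrix ?F e e) - (\<Sum>e\<in>D \<inter> ?E. proj_matrix ?W e e)"
    by (simp only: of_real_diff determinantal_expectation[OF PF fin] determinantal_expectation[OF PW fin])
  also have "\<dots> = (\<Sum>e\<in>D \<inter> ?E. proj_matrix (harmonic_chains K k) e e)"
    unfolding sum_subtractf[symmetric] harmonic_eq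
    by (rule sum.cong[OF refl]) (use proj_matrix_split[OF F W coboundary_closure_subset] in auto)
  finally have t: "complex_of_real ((\<integral>F. real (card (F \<inter> D)) \<partial>PF) - (\<integral>F. real (card (F \<inter> D)) \<partial>PW)) =
      (\<Sum>e\<in>D \<inter> ?E. proj_matrix (harmonic_chains K k) e e)" .
  show ?thesis
    unfolding l2_betti_def using vn_dim_trace[OF D H harmonic_invariant t] by (rule sym)
qed

end

end

theorem proposition4p13:
  fixes \<Gamma> :: "('g, 'm) monoid_scheme"
    and X :: "'a cw_complex"
    and \<phi> :: "'g \<Rightarrow> 'a \<Rightarrow> 'a"
    and D :: "'a set set"
    and k :: nat
  assumes "group \<Gamma>"
    and "countable (carrier \<Gamma>)"
    and "cocompact_cw_complex \<Gamma> X \<phi>"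
    and "fundamental_domain \<Gamma> X \<phi> D"
  shows "(\<forall>H P. closed_subspace (cells X k) H \<longrightarrow>
              invariant_under \<Gamma> (chain_action X \<phi> k) H \<longrightarrow>
              is_determinantal_measure (cells X k) H P \<longrightarrow>
              (\<integral>F. real (card (F \<inter> D)) \<partial>P) = vn_dim \<Gamma> (chain_action X \<phi> k) H) \<and>
         (\<forall>PF PW.
              is_determinantal_measure (cells X k)
                (orth_complement (cells X k) (boundary_space X k)) PF \<longrightarrow>
              is_determinantal_measure (cells X k)
                (ell2_closure (cells X k) (coboundary_space X k)) PW \<longrightarrow>
              (\<integral>F. real (card (F \<inter> D)) \<partial>PF) - (\<integral>F. real (card (F \<inter> D)) \<partial>PW)
                = l2_betti \<Gamma> X \<phi> k)"
proof -
  have "is_cw_complex X" using assms(3) by (simp add: cocompact_cw_complex_def)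
  then interpret cw_action X \<Gamma> \<phi>
    by (intro cw_action.intro cw.intro cw_action_axioms.intro assms(1,3))
  show ?thesis
    using expectation_eq_vn_dim[OF assms(4)] expectation_difference[OF assms(4)] by blast
qed

end
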